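(* Let $F\colon[\mathcal{G}_1\rightrightarrows M]\to[\mathcal{H}_1\rightrightarrows M]$ be a topological groupoid extension. Then the associated morphism of topological stacks $F\colon B\mathcal{G}\to B\mathcal{H}$ is a gerbe over the topological stack $B\mathcal{H}$.
   Context: $\mathrm{Top}$ is the category of topological spaces with the open-cover Grothendieck topology; stacks are stacks in groupoids over this site, and $\underline{U}$ is the stack represented by a space $U$. A continuous map $f\colon X\to Y$ admits local sections (is a map of local sections) if there are an open cover $\{U_\alpha\}$ of $Y$ and sections $U_\alpha\to X$ of $f$ for each $\alpha$. A topological groupoid $\mathcal{G}=[\mathcal{G}_1\rightrightarrows\mathcal{G}_0]$ is a groupoid with topological spaces of objects and arrows and continuous structure maps. A topological groupoid extension of $[\mathcal{H}_1\rightrightarrows M]$ is a morphism of topological groupoids $(F,1_M)\colon[\mathcal{G}_1\rightrightarrows M]\to[\mathcal{H}_1\rightrightarrows M]$ (identity on $M$) such that $F\colon\mathcal{G}_1\to\mathcal{H}_1$ admits local sections. A principal $\mathcal{G}$-bundle over a space $N$ is a continuous map $\pi\colon P\to N$ admitting local sections with a continuous right action of $\mathcal{G}$ on $P$ (anchor $a\colon P\to\mathcal{G}_0$; $p\gamma$ defined when $a(p)=t(\gamma)$, $a(p\gamma)=s(\gamma)$) such that $\pi(p\gamma)=\pi(p)$ and $P\times_{a,\mathcal{G}_0,t}\mathcal{G}_1\to P\times_NP$, $(p,\gamma)\mapsto(p,p\gamma)$, is a homeomorphism. $B\mathcal{G}$ is the stack of principal $\mathcal{G}$-bundles; a topological stack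 is a stack over $\mathrm{Top}$ isomorphic to $B\mathcal{G}$ for some topological groupoid $\mathcal{G}$. The morphism $B\mathcal{G}\to B\mathcal{H}$ associated to an extension $F$ sends a principal $\mathcal{G}$-bundle $Q\to N$ with anchor $a$ to $(Q\times_{a,M,t}\mathcal{H}_1)/\mathcal{G}_1\to N$, the quotient for $(x,h)\gamma=(x\gamma,F(\gamma)^{-1}\circ h)$. A morphism $f\colon\mathcal{D}\to\mathcal{C}$ is an epimorphism of topological stacks if for every space $U$ and morphism $\underline{U}\to\mathcal{C}$ there are an open cover $\{U_\alpha\to U\}$ and morphisms $\underline{U_\alpha}\to\mathcal{D}$ making the squares over $\mathcal{C}$ $2$-commutative. A gerbe over a topological stack $\mathcal{C}$ is a morphism $F\colon\mathcal{D}\to\mathcal{C}$ of topological stacks such that $F$ and its diagonal $\Delta_F\colon\mathcal{D}\to\mathcal{D}\times_{\mathcal{C}}\mathcal{D}$ are epimorphisms of topological stacks. *)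

theory Defs
  imports "HOL-Analysis.Analysis"
begin

text \<open>
  Size convention. HOL has no category of all topological spaces, so a type \<open>'u\<close> plays
  the part of the universe of small sets: the site \<open>Top\<close> consists of the topological
  spaces whose points belong to \<open>'u\<close>. The type is a free variable throughout, hence
  arbitrarily large; theorems assume it infinite, so that \<open>'u \<times> 'u\<close> embeds into it and
  fibre products, quotients and gluings over a base space again have copies in \<open>Top\<close>.
\<close>

section \<open>Topological preliminaries\<close>

definition open_cover :: "'a topology \<Rightarrow> 'a set set \<Rightarrow> bool" where
  "open_cover X \<U> \<longleftrightarrow> (\<forall>U\<in>\<U>. openin X U) \<and> \<Union>\<U> = topspace X"

definition admits_local_sections :: "'a topology \<Rightarrow> 'b topology \<Rightarrow> ('a \<Rightarrow> 'b) \<Rightarrow> bool" where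
  "admits_local_sections X Y f \<longleftrightarrow>
     (\<exists>\<U>. open_cover Y \<U> \<and>
        (\<forall>U\<in>\<U>. \<exists>\<sigma>. continuous_map (subtopology Y U) X \<sigma> \<and> (\<forall>y\<in>U. f (\<sigma> y) = y)))"

definition fibprod :: "'a topology \<Rightarrow> 'b topology \<Rightarrow> ('a \<Rightarrow> 'c) \<Rightarrow> ('b \<Rightarrow> 'c) \<Rightarrow> ('a \<times> 'b) topology" where
  "fibprod X Y f g = subtopology (prod_topology X Y) {(x, y). f x = g y}"

definition quotient_topology :: "'a topology \<Rightarrow> ('a \<Rightarrow> 'b) \<Rightarrow> 'b topology" where
  "quotient_topology X q =
     topology (\<lambda>S. S \<subseteq> q ` topspace X \<and> openin X {x \<in> topspace X. q x \<in> S})"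


section \<open>Categories and functors\<close>

text \<open>\<open>Cmp C g f\<close> is the composite \<open>g \<circ> f\<close>, meaningful when \<open>Dom C g = Cod C f\<close>.\<close>

record ('o, 'a) cat =
  Ob :: "'o set"
  Ar :: "'a set"
  Dom :: "'a \<Rightarrow> 'o"
  Cod :: "'a \<Rightarrow> 'o"
  Idt :: "'o \<Rightarrow> 'a"
  Cmp :: "'a \<Rightarrow> 'a \<Rightarrow> 'a"

definition hom_set :: "('o, 'a, 'z) cat_scheme \<Rightarrow> 'o \<Rightarrow> 'o \<Rightarrow> 'a set" where
  "hom_set C x y = {f \<in> Ar C. Dom C f = x \<and> Cod C f = y}"

definition category :: "('o, 'a, 'z) cat_scheme \<Rightarrow> bool" where
  "category C \<longleftrightarrow>
     (\<forall>f\<in>Ar C. Dom C f \<in> Ob C \<and> Cod C f \<in> Ob C) \<and>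
     (\<forall>x\<in>Ob C. Idt C x \<in> hom_set C x x) \<and>
     (\<forall>f\<in>Ar C. \<forall>g\<in>Ar C. Dom C g = Cod C f \<longrightarrow> Cmp C g f \<in> hom_set C (Dom C f) (Cod C g)) \<and>
     (\<forall>f\<in>Ar C. Cmp C f (Idt C (Dom C f)) = f \<and> Cmp C (Idt C (Cod C f)) f = f) \<and>
     (\<forall>f\<in>Ar C. \<forall>g\<in>Ar C. \<forall>h\<in>Ar C. Dom C g = Cod C f \<longrightarrow> Dom C h = Cod C g \<longrightarrow>
        Cmp C h (Cmp C g f) = Cmp C (Cmp C h g) f)"

record ('o, 'a, 'p, 'b) func =
  on_ob :: "'o \<Rightarrow> 'p"
  on_ar :: "'a \<Rightarrow> 'b"

definition is_functor ::
  "('o, 'a, 'y) cat_scheme \<Rightarrow> ('p, 'b, 'z) cat_scheme \<Rightarrow> ('o, 'a, 'p, 'b) func \<Rightarrow> bool" where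
  "is_functor C D F \<longleftrightarrow>
     (\<forall>x\<in>Ob C. on_ob F x \<in> Ob D) \<and>
     (\<forall>f\<in>Ar C. on_ar F f \<in> hom_set D (on_ob F (Dom C f)) (on_ob F (Cod C f))) \<and>
     (\<forall>x\<in>Ob C. on_ar F (Idt C x) = Idt D (on_ob F x)) \<and>
     (\<forall>f\<in>Ar C. \<forall>g\<in>Ar C. Dom C g = Cod C f \<longrightarrow>
        on_ar F (Cmp C g f) = Cmp D (on_ar F g) (on_ar F f))"

definition id_func :: "('o, 'a, 'o, 'a) func" where
  "id_func = \<lparr>on_ob = (\<lambda>x. x), on_ar = (\<lambda>f. f)\<rparr>"

definition comp_func ::
  "('p, 'b, 'q, 'c) func \<Rightarrow> ('o, 'a, 'p, 'b) func \<Rightarrow> ('o, 'a, 'q, 'c) func" where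
  "comp_func G F = \<lparr>on_ob = on_ob G \<circ> on_ob F, on_ar = on_ar G \<circ> on_ar F\<rparr>"


section \<open>The site \<open>Top\<close>\<close>

text \<open>A continuous map, with its source and target; the underlying function is extensional
  so that equality of arrows is equality of maps.\<close>

type_synonym 'u tmap = "'u topology \<times> 'u topology \<times> ('u \<Rightarrow> 'u)"

definition Top :: "('u topology, 'u tmap) cat" where
  "Top = \<lparr>
     Ob = UNIV,
     Ar = {(X, Y, f). continuous_map X Y f \<and> f \<in> extensional (topspace X)},
     Dom = (\<lambda>(X, Y, f). X),
     Cod = (\<lambda>(X, Y, f). Y),
     Idt = (\<lambda>X. (X, X, \<lambda>x\<in>topspace X. x)),
     Cmp = (\<lambda>(Y, Z, g) (X, Y', f). (X, Z, compose (topspace X) g f))\<rparr>"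

text \<open>The inclusion of a subspace \<open>A\<close> of \<open>B\<close>.\<close>

definition incl :: "'u topology \<Rightarrow> 'u topology \<Rightarrow> 'u tmap" where
  "incl A B = (A, B, \<lambda>x\<in>topspace A. x)"


section \<open>Stacks in groupoids over \<open>Top\<close>\<close>

record ('u, 'o, 'a) topcat = "('o, 'a) cat" +
  proj :: "('o, 'a, 'u topology, 'u tmap) func"

abbreviation base_ob :: "('u, 'o, 'a) topcat \<Rightarrow> 'o \<Rightarrow> 'u topology" where
  "base_ob X x \<equiv> on_ob (proj X) x"

abbreviation base_ar :: "('u, 'o, 'a) topcat \<Rightarrow> 'a \<Rightarrow> 'u tmap" where
  "base_ar X f \<equiv> on_ar (proj X) f"

definition fibred_in_groupoids :: "('u, 'o, 'a) topcat \<Rightarrow> bool" where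
  "fibred_in_groupoids X \<longleftrightarrow>
     category X \<and> is_functor X Top (proj X) \<and>
     (\<forall>x\<in>Ob X. \<forall>f\<in>Ar Top. Cod Top f = base_ob X x \<longrightarrow>
        (\<exists>m\<in>Ar X. Cod X m = x \<and> base_ar X m = f)) \<and>
     (\<forall>m\<in>Ar X. \<forall>k\<in>Ar X. \<forall>h\<in>Ar Top.
        Cod X m = Cod X k \<and> Dom Top h = base_ob X (Dom X k) \<and>
        Cod Top h = base_ob X (Dom X m) \<and> Cmp Top (base_ar X m) h = base_ar X k \<longrightarrow>
        (\<exists>!l. l \<in> hom_set X (Dom X k) (Dom X m) \<and> base_ar X l = h \<and> Cmp X m l = k))"

text \<open>
  Descent, without choosing pullbacks: a restriction of \<open>x\<close> to an open \<open>V\<close> is an arrow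
  into \<open>x\<close> over the inclusion of \<open>V\<close>, and a morphism \<open>x|V \<rightarrow> y|V\<close> over \<open>V\<close> is the same as
  an arrow \<open>x|V \<rightarrow> y\<close> over the inclusion of \<open>V\<close>.

  Morphisms: \<open>i V\<close> are restrictions of \<open>x\<close> to the members of the cover and \<open>f V\<close> represents
  \<open>\<phi>\<^sub>V : x|V \<rightarrow> y|V\<close>. The premise on \<open>p\<close>, \<open>q\<close> says that \<open>\<phi>\<^sub>V\<close> and \<open>\<phi>\<^sub>W\<close> agree on \<open>V \<inter> W\<close>.
\<close>

definition morphisms_glue :: "('u, 'o, 'a) topcat \<Rightarrow> bool" where
  "morphisms_glue X \<longleftrightarrow>
     (\<forall>N \<U> x y i f.
        open_cover N \<U> \<and> x \<in> Ob X \<and> y \<in> Ob X \<and> base_ob X x = N \<and> base_ob X y = N \<and>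
        (\<forall>V\<in>\<U>. i V \<in> Ar X \<and> Cod X (i V) = x \<and> base_ar X (i V) = incl (subtopology N V) N) \<and>
        (\<forall>V\<in>\<U>. f V \<in> hom_set X (Dom X (i V)) y \<and> base_ar X (f V) = incl (subtopology N V) N) \<and>
        (\<forall>V\<in>\<U>. \<forall>W\<in>\<U>. \<forall>p\<in>Ar X. \<forall>q\<in>Ar X.
           Dom X p = Dom X q \<and> Cod X p = Dom X (i V) \<and> Cod X q = Dom X (i W) \<and>
           base_ar X p = incl (subtopology N (V \<inter> W)) (subtopology N V) \<and>
           base_ar X q = incl (subtopology N (V \<inter> W)) (subtopology N W) \<and>
           Cmp X (i V) p = Cmp X (i W) q \<longrightarrow>
           Cmp X (f V) p = Cmp X (f W) q) \<longrightarrow>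
        (\<exists>!\<phi>. \<phi> \<in> hom_set X x y \<and> base_ar X \<phi> = Idt Top N \<and> (\<forall>V\<in>\<U>. Cmp X \<phi> (i V) = f V)))"

text \<open>
  Objects: \<open>p V W\<close> is a restriction of \<open>x V\<close> to \<open>V \<inter> W\<close>, and \<open>q V W\<close>, an arrow from the same
  object to \<open>x W\<close>, represents the transition isomorphism \<open>\<phi>\<^sub>V\<^sub>W : x V|V\<inter>W \<rightarrow> x W|V\<inter>W\<close>.
  The premise on \<open>a\<close>, \<open>b\<close>, \<open>c\<close> is the cocycle condition \<open>\<phi>\<^sub>W\<^sub>T \<circ> \<phi>\<^sub>V\<^sub>W = \<phi>\<^sub>V\<^sub>T\<close> on \<open>V \<inter> W \<inter> T\<close>.
\<close>

definition objects_glue :: "('u, 'o, 'a) topcat \<Rightarrow> bool" where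
  "objects_glue X \<longleftrightarrow>
     (\<forall>N \<U> x p q.
        open_cover N \<U> \<and>
        (\<forall>V\<in>\<U>. x V \<in> Ob X \<and> base_ob X (x V) = subtopology N V) \<and>
        (\<forall>V\<in>\<U>. \<forall>W\<in>\<U>.
           p V W \<in> Ar X \<and> q V W \<in> Ar X \<and> Dom X (p V W) = Dom X (q V W) \<and>
           Cod X (p V W) = x V \<and> Cod X (q V W) = x W \<and>
           base_ar X (p V W) = incl (subtopology N (V \<inter> W)) (subtopology N V) \<and>
           base_ar X (q V W) = incl (subtopology N (V \<inter> W)) (subtopology N W)) \<and>
        (\<forall>V\<in>\<U>. \<forall>W\<in>\<U>. \<forall>T\<in>\<U>. \<forall>w\<in>Ob X. \<forall>a b c.
           base_ob X w = subtopology N (V \<inter> W \<inter> T) \<and>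
           a \<in> hom_set X w (Dom X (p V W)) \<and>
           b \<in> hom_set X w (Dom X (p W T)) \<and>
           c \<in> hom_set X w (Dom X (p V T)) \<and>
           base_ar X a = incl (subtopology N (V \<inter> W \<inter> T)) (subtopology N (V \<inter> W)) \<and>
           base_ar X b = incl (subtopology N (V \<inter> W \<inter> T)) (subtopology N (W \<inter> T)) \<and>
           base_ar X c = incl (subtopology N (V \<inter> W \<inter> T)) (subtopology N (V \<inter> T)) \<and>
           Cmp X (p V W) a = Cmp X (p V T) c \<and>
           Cmp X (q V W) a = Cmp X (p W T) b \<longrightarrow>
           Cmp X (q W T) b = Cmp X (q V T) c) \<longrightarrow>
        (\<exists>z i. z \<in> Ob X \<and> base_ob X z = N \<and>
           (\<forall>V\<in>\<U>. i V \<in> hom_set X (x V) z \<and> base_ar X (i V) = incl (subtopology N V) N) \<and>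
           (\<forall>V\<in>\<U>. \<forall>W\<in>\<U>. Cmp X (i V) (p V W) = Cmp X (i W) (q V W))))"

definition stack :: "('u, 'o, 'a) topcat \<Rightarrow> bool" where
  "stack X \<longleftrightarrow> fibred_in_groupoids X \<and> morphisms_glue X \<and> objects_glue X"

definition stack_morphism ::
  "('u, 'o, 'a) topcat \<Rightarrow> ('u, 'p, 'b) topcat \<Rightarrow> ('o, 'a, 'p, 'b) func \<Rightarrow> bool" where
  "stack_morphism X Y F \<longleftrightarrow>
     is_functor X Y F \<and>
     (\<forall>x\<in>Ob X. base_ob Y (on_ob F x) = base_ob X x) \<and>
     (\<forall>f\<in>Ar X. base_ar Y (on_ar F f) = base_ar X f)"

text \<open>Natural transformations over \<open>Top\<close>. All arrows over identities of a category fibred in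
  groupoids are invertible, so these are the 2-isomorphisms.\<close>

definition two_morphism ::
  "('u, 'o, 'a) topcat \<Rightarrow> ('u, 'p, 'b) topcat \<Rightarrow>
   ('o, 'a, 'p, 'b) func \<Rightarrow> ('o, 'a, 'p, 'b) func \<Rightarrow> ('o \<Rightarrow> 'b) \<Rightarrow> bool" where
  "two_morphism X Y F G \<eta> \<longleftrightarrow>
     (\<forall>x\<in>Ob X. \<eta> x \<in> hom_set Y (on_ob F x) (on_ob G x) \<and>
        base_ar Y (\<eta> x) = Idt Top (base_ob X x)) \<and>
     (\<forall>f\<in>Ar X. Cmp Y (on_ar G f) (\<eta> (Dom X f)) = Cmp Y (\<eta> (Cod X f)) (on_ar F f))"

definition isomorphic_stacks :: "('u, 'o, 'a) topcat \<Rightarrow> ('u, 'p, 'b) topcat \<Rightarrow> bool" where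
  "isomorphic_stacks X Y \<longleftrightarrow>
     (\<exists>F G \<eta> \<epsilon>. stack_morphism X Y F \<and> stack_morphism Y X G \<and>
        two_morphism X X (comp_func G F) id_func \<eta> \<and>
        two_morphism Y Y (comp_func F G) id_func \<epsilon>)"

text \<open>The stack represented by a space: the slice category \<open>Top/U\<close>. The pair \<open>(g, f)\<close> is the
  arrow from \<open>f \<circ> g\<close> to \<open>f\<close> given by \<open>g\<close>.\<close>

definition representable :: "'u topology \<Rightarrow> ('u, 'u tmap, 'u tmap \<times> 'u tmap) topcat" where
  "representable U = \<lparr>
     Ob = {f \<in> Ar Top. Cod Top f = U},
     Ar = {(g, f). g \<in> Ar Top \<and> f \<in> Ar Top \<and> Cod Top f = U \<and> Dom Top f = Cod Top g},
     Dom = (\<lambda>(g, f). Cmp Top f g),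
     Cod = (\<lambda>(g, f). f),
     Idt = (\<lambda>f. (Idt Top (Dom Top f), f)),
     Cmp = (\<lambda>(g', f') (g, f). (Cmp Top g' g, f')),
     proj = \<lparr>on_ob = Dom Top, on_ar = fst\<rparr>\<rparr>"

definition representable_map ::
  "'u tmap \<Rightarrow> ('u tmap, 'u tmap \<times> 'u tmap, 'u tmap, 'u tmap \<times> 'u tmap) func" where
  "representable_map j = \<lparr>on_ob = (\<lambda>f. Cmp Top j f), on_ar = (\<lambda>(g, f). (g, Cmp Top j f))\<rparr>"

definition epimorphism ::
  "('u, 'o, 'a) topcat \<Rightarrow> ('u, 'p, 'b) topcat \<Rightarrow> ('o, 'a, 'p, 'b) func \<Rightarrow> bool" where
  "epimorphism D C f \<longleftrightarrow>
     stack_morphism D C f \<and>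
     (\<forall>U u. stack_morphism (representable U) C u \<longrightarrow>
        (\<exists>\<U>. open_cover U \<U> \<and>
           (\<forall>V\<in>\<U>. \<exists>v \<eta>.
              stack_morphism (representable (subtopology U V)) D v \<and>
              two_morphism (representable (subtopology U V)) C
                (comp_func f v) (comp_func u (representable_map (incl (subtopology U V) U))) \<eta>)))"

text \<open>The 2-fibre product \<open>D \<times>\<^bsub>C\<^esub> D\<close> of \<open>F : D \<rightarrow> C\<close> with itself: objects are triples
  \<open>(x, y, \<phi> : F x \<rightarrow> F y)\<close> with \<open>\<phi>\<close> over an identity; arrows carry their source and target.\<close>

type_synonym ('o, 'b) fpob = "'o \<times> 'o \<times> 'b"
type_synonym ('o, 'a, 'b) fpar = "('o, 'b) fpob \<times> ('o, 'b) fpob \<times> 'a \<times> 'a"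

definition self_fibre_product ::
  "('u, 'o, 'a) topcat \<Rightarrow> ('u, 'p, 'b) topcat \<Rightarrow> ('o, 'a, 'p, 'b) func \<Rightarrow>
   ('u, ('o, 'b) fpob, ('o, 'a, 'b) fpar) topcat" where
  "self_fibre_product D C F = (let
     objects = {(x, y, \<phi>). x \<in> Ob D \<and> y \<in> Ob D \<and> base_ob D x = base_ob D y \<and>
        \<phi> \<in> hom_set C (on_ob F x) (on_ob F y) \<and> base_ar C \<phi> = Idt Top (base_ob D x)}
   in \<lparr>
     Ob = objects,
     Ar = {((x, y, \<phi>), (x', y', \<phi>'), (a, b)).
        (x, y, \<phi>) \<in> objects \<and> (x', y', \<phi>') \<in> objects \<and>
        a \<in> hom_set D x x' \<and> b \<in> hom_set D y y' \<and> base_ar D a = base_ar D b \<and>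
        Cmp C \<phi>' (on_ar F a) = Cmp C (on_ar F b) \<phi>},
     Dom = (\<lambda>(s, t, ab). s),
     Cod = (\<lambda>(s, t, ab). t),
     Idt = (\<lambda>(x, y, \<phi>). ((x, y, \<phi>), (x, y, \<phi>), (Idt D x, Idt D y))),
     Cmp = (\<lambda>(s', t', (a', b')) (s, t, (a, b)). (s, t', (Cmp D a' a, Cmp D b' b))),
     proj = \<lparr>on_ob = (\<lambda>(x, y, \<phi>). base_ob D x), on_ar = (\<lambda>(s, t, (a, b)). base_ar D a)\<rparr>\<rparr>)"

definition diagonal ::
  "('u, 'o, 'a) topcat \<Rightarrow> ('u, 'p, 'b) topcat \<Rightarrow> ('o, 'a, 'p, 'b) func \<Rightarrow>
   ('o, 'a, ('o, 'b) fpob, ('o, 'a, 'b) fpar) func" where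
  "diagonal D C F = (let
     \<Delta> = (\<lambda>x. (x, x, Idt C (on_ob F x)))
   in \<lparr>on_ob = \<Delta>, on_ar = (\<lambda>a. (\<Delta> (Dom D a), \<Delta> (Cod D a), (a, a)))\<rparr>)"


section \<open>Topological groupoids and principal bundles\<close>

text \<open>\<open>gcomp G g h\<close> is \<open>g \<circ> h\<close>, meaningful when \<open>gsrc G g = gtgt G h\<close>.\<close>

record 'u tgpd =
  gobj :: "'u topology"
  garr :: "'u topology"
  gsrc :: "'u \<Rightarrow> 'u"
  gtgt :: "'u \<Rightarrow> 'u"
  gunit :: "'u \<Rightarrow> 'u"
  ginv :: "'u \<Rightarrow> 'u"
  gcomp :: "'u \<Rightarrow> 'u \<Rightarrow> 'u"

definition topological_groupoid :: "'u tgpd \<Rightarrow> bool" where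
  "topological_groupoid G \<longleftrightarrow>
     continuous_map (garr G) (gobj G) (gsrc G) \<and>
     continuous_map (garr G) (gobj G) (gtgt G) \<and>
     continuous_map (gobj G) (garr G) (gunit G) \<and>
     continuous_map (garr G) (garr G) (ginv G) \<and>
     continuous_map (fibprod (garr G) (garr G) (gsrc G) (gtgt G)) (garr G)
       (\<lambda>(g, h). gcomp G g h) \<and>
     (\<forall>x\<in>topspace (gobj G). gsrc G (gunit G x) = x \<and> gtgt G (gunit G x) = x) \<and>
     (\<forall>g\<in>topspace (garr G). \<forall>h\<in>topspace (garr G). gsrc G g = gtgt G h \<longrightarrow>
        gsrc G (gcomp G g h) = gsrc G h \<and> gtgt G (gcomp G g h) = gtgt G g) \<and>
     (\<forall>g\<in>topspace (garr G). \<forall>h\<in>topspace (garr G). \<forall>k\<in>topspace (garr G).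
        gsrc G g = gtgt G h \<longrightarrow> gsrc G h = gtgt G k \<longrightarrow>
        gcomp G g (gcomp G h k) = gcomp G (gcomp G g h) k) \<and>
     (\<forall>g\<in>topspace (garr G).
        gcomp G g (gunit G (gsrc G g)) = g \<and> gcomp G (gunit G (gtgt G g)) g = g \<and>
        gsrc G (ginv G g) = gtgt G g \<and> gtgt G (ginv G g) = gsrc G g \<and>
        gcomp G g (ginv G g) = gunit G (gtgt G g) \<and>
        gcomp G (ginv G g) g = gunit G (gsrc G g))"

definition groupoid_extension :: "'u tgpd \<Rightarrow> 'u tgpd \<Rightarrow> ('u \<Rightarrow> 'u) \<Rightarrow> bool" where
  "groupoid_extension G H F \<longleftrightarrow>
     topological_groupoid G \<and> topological_groupoid H \<and> gobj G = gobj H \<and>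
     continuous_map (garr G) (garr H) F \<and>
     (\<forall>g\<in>topspace (garr G). gsrc H (F g) = gsrc G g \<and> gtgt H (F g) = gtgt G g) \<and>
     (\<forall>x\<in>topspace (gobj G). F (gunit G x) = gunit H x) \<and>
     (\<forall>g\<in>topspace (garr G). \<forall>h\<in>topspace (garr G). gsrc G g = gtgt G h \<longrightarrow>
        F (gcomp G g h) = gcomp H (F g) (F h)) \<and>
     admits_local_sections (garr G) (garr H) F"

record 'u pbundle =
  btot :: "'u topology"
  bbase :: "'u topology"
  bproj :: "'u \<Rightarrow> 'u"
  banch :: "'u \<Rightarrow> 'u"
  bact :: "'u \<Rightarrow> 'u \<Rightarrow> 'u"

text \<open>The maps of a bundle are not required to be extensional: two records that agree where they
  matter are isomorphic objects of the stack \<open>BG\<close> of principal \<open>G\<close>-bundles, \<open>classifying_stack G\<close>.\<close>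

definition principal_bundle :: "'u tgpd \<Rightarrow> 'u pbundle \<Rightarrow> bool" where
  "principal_bundle G P \<longleftrightarrow>
     continuous_map (btot P) (bbase P) (bproj P) \<and>
     admits_local_sections (btot P) (bbase P) (bproj P) \<and>
     continuous_map (btot P) (gobj G) (banch P) \<and>
     continuous_map (fibprod (btot P) (garr G) (banch P) (gtgt G)) (btot P)
       (\<lambda>(p, \<gamma>). bact P p \<gamma>) \<and>
     (\<forall>p\<in>topspace (btot P). bact P p (gunit G (banch P p)) = p) \<and>
     (\<forall>p\<in>topspace (btot P). \<forall>\<gamma>\<in>topspace (garr G). banch P p = gtgt G \<gamma> \<longrightarrow>
        banch P (bact P p \<gamma>) = gsrc G \<gamma> \<and> bproj P (bact P p \<gamma>) = bproj P p) \<and>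
     (\<forall>p\<in>topspace (btot P). \<forall>\<gamma>\<in>topspace (garr G). \<forall>\<delta>\<in>topspace (garr G).
        banch P p = gtgt G \<gamma> \<longrightarrow> gsrc G \<gamma> = gtgt G \<delta> \<longrightarrow>
        bact P (bact P p \<gamma>) \<delta> = bact P p (gcomp G \<gamma> \<delta>)) \<and>
     homeomorphic_map
       (fibprod (btot P) (garr G) (banch P) (gtgt G))
       (fibprod (btot P) (btot P) (bproj P) (bproj P))
       (\<lambda>(p, \<gamma>). (p, bact P p \<gamma>))"

text \<open>Arrows \<open>(P, Q, \<phi>, f)\<close>: an equivariant continuous map \<open>\<phi>\<close> of total spaces covering the
  continuous map \<open>f\<close> of bases.\<close>

type_synonym 'u bundle_map = "'u pbundle \<times> 'u pbundle \<times> ('u \<Rightarrow> 'u) \<times> ('u \<Rightarrow> 'u)"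

definition bundle_maps :: "'u tgpd \<Rightarrow> 'u bundle_map set" where
  "bundle_maps G = {(P, Q, \<phi>, f).
     principal_bundle G P \<and> principal_bundle G Q \<and>
     continuous_map (btot P) (btot Q) \<phi> \<and> \<phi> \<in> extensional (topspace (btot P)) \<and>
     continuous_map (bbase P) (bbase Q) f \<and> f \<in> extensional (topspace (bbase P)) \<and>
     (\<forall>p\<in>topspace (btot P). bproj Q (\<phi> p) = f (bproj P p) \<and> banch Q (\<phi> p) = banch P p) \<and>
     (\<forall>p\<in>topspace (btot P). \<forall>\<gamma>\<in>topspace (garr G). banch P p = gtgt G \<gamma> \<longrightarrow>
        \<phi> (bact P p \<gamma>) = bact Q (\<phi> p) \<gamma>)}"

definition classifying_stack :: "'u tgpd \<Rightarrow> ('u, 'u pbundle, 'u bundle_map) topcat" where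
  "classifying_stack G = \<lparr>
     Ob = {P. principal_bundle G P},
     Ar = bundle_maps G,
     Dom = (\<lambda>(P, Q, \<phi>, f). P),
     Cod = (\<lambda>(P, Q, \<phi>, f). Q),
     Idt = (\<lambda>P. (P, P, \<lambda>p\<in>topspace (btot P). p, \<lambda>x\<in>topspace (bbase P). x)),
     Cmp = (\<lambda>(Q', R, \<psi>, g) (P, Q, \<phi>, f).
        (P, R, compose (topspace (btot P)) \<psi> \<phi>, compose (topspace (bbase P)) g f)),
     proj = \<lparr>on_ob = bbase, on_ar = (\<lambda>(P, Q, \<phi>, f). (bbase P, bbase Q, f))\<rparr>\<rparr>"

definition topological_stack :: "('u, 'o, 'a) topcat \<Rightarrow> bool" where
  "topological_stack X \<longleftrightarrow>
     stack X \<and> (\<exists>G :: 'u tgpd. topological_groupoid G \<and> isomorphic_stacks X (classifying_stack G))"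


section \<open>The morphism associated to an extension\<close>

text \<open>
  The orbit space of \<open>Q \<times> H\<^sub>1\<close> must have its points in \<open>'u\<close>. An orbit is therefore named by
  the code of one of its members, for a fixed injection \<open>pair_code\<close>; decoding the name of an
  orbit yields a representative \<open>(x, h)\<close>.
\<close>

definition pair_code :: "'u \<times> 'u \<Rightarrow> 'u" where
  "pair_code = (SOME e. inj e)"

definition assoc_orbit ::
  "'u tgpd \<Rightarrow> 'u tgpd \<Rightarrow> ('u \<Rightarrow> 'u) \<Rightarrow> 'u pbundle \<Rightarrow> 'u \<times> 'u \<Rightarrow> ('u \<times> 'u) set" where
  "assoc_orbit G H F Q = (\<lambda>(x, h).
     {(bact Q x \<gamma>, gcomp H (ginv H (F \<gamma>)) h) |\<gamma>. \<gamma> \<in> topspace (garr G) \<and> gtgt G \<gamma> = banch Q x})"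

definition assoc_class ::
  "'u tgpd \<Rightarrow> 'u tgpd \<Rightarrow> ('u \<Rightarrow> 'u) \<Rightarrow> 'u pbundle \<Rightarrow> 'u \<times> 'u \<Rightarrow> 'u" where
  "assoc_class G H F Q z = pair_code (SOME w. w \<in> assoc_orbit G H F Q z)"

definition assoc_rep :: "'u \<Rightarrow> 'u \<times> 'u" where
  "assoc_rep = inv pair_code"

definition assoc_bundle ::
  "'u tgpd \<Rightarrow> 'u tgpd \<Rightarrow> ('u \<Rightarrow> 'u) \<Rightarrow> 'u pbundle \<Rightarrow> 'u pbundle" where
  "assoc_bundle G H F Q = \<lparr>
     btot = quotient_topology (fibprod (btot Q) (garr H) (banch Q) (gtgt H)) (assoc_class G H F Q),
     bbase = bbase Q,
     bproj = (\<lambda>c. bproj Q (fst (assoc_rep c))),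
     banch = (\<lambda>c. gsrc H (snd (assoc_rep c))),
     bact = (\<lambda>c k. case assoc_rep c of (x, h) \<Rightarrow> assoc_class G H F Q (x, gcomp H h k))\<rparr>"

definition assoc_morphism ::
  "'u tgpd \<Rightarrow> 'u tgpd \<Rightarrow> ('u \<Rightarrow> 'u) \<Rightarrow>
   ('u pbundle, 'u bundle_map, 'u pbundle, 'u bundle_map) func" where
  "assoc_morphism G H F = \<lparr>
     on_ob = assoc_bundle G H F,
     on_ar = (\<lambda>(P, Q, \<phi>, f).
       (assoc_bundle G H F P, assoc_bundle G H F Q,
        \<lambda>c\<in>topspace (btot (assoc_bundle G H F P)).
          case assoc_rep c of (x, h) \<Rightarrow> assoc_class G H F Q (\<phi> x, h),
        f))\<rparr>"


section \<open>Gerbes\<close>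

definition gerbe ::
  "('u, 'o, 'a) topcat \<Rightarrow> ('u, 'p, 'b) topcat \<Rightarrow> ('o, 'a, 'p, 'b) func \<Rightarrow> bool" where
  "gerbe D C F \<longleftrightarrow>
     topological_stack D \<and> topological_stack C \<and> stack_morphism D C F \<and>
     epimorphism D C F \<and>
     epimorphism D (self_fibre_product D C F) (diagonal D C F)"

end

theory Submission
  imports Defs
begin

text \<open>
  A bundle map is bijective on fibres, with an inverse that depends continuously on the point, so bundle
  maps are cartesian and can be glued from maps over an open cover; bundles are glued by the usual clutching
  construction. Hence \<open>BG\<close> is a stack. An object of a category fibred in groupoids over a space is a
  morphism from the represented stack, so a morphism of stacks is an epimorphism as soon as every object of
  the target lifts locally on its base. For \<open>BG \<rightarrow> BH\<close> a local section \<open>\<sigma>\<close> of an \<open>H\<close>-bundle exhibits it as the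
  bundle associated to the trivial \<open>G\<close>-bundle with anchor \<open>a \<circ> \<sigma>\<close>. For the diagonal, a map between the
  associated bundles of two \<open>G\<close>-bundles is locally given, after choosing sections of both, by a continuous
  map into \<open>H\<^sub>1\<close>, which lifts locally to \<open>G\<^sub>1\<close> because \<open>F\<close> admits local sections.
\<close>

section \<open>Topological preliminaries\<close>

text \<open>Two obstacles shape the details. Every total space must have its points in
  \<open>'u\<close>, so an orbit is named by one arbitrarily chosen member, and decoding such a name
  need not be continuous. Moreover the action and the comparison of two points of a fibre live on
  fibre products, and a product of quotient maps need not be a quotient map, so their continuity
  cannot be tested on representatives. The remedy is a local section or a chart: it supplies
  continuous representatives over an open set, where the operation is a composite of continuous
  maps. The homeomorphism in the definition of a principal bundle is handled through its inverse,
  the arrow \<open>division G P p q\<close> that carries p to q. Fibre inverses of bundle maps, the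
  orbit relation and the lifting problem for the diagonal all become formulas in such arrows. The
  groupoids G and H share their objects, so the anchor of an H-bundle can also serve as the anchor
  of a G-bundle; it is only for arrows, that is for the diagonal, that something has to be lifted
  along F.\<close>

lemma topspace_fibprod [simp]:
  "topspace (fibprod X Y f g) = {(x, y). x \<in> topspace X \<and> y \<in> topspace Y \<and> f x = g y}"
  by (auto simp: fibprod_def)

lemma continuous_map_into_fibprod:
  assumes "continuous_map Z X a" "continuous_map Z Y b" "\<And>z. z \<in> topspace Z \<Longrightarrow> f (a z) = g (b z)"
  shows "continuous_map Z (fibprod X Y f g) (\<lambda>z. (a z, b z))"
  unfolding fibprod_def continuous_map_in_subtopology
  using assms by (auto simp: continuous_map_paired)

lemma continuous_map_compose_apply:
  "continuous_map Y W g \<Longrightarrow> continuous_map Z Y f \<Longrightarrow> continuous_map Z W (\<lambda>z. g (f z))"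
  using continuous_map_compose[of Z Y f W g] by (simp add: o_def)

lemma continuous_map_fibprod_fst: "continuous_map (fibprod X Y f g) X fst"
  unfolding fibprod_def by (intro continuous_map_from_subtopology continuous_map_fst)

lemma continuous_map_fibprod_snd: "continuous_map (fibprod X Y f g) Y snd"
  unfolding fibprod_def by (intro continuous_map_from_subtopology continuous_map_snd)

lemma continuous_map_compose_subtopology:
  assumes "continuous_map (subtopology Y V) W g" "continuous_map Z Y f"
    and "\<And>z. z \<in> topspace Z \<Longrightarrow> f z \<in> V"
  shows "continuous_map Z W (\<lambda>z. g (f z))"
  by (rule continuous_map_compose_apply[OF assms(1)])
     (use assms in \<open>auto simp: continuous_map_in_subtopology\<close>)

lemma continuous_map_locally:
  assumes "\<And>z. z \<in> topspace Z \<Longrightarrow> \<exists>U. openin Z U \<and> z \<in> U \<and> continuous_map (subtopology Z U) Y f"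
  shows "continuous_map Z Y f"
proof -
  obtain U where U: "\<And>z. z \<in> topspace Z \<Longrightarrow> openin Z (U z) \<and> z \<in> U z \<and> continuous_map (subtopology Z (U z)) Y f"
    using assms by metis
  show ?thesis
    by (rule pasting_lemma[where I = "topspace Z" and T = U and f = "\<lambda>_. f"]) (use U in auto)
qed

lemma continuous_map_cong_topspace:
  "continuous_map X Y f \<Longrightarrow> (\<And>x. x \<in> topspace X \<Longrightarrow> f x = g x) \<Longrightarrow> continuous_map X Y g"
  by (rule continuous_map_eq)

lemma continuous_map_topspace: "continuous_map X Y f \<Longrightarrow> x \<in> topspace X \<Longrightarrow> f x \<in> topspace Y"
  by (auto simp: continuous_map_def)

text \<open>The constructor \<open>topology\<close> carries information only for families satisfying
  \<open>istopology\<close>; this holds because preimages commute with intersections and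
  unions.\<close>

lemma openin_quotient_topology:
  "openin (quotient_topology X q) S \<longleftrightarrow> S \<subseteq> q ` topspace X \<and> openin X {x \<in> topspace X. q x \<in> S}"
proof -
  have "istopology (\<lambda>S. S \<subseteq> q ` topspace X \<and> openin X {x \<in> topspace X. q x \<in> S})"
    unfolding istopology_def
  proof (rule conjI; clarify)
    fix S T assume "openin X {x \<in> topspace X. q x \<in> S}" "openin X {x \<in> topspace X. q x \<in> T}"
    moreover have "{x \<in> topspace X. q x \<in> S \<inter> T} = {x \<in> topspace X. q x \<in> S} \<inter> {x \<in> topspace X. q x \<in> T}"
      by auto
    moreover assume "S \<subseteq> q ` topspace X"
    ultimately show "S \<inter> T \<subseteq> q ` topspace X \<and> openin X {x \<in> topspace X. q x \<in> S \<inter> T}"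
      by auto
  next
    fix \<K> assume K: "\<forall>K\<in>\<K>. K \<subseteq> q ` topspace X \<and> openin X {x \<in> topspace X. q x \<in> K}"
    moreover have "{x \<in> topspace X. q x \<in> \<Union>\<K>} = (\<Union>K\<in>\<K>. {x \<in> topspace X. q x \<in> K})"
      by auto
    ultimately show "\<Union>\<K> \<subseteq> q ` topspace X \<and> openin X {x \<in> topspace X. q x \<in> \<Union>\<K>}"
      by (auto intro!: openin_Union)
  qed
  then show ?thesis
    by (simp add: quotient_topology_def topology_inverse')
qed

lemma topspace_quotient_topology [simp]: "topspace (quotient_topology X q) = q ` topspace X"
proof -
  have "openin (quotient_topology X q) (q ` topspace X)"
    unfolding openin_quotient_topology by (auto intro: openin_subopen[THEN iffD2])
  then have "q ` topspace X \<subseteq> topspace (quotient_topology X q)" by (rule openin_subset)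
  moreover have "topspace (quotient_topology X q) \<subseteq> q ` topspace X"
    using openin_topspace[of "quotient_topology X q"] unfolding openin_quotient_topology by blast
  ultimately show ?thesis by blast
qed

lemma quotient_map_quotient_topology: "quotient_map X (quotient_topology X q) q"
  unfolding quotient_map_def by (auto simp: openin_quotient_topology)

lemma continuous_map_quotient_topology: "continuous_map X (quotient_topology X q) q"
  by (simp add: quotient_imp_continuous_map quotient_map_quotient_topology)

lemma continuous_map_from_quotient_topology:
  "continuous_map X Y (\<lambda>x. f (q x)) \<Longrightarrow> continuous_map (quotient_topology X q) Y f"
  by (rule continuous_compose_quotient_map[OF quotient_map_quotient_topology]) (simp add: o_def)

text \<open>A quotient map restricted to the preimage of an open set is again a quotient map. This
  serves functions that are under control over an open set only.\<close>

lemma continuous_map_from_open_quotient_topology: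
  assumes "openin (quotient_topology X q) V"
    and "continuous_map (subtopology X {x \<in> topspace X. q x \<in> V}) Y (\<lambda>x. f (q x))"
  shows "continuous_map (subtopology (quotient_topology X q) V) Y f"
  by (rule continuous_compose_quotient_map[OF quotient_map_restriction[OF quotient_map_quotient_topology refl]])
     (use assms in \<open>simp_all add: o_def\<close>)

section \<open>Local sections, one point at a time\<close>

lemma admits_local_sectionsD:
  assumes "admits_local_sections X Y f" "y \<in> topspace Y"
  obtains U \<sigma> where "openin Y U" "y \<in> U" "continuous_map (subtopology Y U) X \<sigma>" "\<And>z. z \<in> U \<Longrightarrow> f (\<sigma> z) = z"
  using assms unfolding admits_local_sections_def open_cover_def by (metis UnionE)

lemma admits_local_sectionsI:
  assumes "\<And>y. y \<in> topspace Y \<Longrightarrow>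
    \<exists>U \<sigma>. openin Y U \<and> y \<in> U \<and> continuous_map (subtopology Y U) X \<sigma> \<and> (\<forall>z\<in>U. f (\<sigma> z) = z)"
  shows "admits_local_sections X Y f"
  unfolding admits_local_sections_def open_cover_def
proof (intro exI conjI)
  let ?U = "{U. openin Y U \<and> (\<exists>\<sigma>. continuous_map (subtopology Y U) X \<sigma> \<and> (\<forall>z\<in>U. f (\<sigma> z) = z))}"
  show "\<forall>U\<in>?U. openin Y U" by simp
  show "\<Union>?U = topspace Y"
  proof (rule equalityI; rule subsetI)
    fix y assume "y \<in> topspace Y"
    from assms[OF this] show "y \<in> \<Union>?U" by blast
  qed (auto dest: openin_subset)
  show "\<forall>U\<in>?U. \<exists>\<sigma>. continuous_map (subtopology Y U) X \<sigma> \<and> (\<forall>y\<in>U. f (\<sigma> y) = y)" by simp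
qed


section \<open>Topological groupoids\<close>

locale topgpd =
  fixes G :: "'u tgpd"
  assumes topological_groupoid: "topological_groupoid G"
begin

abbreviation "arr \<equiv> topspace (garr G)"
abbreviation "obj \<equiv> topspace (gobj G)"
abbreviation src where "src \<equiv> gsrc G"
abbreviation tgt where "tgt \<equiv> gtgt G"
abbreviation unt where "unt \<equiv> gunit G"
abbreviation inw where "inw \<equiv> ginv G"
abbreviation cmp where "cmp \<equiv> gcomp G"

lemma continuous_src: "continuous_map (garr G) (gobj G) src"
  and continuous_tgt: "continuous_map (garr G) (gobj G) tgt"
  and continuous_unt: "continuous_map (gobj G) (garr G) unt"
  and continuous_inw: "continuous_map (garr G) (garr G) inw"
  using topological_groupoid unfolding topological_groupoid_def by blast+

lemma continuous_cmp:
  assumes "continuous_map Z (garr G) a" "continuous_map Z (garr G) b"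
    "\<And>z. z \<in> topspace Z \<Longrightarrow> src (a z) = tgt (b z)"
  shows "continuous_map Z (garr G) (\<lambda>z. cmp (a z) (b z))"
proof -
  have "continuous_map (fibprod (garr G) (garr G) src tgt) (garr G) (\<lambda>(g, h). cmp g h)"
    using topological_groupoid unfolding topological_groupoid_def by blast
  from continuous_map_compose_apply[OF this continuous_map_into_fibprod[where f = src and g = tgt, OF assms]]
  show ?thesis by simp
qed

lemma src_in [simp]: "g \<in> arr \<Longrightarrow> src g \<in> obj"
  and tgt_in [simp]: "g \<in> arr \<Longrightarrow> tgt g \<in> obj"
  and unt_in [simp]: "x \<in> obj \<Longrightarrow> unt x \<in> arr"
  and inw_in [simp]: "g \<in> arr \<Longrightarrow> inw g \<in> arr"
  using continuous_src continuous_tgt continuous_unt continuous_inw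
  by (auto simp: continuous_map_def)

lemma cmp_in [simp]: "g \<in> arr \<Longrightarrow> h \<in> arr \<Longrightarrow> src g = tgt h \<Longrightarrow> cmp g h \<in> arr"
  using topological_groupoid unfolding topological_groupoid_def continuous_map_def
  by (auto simp: Pi_iff)

lemma src_unt [simp]: "x \<in> obj \<Longrightarrow> src (unt x) = x"
  and tgt_unt [simp]: "x \<in> obj \<Longrightarrow> tgt (unt x) = x"
  and src_cmp [simp]: "g \<in> arr \<Longrightarrow> h \<in> arr \<Longrightarrow> src g = tgt h \<Longrightarrow> src (cmp g h) = src h"
  and tgt_cmp [simp]: "g \<in> arr \<Longrightarrow> h \<in> arr \<Longrightarrow> src g = tgt h \<Longrightarrow> tgt (cmp g h) = tgt g"
  and cmp_assoc: "g \<in> arr \<Longrightarrow> h \<in> arr \<Longrightarrow> k \<in> arr \<Longrightarrow> src g = tgt h \<Longrightarrow> src h = tgt k \<Longrightarrow>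
        cmp (cmp g h) k = cmp g (cmp h k)"
  and src_inw [simp]: "g \<in> arr \<Longrightarrow> src (inw g) = tgt g"
  and tgt_inw [simp]: "g \<in> arr \<Longrightarrow> tgt (inw g) = src g"
  using topological_groupoid unfolding topological_groupoid_def by (blast, blast, blast, blast, metis, blast, blast)

lemma cmp_unt_right [simp]: "g \<in> arr \<Longrightarrow> src g = x \<Longrightarrow> cmp g (unt x) = g"
  and cmp_unt_left [simp]: "g \<in> arr \<Longrightarrow> tgt g = x \<Longrightarrow> cmp (unt x) g = g"
  and cmp_inw_right [simp]: "g \<in> arr \<Longrightarrow> cmp g (inw g) = unt (tgt g)"
  and cmp_inw_left [simp]: "g \<in> arr \<Longrightarrow> cmp (inw g) g = unt (src g)"
  using topological_groupoid unfolding topological_groupoid_def by (blast, blast, blast, blast)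

lemma cmp_cancel1 [simp]: "g \<in> arr \<Longrightarrow> h \<in> arr \<Longrightarrow> src g = tgt h \<Longrightarrow> cmp (inw g) (cmp g h) = h"
  by (simp flip: cmp_assoc)

lemma cmp_cancel2 [simp]: "g \<in> arr \<Longrightarrow> h \<in> arr \<Longrightarrow> tgt g = tgt h \<Longrightarrow> cmp g (cmp (inw g) h) = h"
  by (simp flip: cmp_assoc)

lemma cmp_left_cancel:
  "cmp g h = cmp g k \<Longrightarrow> g \<in> arr \<Longrightarrow> h \<in> arr \<Longrightarrow> k \<in> arr \<Longrightarrow> src g = tgt h \<Longrightarrow> src g = tgt k \<Longrightarrow> h = k"
  by (metis cmp_cancel1)

lemma inw_eqI:
  "cmp g h = unt (tgt g) \<Longrightarrow> g \<in> arr \<Longrightarrow> h \<in> arr \<Longrightarrow> src g = tgt h \<Longrightarrow> inw g = h"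
  by (metis cmp_cancel1 cmp_unt_right src_inw inw_in)

lemma inw_unt [simp]: "x \<in> obj \<Longrightarrow> inw (unt x) = unt x"
  by (rule inw_eqI) auto

end


section \<open>Principal bundles\<close>

abbreviation pts :: "'u pbundle \<Rightarrow> 'u set" where
  "pts P \<equiv> topspace (btot P)"

text \<open>The translation function of the bundle. The description is definite when p and q lie in
  one fibre, by principality.\<close>

definition division :: "'u tgpd \<Rightarrow> 'u pbundle \<Rightarrow> 'u \<Rightarrow> 'u \<Rightarrow> 'u" where
  "division G P p q = (THE \<gamma>. \<gamma> \<in> topspace (garr G) \<and> banch P p = gtgt G \<gamma> \<and> bact P p \<gamma> = q)"

context topgpd
begin

lemma
  assumes "principal_bundle G P"
  shows continuous_bproj: "continuous_map (btot P) (bbase P) (bproj P)"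
    and continuous_banch: "continuous_map (btot P) (gobj G) (banch P)"
    and bproj_local_sections: "admits_local_sections (btot P) (bbase P) (bproj P)"
  using assms unfolding principal_bundle_def by blast+

lemma continuous_bact:
  assumes "principal_bundle G P" "continuous_map Z (btot P) a" "continuous_map Z (garr G) b"
    "\<And>z. z \<in> topspace Z \<Longrightarrow> banch P (a z) = tgt (b z)"
  shows "continuous_map Z (btot P) (\<lambda>z. bact P (a z) (b z))"
proof -
  have "continuous_map (fibprod (btot P) (garr G) (banch P) tgt) (btot P) (\<lambda>(p, \<gamma>). bact P p \<gamma>)"
    using assms(1) unfolding principal_bundle_def by blast
  from continuous_map_compose_apply[OF this continuous_map_into_fibprod[where f = "banch P" and g = tgt, OF assms(2-)]]
  show ?thesis by simp
qed

lemma bproj_in [simp]: "principal_bundle G P \<Longrightarrow> p \<in> pts P \<Longrightarrow> bproj P p \<in> topspace (bbase P)"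
  and banch_in [simp]: "principal_bundle G P \<Longrightarrow> p \<in> pts P \<Longrightarrow> banch P p \<in> obj"
  by (meson continuous_map_topspace continuous_bproj continuous_banch)+

lemma bact_in [simp]:
  "principal_bundle G P \<Longrightarrow> p \<in> pts P \<Longrightarrow> \<gamma> \<in> arr \<Longrightarrow> banch P p = tgt \<gamma> \<Longrightarrow> bact P p \<gamma> \<in> pts P"
  unfolding principal_bundle_def continuous_map_def by (auto simp: Pi_iff)

lemma bact_unt [simp]: "principal_bundle G P \<Longrightarrow> p \<in> pts P \<Longrightarrow> banch P p = x \<Longrightarrow> bact P p (unt x) = p"
  and banch_bact [simp]:
    "principal_bundle G P \<Longrightarrow> p \<in> pts P \<Longrightarrow> \<gamma> \<in> arr \<Longrightarrow> banch P p = tgt \<gamma> \<Longrightarrow> banch P (bact P p \<gamma>) = src \<gamma>"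
  and bproj_bact [simp]:
    "principal_bundle G P \<Longrightarrow> p \<in> pts P \<Longrightarrow> \<gamma> \<in> arr \<Longrightarrow> banch P p = tgt \<gamma> \<Longrightarrow> bproj P (bact P p \<gamma>) = bproj P p"
  and bact_bact:
    "principal_bundle G P \<Longrightarrow> p \<in> pts P \<Longrightarrow> \<gamma> \<in> arr \<Longrightarrow> \<delta> \<in> arr \<Longrightarrow> banch P p = tgt \<gamma> \<Longrightarrow> src \<gamma> = tgt \<delta> \<Longrightarrow>
      bact P (bact P p \<gamma>) \<delta> = bact P p (cmp \<gamma> \<delta>)"
  unfolding principal_bundle_def by (blast, blast, blast, blast)

lemma principal_section:
  assumes "principal_bundle G P" "n \<in> topspace (bbase P)"
  obtains U \<sigma> where "openin (bbase P) U" "n \<in> U" "continuous_map (subtopology (bbase P) U) (btot P) \<sigma>"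
    "\<And>z. z \<in> U \<Longrightarrow> bproj P (\<sigma> z) = z" "\<And>z. z \<in> U \<Longrightarrow> \<sigma> z \<in> pts P"
proof -
  obtain U \<sigma> where U: "openin (bbase P) U" "n \<in> U" "continuous_map (subtopology (bbase P) U) (btot P) \<sigma>"
    "\<And>z. z \<in> U \<Longrightarrow> bproj P (\<sigma> z) = z"
    using admits_local_sectionsD[OF bproj_local_sections[OF assms(1)] assms(2)] by metis
  moreover have "\<sigma> z \<in> pts P" if "z \<in> U" for z
    using U(1,3) that openin_subset[OF U(1)] by (auto simp: continuous_map_def Pi_iff)
  ultimately show thesis using that by blast
qed

lemma principal_point:
  assumes "principal_bundle G P" "n \<in> topspace (bbase P)"
  obtains p where "p \<in> pts P" "bproj P p = n"
  by (rule principal_section[OF assms]) blast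

lemma division_unique:
  assumes "principal_bundle G P" "p \<in> pts P" "q \<in> pts P" "bproj P p = bproj P q"
  shows "\<exists>!\<gamma>. \<gamma> \<in> arr \<and> banch P p = tgt \<gamma> \<and> bact P p \<gamma> = q"
proof -
  have "homeomorphic_map (fibprod (btot P) (garr G) (banch P) tgt) (fibprod (btot P) (btot P) (bproj P) (bproj P))
       (\<lambda>(p, \<gamma>). (p, bact P p \<gamma>))"
    using assms(1) unfolding principal_bundle_def by blast
  then have "bij_betw (\<lambda>(p, \<gamma>). (p, bact P p \<gamma>)) {(p,\<gamma>). p \<in> pts P \<and> \<gamma> \<in> arr \<and> banch P p = tgt \<gamma>}
     {(p,q). p \<in> pts P \<and> q \<in> pts P \<and> bproj P p = bproj P q}"
    by (auto simp: homeomorphic_eq_everything_map bij_betw_def)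
  then have inj: "inj_on (\<lambda>(p, \<gamma>). (p, bact P p \<gamma>)) {(p,\<gamma>). p \<in> pts P \<and> \<gamma> \<in> arr \<and> banch P p = tgt \<gamma>}"
    and im: "(p,q) \<in> (\<lambda>(p, \<gamma>). (p, bact P p \<gamma>)) ` {(p,\<gamma>). p \<in> pts P \<and> \<gamma> \<in> arr \<and> banch P p = tgt \<gamma>}"
    using assms unfolding bij_betw_def by auto
  from im obtain \<gamma> where g: "\<gamma> \<in> arr \<and> banch P p = tgt \<gamma> \<and> bact P p \<gamma> = q" by auto
  show ?thesis
  proof (rule ex1I[where a = \<gamma>], rule g)
    fix \<delta> assume d: "\<delta> \<in> arr \<and> banch P p = tgt \<delta> \<and> bact P p \<delta> = q"
    show "\<delta> = \<gamma>" using inj_onD[OF inj, of "(p,\<delta>)" "(p,\<gamma>)"] g d assms by auto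
  qed
qed

lemma
  assumes "principal_bundle G P" "p \<in> pts P" "q \<in> pts P" "bproj P p = bproj P q"
  shows division_in [simp]: "division G P p q \<in> arr"
    and tgt_division [simp]: "tgt (division G P p q) = banch P p"
    and bact_division [simp]: "bact P p (division G P p q) = q"
    and src_division [simp]: "src (division G P p q) = banch P q"
proof -
  have *: "division G P p q \<in> arr \<and> banch P p = tgt (division G P p q) \<and> bact P p (division G P p q) = q"
    unfolding division_def by (rule theI', rule division_unique[OF assms])
  then show "division G P p q \<in> arr" "tgt (division G P p q) = banch P p" "bact P p (division G P p q) = q"
    by simp_all
  then show "src (division G P p q) = banch P q"
    using banch_bact[OF assms(1,2), of "division G P p q"] * by metis
qed

lemma division_eqI:
  assumes "principal_bundle G P" "p \<in> pts P" "\<gamma> \<in> arr" "banch P p = tgt \<gamma>" "bact P p \<gamma> = q"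
  shows "division G P p q = \<gamma>"
  using division_unique[OF assms(1,2), of q] assms
  by (metis bact_in bproj_bact division_in bact_division tgt_division)

lemma bact_left_cancel:
  "bact P p \<gamma> = bact P p \<delta> \<Longrightarrow> principal_bundle G P \<Longrightarrow> p \<in> pts P \<Longrightarrow> \<gamma> \<in> arr \<Longrightarrow> \<delta> \<in> arr \<Longrightarrow>
   banch P p = tgt \<gamma> \<Longrightarrow> banch P p = tgt \<delta> \<Longrightarrow> \<gamma> = \<delta>"
  by (metis division_eqI)

text \<open>The inverse of the principality homeomorphism is \<open>(p, q)\<close> to
  \<open>(p, division G P p q)\<close>, so its continuity is the continuity of the translation
  function.\<close>

lemma continuous_division:
  assumes P: "principal_bundle G P" and a: "continuous_map Z (btot P) a" "continuous_map Z (btot P) b"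
    "\<And>z. z \<in> topspace Z \<Longrightarrow> bproj P (a z) = bproj P (b z)"
  shows "continuous_map Z (garr G) (\<lambda>z. division G P (a z) (b z))"
proof -
  have "homeomorphic_map (fibprod (btot P) (garr G) (banch P) tgt) (fibprod (btot P) (btot P) (bproj P) (bproj P))
       (\<lambda>(p, \<gamma>). (p, bact P p \<gamma>))"
    using P unfolding principal_bundle_def by blast
  then obtain g where g: "homeomorphic_maps (fibprod (btot P) (garr G) (banch P) tgt)
       (fibprod (btot P) (btot P) (bproj P) (bproj P)) (\<lambda>(p, \<gamma>). (p, bact P p \<gamma>)) g"
    using homeomorphic_map_maps by blast
  have gd: "snd (g (p, q)) = division G P p q"
    if "p \<in> pts P" "q \<in> pts P" "bproj P p = bproj P q" for p q
  proof -
    have "g (p, bact P p (division G P p q)) = (p, division G P p q)"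
    proof -
      have "(p, division G P p q) \<in> topspace (fibprod (btot P) (garr G) (banch P) tgt)"
        using that P by simp
      then have "g ((\<lambda>(p, \<gamma>). (p, bact P p \<gamma>)) (p, division G P p q)) = (p, division G P p q)"
        using g unfolding homeomorphic_maps_def by blast
      then show ?thesis by simp
    qed
    then show ?thesis using P that by simp
  qed
  have "continuous_map (fibprod (btot P) (btot P) (bproj P) (bproj P)) (garr G) (\<lambda>z. snd (g z))"
    using g unfolding homeomorphic_maps_def
    by (auto intro: continuous_map_compose_apply[OF continuous_map_fibprod_snd])
  from continuous_map_compose_apply[OF this continuous_map_into_fibprod[where f = "bproj P" and g = "bproj P", OF a]]
  have "continuous_map Z (garr G) (\<lambda>z. snd (g (a z, b z)))" .
  then show ?thesis
    by (rule continuous_map_cong_topspace) (use a gd in \<open>auto simp: continuous_map_def Pi_iff\<close>)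
qed

text \<open>The homeomorphism condition is traded for a continuous candidate d for the translation
  function. All bundles constructed below are verified in this form. That \<open>d p q\<close> is an
  arrow is contained in its continuity as a map into \<open>garr G\<close>.\<close>

lemma principal_bundleI:
  assumes "continuous_map (btot P) (bbase P) (bproj P)"
    and "admits_local_sections (btot P) (bbase P) (bproj P)"
    and "continuous_map (btot P) (gobj G) (banch P)"
    and act: "continuous_map (fibprod (btot P) (garr G) (banch P) tgt) (btot P) (\<lambda>z. bact P (fst z) (snd z))"
    and "\<And>p. p \<in> pts P \<Longrightarrow> bact P p (unt (banch P p)) = p"
    and pr: "\<And>p \<gamma>. p \<in> pts P \<Longrightarrow> \<gamma> \<in> arr \<Longrightarrow> banch P p = tgt \<gamma> \<Longrightarrow>
          banch P (bact P p \<gamma>) = src \<gamma> \<and> bproj P (bact P p \<gamma>) = bproj P p"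
    and "\<And>p \<gamma> \<delta>. p \<in> pts P \<Longrightarrow> \<gamma> \<in> arr \<Longrightarrow> \<delta> \<in> arr \<Longrightarrow> banch P p = tgt \<gamma> \<Longrightarrow> src \<gamma> = tgt \<delta> \<Longrightarrow>
          bact P (bact P p \<gamma>) \<delta> = bact P p (cmp \<gamma> \<delta>)"
    and d: "continuous_map (fibprod (btot P) (btot P) (bproj P) (bproj P)) (garr G) (\<lambda>z. d (fst z) (snd z))"
    and dp: "\<And>p q. p \<in> pts P \<Longrightarrow> q \<in> pts P \<Longrightarrow> bproj P p = bproj P q \<Longrightarrow>
          tgt (d p q) = banch P p \<and> bact P p (d p q) = q"
    and du: "\<And>p \<gamma>. p \<in> pts P \<Longrightarrow> \<gamma> \<in> arr \<Longrightarrow> banch P p = tgt \<gamma> \<Longrightarrow> d p (bact P p \<gamma>) = \<gamma>"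
  shows "principal_bundle G P"
proof -
  have act': "continuous_map (fibprod (btot P) (garr G) (banch P) tgt) (btot P) (\<lambda>(p, \<gamma>). bact P p \<gamma>)"
    using act by (simp add: split_beta')
  then have in_P: "bact P p \<gamma> \<in> pts P" if "p \<in> pts P" "\<gamma> \<in> arr" "banch P p = tgt \<gamma>" for p \<gamma>
    using that by (auto simp: continuous_map_def Pi_iff)
  have "homeomorphic_maps (fibprod (btot P) (garr G) (banch P) tgt)
     (fibprod (btot P) (btot P) (bproj P) (bproj P)) (\<lambda>z. (fst z, bact P (fst z) (snd z))) (\<lambda>z. (fst z, d (fst z) (snd z)))"
    unfolding homeomorphic_maps_def
    using dp du in_P pr
    by (auto intro!: continuous_map_into_fibprod act d continuous_map_fibprod_fst)
  then have "homeomorphic_map (fibprod (btot P) (garr G) (banch P) tgt)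
     (fibprod (btot P) (btot P) (bproj P) (bproj P)) (\<lambda>(p, \<gamma>). (p, bact P p \<gamma>))"
    unfolding homeomorphic_map_maps by (auto simp: split_beta')
  then show ?thesis
    unfolding principal_bundle_def using assms act' by blast
qed

end


section \<open>Bundle maps\<close>

lemma continuous_map_restrict_topspace [simp]:
  "continuous_map X Y (restrict f (topspace X)) \<longleftrightarrow> continuous_map X Y f"
  by (auto elim: continuous_map_cong_topspace)

text \<open>By principality a bundle map is bijective on fibres, so the description is definite when \<^term>\<open>\<phi>\<close> is one.\<close>

definition fibre_inverse :: "'u pbundle \<Rightarrow> ('u \<Rightarrow> 'u) \<Rightarrow> 'u \<Rightarrow> 'u \<Rightarrow> 'u" where
  "fibre_inverse P \<phi> n r = (THE p. p \<in> pts P \<and> bproj P p = n \<and> \<phi> p = r)"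

context topgpd
begin

lemma bundle_maps_iff:
  "(P, Q, \<phi>, f) \<in> bundle_maps G \<longleftrightarrow>
     principal_bundle G P \<and> principal_bundle G Q \<and>
     continuous_map (btot P) (btot Q) \<phi> \<and> \<phi> \<in> extensional (pts P) \<and>
     continuous_map (bbase P) (bbase Q) f \<and> f \<in> extensional (topspace (bbase P)) \<and>
     (\<forall>p\<in>pts P. bproj Q (\<phi> p) = f (bproj P p) \<and> banch Q (\<phi> p) = banch P p) \<and>
     (\<forall>p\<in>pts P. \<forall>\<gamma>\<in>arr. banch P p = tgt \<gamma> \<longrightarrow> \<phi> (bact P p \<gamma>) = bact Q (\<phi> p) \<gamma>)"
  by (simp add: bundle_maps_def)

lemma bundle_mapsI:
  assumes "principal_bundle G P" "principal_bundle G Q"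
    "continuous_map (btot P) (btot Q) \<phi>" "continuous_map (bbase P) (bbase Q) f"
    "\<And>p. p \<in> pts P \<Longrightarrow> bproj Q (\<phi> p) = f (bproj P p) \<and> banch Q (\<phi> p) = banch P p"
    "\<And>p \<gamma>. p \<in> pts P \<Longrightarrow> \<gamma> \<in> arr \<Longrightarrow> banch P p = tgt \<gamma> \<Longrightarrow> \<phi> (bact P p \<gamma>) = bact Q (\<phi> p) \<gamma>"
    "f \<in> extensional (topspace (bbase P))"
  shows "(P, Q, restrict \<phi> (pts P), f) \<in> bundle_maps G"
  unfolding bundle_maps_iff using assms by auto

lemma
  assumes "(P, Q, \<phi>, f) \<in> bundle_maps G"
  shows bundle_map_principal_dom: "principal_bundle G P"
    and bundle_map_principal_cod: "principal_bundle G Q"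
    and bundle_map_continuous: "continuous_map (btot P) (btot Q) \<phi>"
    and bundle_map_continuous_base: "continuous_map (bbase P) (bbase Q) f"
    and bundle_map_extensional: "\<phi> \<in> extensional (pts P)"
    and bundle_map_extensional_base: "f \<in> extensional (topspace (bbase P))"
    and bundle_map_in: "\<And>p. p \<in> pts P \<Longrightarrow> \<phi> p \<in> pts Q"
    and bundle_map_base_in: "\<And>n. n \<in> topspace (bbase P) \<Longrightarrow> f n \<in> topspace (bbase Q)"
    and bundle_map_bproj: "\<And>p. p \<in> pts P \<Longrightarrow> bproj Q (\<phi> p) = f (bproj P p)"
    and bundle_map_banch: "\<And>p. p \<in> pts P \<Longrightarrow> banch Q (\<phi> p) = banch P p"
    and bundle_map_bact: "\<And>p \<gamma>. p \<in> pts P \<Longrightarrow> \<gamma> \<in> arr \<Longrightarrow> banch P p = tgt \<gamma> \<Longrightarrow> \<phi> (bact P p \<gamma>) = bact Q (\<phi> p) \<gamma>"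
  using assms unfolding bundle_maps_iff by (auto simp: continuous_map_def)

text \<open>Let \<gamma> carry p to q. By equivariance it carries \<open>\<phi> p\<close> to
  \<open>\<phi> q\<close>, which is the same point, so by freeness of the action on Q it is a
  unit.\<close>

lemma bundle_map_inj:
  assumes m: "(P, Q, \<phi>, f) \<in> bundle_maps G" and p: "p \<in> pts P" "q \<in> pts P"
    "bproj P p = bproj P q" "\<phi> p = \<phi> q"
  shows "p = q"
proof -
  note P = bundle_map_principal_dom[OF m] and Q = bundle_map_principal_cod[OF m]
  let ?\<gamma> = "division G P p q"
  have pq: "banch P q = banch P p"
    using bundle_map_banch[OF m p(1)] bundle_map_banch[OF m p(2)] p(4) by simp
  have "bact Q (\<phi> p) ?\<gamma> = \<phi> (bact P p ?\<gamma>)"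
    by (rule bundle_map_bact[OF m, symmetric]) (use P p in auto)
  also have "\<dots> = bact Q (\<phi> p) (unt (banch P p))"
    using P Q p bundle_map_in[OF m p(2)] bundle_map_banch[OF m p(1)] by simp
  finally have "?\<gamma> = unt (banch P p)"
    by (rule bact_left_cancel[OF _ Q]) (use P p pq bundle_map_in[OF m] bundle_map_banch[OF m] in auto)
  then show ?thesis using bact_division[OF P p(1-3)] P p(1) by simp
qed

text \<open>Any p in the right fibre serves as a reference point: the arrow from
  \<open>\<phi> p\<close> to r, applied to p instead, gives the preimage of r. This explicit form is
  what makes fibre inverses accessible to continuity arguments.\<close>

lemma fibre_inverse_formula:
  assumes m: "(P, Q, \<phi>, f) \<in> bundle_maps G" and p: "p \<in> pts P" "r \<in> pts Q"
    "bproj Q r = f (bproj P p)"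
  shows "fibre_inverse P \<phi> (bproj P p) r = bact P p (division G Q (\<phi> p) r)"
    and "\<phi> (bact P p (division G Q (\<phi> p) r)) = r"
proof -
  note P = bundle_map_principal_dom[OF m] and Q = bundle_map_principal_cod[OF m]
  have *: "\<phi> p \<in> pts Q" "bproj Q (\<phi> p) = bproj Q r" "banch Q (\<phi> p) = banch P p"
    using bundle_map_in[OF m] bundle_map_banch[OF m] bundle_map_bproj[OF m] p by auto
  show eq: "\<phi> (bact P p (division G Q (\<phi> p) r)) = r"
    using bundle_map_bact[OF m p(1), of "division G Q (\<phi> p) r"] * p Q by simp
  show "fibre_inverse P \<phi> (bproj P p) r = bact P p (division G Q (\<phi> p) r)"
    unfolding fibre_inverse_def
    by (rule the_equality) (use eq bundle_map_inj[OF m] P Q * p in auto)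
qed

lemma
  assumes m: "(P, Q, \<phi>, f) \<in> bundle_maps G"
    and n: "n \<in> topspace (bbase P)" "r \<in> pts Q" "bproj Q r = f n"
  shows fibre_inverse_in: "fibre_inverse P \<phi> n r \<in> pts P"
    and bproj_fibre_inverse: "bproj P (fibre_inverse P \<phi> n r) = n"
    and bundle_map_fibre_inverse: "\<phi> (fibre_inverse P \<phi> n r) = r"
    and banch_fibre_inverse: "banch P (fibre_inverse P \<phi> n r) = banch Q r"
proof -
  note P = bundle_map_principal_dom[OF m] and Q = bundle_map_principal_cod[OF m]
  obtain p where p: "p \<in> pts P" "bproj P p = n" using principal_point[OF P n(1)] .
  have *: "\<phi> p \<in> pts Q" "bproj Q (\<phi> p) = bproj Q r" "banch Q (\<phi> p) = banch P p"
    using bundle_map_in[OF m] bundle_map_banch[OF m] bundle_map_bproj[OF m] p n by auto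
  show in_P: "fibre_inverse P \<phi> n r \<in> pts P"
    and "bproj P (fibre_inverse P \<phi> n r) = n"
    and eq: "\<phi> (fibre_inverse P \<phi> n r) = r"
    using fibre_inverse_formula[OF m p(1) n(2)] * p n P Q by auto
  show "banch P (fibre_inverse P \<phi> n r) = banch Q r"
    using bundle_map_banch[OF m in_P] eq by simp
qed

lemma fibre_inverse_eqI:
  assumes m: "(P, Q, \<phi>, f) \<in> bundle_maps G" and p: "p \<in> pts P" "bproj P p = n" "\<phi> p = r"
  shows "fibre_inverse P \<phi> n r = p"
  unfolding fibre_inverse_def
  by (rule the_equality) (use bundle_map_inj[OF m] p in auto)

lemma fibre_inverse_bact:
  assumes m: "(P, Q, \<phi>, f) \<in> bundle_maps G"
    and n: "n \<in> topspace (bbase P)" "r \<in> pts Q" "bproj Q r = f n"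
    and g: "\<gamma> \<in> arr" "banch Q r = tgt \<gamma>"
  shows "fibre_inverse P \<phi> n (bact Q r \<gamma>) = bact P (fibre_inverse P \<phi> n r) \<gamma>"
proof (rule fibre_inverse_eqI[OF m])
  note fi = fibre_inverse_in[OF m n] bproj_fibre_inverse[OF m n] bundle_map_fibre_inverse[OF m n] banch_fibre_inverse[OF m n]
  note P = bundle_map_principal_dom[OF m] and Q = bundle_map_principal_cod[OF m]
  show "bact P (fibre_inverse P \<phi> n r) \<gamma> \<in> pts P" "bproj P (bact P (fibre_inverse P \<phi> n r) \<gamma>) = n"
    using fi P g by simp_all
  show "\<phi> (bact P (fibre_inverse P \<phi> n r) \<gamma>) = bact Q r \<gamma>"
    using bundle_map_bact[OF m fi(1) g(1)] fi g by simp
qed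

text \<open>A definite description says nothing about continuity. Over an open set with a section
  \<sigma> of P, the reference point in \<open>fibre_inverse_formula\<close> can be taken as
  \<open>\<sigma> (b z)\<close>, and then the formula is a composite of continuous maps.\<close>

lemma continuous_fibre_inverse:
  assumes m: "(P, Q, \<phi>, f) \<in> bundle_maps G"
    and b: "continuous_map Z (bbase P) b" and k: "continuous_map Z (btot Q) k"
    and e: "\<And>z. z \<in> topspace Z \<Longrightarrow> bproj Q (k z) = f (b z)"
  shows "continuous_map Z (btot P) (\<lambda>z. fibre_inverse P \<phi> (b z) (k z))"
proof (rule continuous_map_locally)
  fix z assume z: "z \<in> topspace Z"
  note P = bundle_map_principal_dom[OF m] and Q = bundle_map_principal_cod[OF m]
  obtain U \<sigma> where U: "openin (bbase P) U" "b z \<in> U" "continuous_map (subtopology (bbase P) U) (btot P) \<sigma>"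
    "\<And>y. y \<in> U \<Longrightarrow> bproj P (\<sigma> y) = y" "\<And>y. y \<in> U \<Longrightarrow> \<sigma> y \<in> pts P"
    using principal_section[OF P continuous_map_topspace[OF b z]] by metis
  let ?V = "{z \<in> topspace Z. b z \<in> U}"
  let ?S = "subtopology Z ?V"
  have b': "continuous_map ?S (bbase P) b" and k': "continuous_map ?S (btot Q) k"
    using b k by (auto intro: continuous_map_from_subtopology)
  have s: "continuous_map ?S (btot P) (\<lambda>z. \<sigma> (b z))"
    by (rule continuous_map_compose_subtopology[OF U(3) b']) auto
  have ps: "continuous_map ?S (btot Q) (\<lambda>z. \<phi> (\<sigma> (b z)))"
    by (rule continuous_map_compose_apply[OF bundle_map_continuous[OF m] s])
  have k_in: "\<And>z. z \<in> topspace Z \<Longrightarrow> k z \<in> pts Q" using continuous_map_topspace[OF k] .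
  have *: "\<phi> (\<sigma> (b z)) \<in> pts Q" "bproj Q (\<phi> (\<sigma> (b z))) = bproj Q (k z)" "banch Q (\<phi> (\<sigma> (b z))) = banch P (\<sigma> (b z))"
    if "z \<in> topspace Z" "b z \<in> U" for z
    using that U e bundle_map_in[OF m] bundle_map_bproj[OF m] bundle_map_banch[OF m] by auto
  have "continuous_map ?S (btot P) (\<lambda>z. bact P (\<sigma> (b z)) (division G Q (\<phi> (\<sigma> (b z))) (k z)))"
    by (intro continuous_bact[OF P] continuous_division[OF Q] s ps k') (use * k_in Q in auto)
  then have "continuous_map ?S (btot P) (\<lambda>z. fibre_inverse P \<phi> (b z) (k z))"
    by (rule continuous_map_cong_topspace)
       (use fibre_inverse_formula(1)[OF m U(5) k_in] U(4) e in force)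
  then show "\<exists>U. openin Z U \<and> z \<in> U \<and> continuous_map (subtopology Z U) (btot P) (\<lambda>z. fibre_inverse P \<phi> (b z) (k z))"
    using z U openin_continuous_map_preimage[OF b U(1)] by (intro exI[of _ ?V]) auto
qed

text \<open>A bundle with a global section s is trivial: each p is \<open>s (bproj P p)\<close>
  moved by a unique arrow. An equivariant map is therefore given by sending \<open>s n\<close> to
  \<open>t n\<close>, and equality of the anchors is what allows the same arrow to act on
  \<open>t n\<close>. Both epimorphism proofs take their bundle maps from here.\<close>

lemma bundle_map_from_section:
  assumes P: "principal_bundle G P" and Q: "principal_bundle G Q"
    and f: "continuous_map (bbase P) (bbase Q) f" "f \<in> extensional (topspace (bbase P))"
    and s: "continuous_map (bbase P) (btot P) s" "\<And>n. n \<in> topspace (bbase P) \<Longrightarrow> bproj P (s n) = n"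
    and t: "continuous_map (bbase P) (btot Q) t" "\<And>n. n \<in> topspace (bbase P) \<Longrightarrow> bproj Q (t n) = f n"
    and a: "\<And>n. n \<in> topspace (bbase P) \<Longrightarrow> banch Q (t n) = banch P (s n)"
  shows "(P, Q, \<lambda>p\<in>pts P. bact Q (t (bproj P p)) (division G P (s (bproj P p)) p), f) \<in> bundle_maps G"
proof (rule bundle_mapsI[OF P Q _ f(1) _ _ f(2)])
  note pr = continuous_bproj[OF P]
  have in': "s n \<in> pts P" "t n \<in> pts Q" if "n \<in> topspace (bbase P)" for n
    using that continuous_map_topspace[OF s(1)] continuous_map_topspace[OF t(1)] by auto
  show "continuous_map (btot P) (btot Q) (\<lambda>p. bact Q (t (bproj P p)) (division G P (s (bproj P p)) p))"
    by (intro continuous_bact[OF Q] continuous_division[OF P] continuous_map_compose_apply[OF s(1) pr]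
        continuous_map_compose_apply[OF t(1) pr] continuous_map_id[unfolded id_def])
       (use s t a in' P in auto)
  fix p assume p: "p \<in> pts P"
  let ?n = "bproj P p"
  note n = bproj_in[OF P p]
  note props = s(2)[OF n] t(2)[OF n] a[OF n] in'[OF n] p P Q n
  show "bproj Q (bact Q (t ?n) (division G P (s ?n) p)) = f ?n \<and> banch Q (bact Q (t ?n) (division G P (s ?n) p)) = banch P p"
    using props by simp
  fix \<gamma> assume g: "\<gamma> \<in> arr" "banch P p = tgt \<gamma>"
  have "division G P (s ?n) (bact P p \<gamma>) = cmp (division G P (s ?n) p) \<gamma>"
    by (rule division_eqI[OF P]) (use props g in \<open>auto simp flip: bact_bact\<close>)
  then show "bact Q (t (bproj P (bact P p \<gamma>))) (division G P (s (bproj P (bact P p \<gamma>))) (bact P p \<gamma>))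
     = bact Q (bact Q (t ?n) (division G P (s ?n) p)) \<gamma>"
    using props g by (simp add: bact_bact)
qed


section \<open>The unit bundle and pullbacks\<close>

text \<open>The groupoid acting on its own arrows by right composition. Trivial bundles are its
  pullbacks along maps into the object space.\<close>

definition unit_bundle :: "'u pbundle" where
  "unit_bundle = \<lparr>btot = garr G, bbase = gobj G, bproj = tgt, banch = src, bact = cmp\<rparr>"

lemma unit_bundle_simps [simp]:
  "btot unit_bundle = garr G" "bbase unit_bundle = gobj G" "bproj unit_bundle = tgt"
  "banch unit_bundle = src" "bact unit_bundle = cmp"
  by (simp_all add: unit_bundle_def)

lemma principal_unit_bundle: "principal_bundle G unit_bundle"
proof (rule principal_bundleI[where d = "\<lambda>p q. cmp (inw p) q"]; (simp only: unit_bundle_simps)?)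
  show "admits_local_sections (garr G) (gobj G) tgt"
    by (rule admits_local_sectionsI)
       (auto intro!: exI[of _ "topspace (gobj G)"] exI[of _ unt] continuous_map_from_subtopology continuous_unt)
  show "continuous_map (fibprod (garr G) (garr G) src tgt) (garr G) (\<lambda>z. cmp (fst z) (snd z))"
    by (intro continuous_cmp continuous_map_fibprod_fst continuous_map_fibprod_snd) auto
  show "continuous_map (fibprod (garr G) (garr G) tgt tgt) (garr G) (\<lambda>z. cmp (inw (fst z)) (snd z))"
    by (intro continuous_cmp continuous_map_compose_apply[OF continuous_inw] continuous_map_fibprod_fst continuous_map_fibprod_snd) auto
qed (auto simp: continuous_src continuous_tgt cmp_assoc)

end

text \<open>An infinite type is equipotent with its square, so an injection exists,
  \<open>SOME\<close> picks one, and \<open>inv\<close> is a left inverse of it.\<close>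

lemma assoc_rep_pair_code:
  includes cardinal_syntax
  assumes "infinite (UNIV :: 'u set)"
  shows "assoc_rep (pair_code z :: 'u) = z"
proof -
  have "|UNIV :: ('u \<times> 'u) set| \<le>o |UNIV :: 'u set|"
    using card_of_Times_same_infinite[OF assms, THEN ordIso_imp_ordLeq] by simp
  then have "\<exists>e :: 'u \<times> 'u \<Rightarrow> 'u. inj e"
    unfolding card_of_ordLeq[symmetric] by auto
  then have "inj (pair_code :: 'u \<times> 'u \<Rightarrow> 'u)"
    unfolding pair_code_def by (rule someI_ex)
  then show ?thesis by (simp add: assoc_rep_def)
qed

text \<open>The fibre product consists of pairs. Once \<open>'u\<close> is infinite,
  \<open>pair_code\<close> is injective and the quotient along it merely transports the topology to
  points of \<open>'u\<close>; unlike the names of orbits, these codes decode continuously.\<close>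

definition pullback_bundle :: "'u pbundle \<Rightarrow> 'u topology \<Rightarrow> ('u \<Rightarrow> 'u) \<Rightarrow> 'u pbundle" where
  "pullback_bundle P N f =
     \<lparr>btot = quotient_topology (fibprod N (btot P) f (bproj P)) pair_code,
      bbase = N,
      bproj = (\<lambda>c. fst (assoc_rep c)),
      banch = (\<lambda>c. banch P (snd (assoc_rep c))),
      bact = (\<lambda>c \<gamma>. pair_code (fst (assoc_rep c), bact P (snd (assoc_rep c)) \<gamma>))\<rparr>"

locale topgpd_infinite = topgpd G for G :: "'u tgpd" +
  assumes infinite_UNIV: "infinite (UNIV :: 'u set)"
begin

lemma assoc_rep_pair_code' [simp]: "assoc_rep (pair_code z :: 'u) = z"
  by (rule assoc_rep_pair_code[OF infinite_UNIV])

lemma pullback_bundle: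
  assumes P: "principal_bundle G P" and f: "continuous_map N (bbase P) f" "f \<in> extensional (topspace N)"
  shows "principal_bundle G (pullback_bundle P N f)"
    and "(pullback_bundle P N f, P, \<lambda>c\<in>pts (pullback_bundle P N f). snd (assoc_rep c), f) \<in> bundle_maps G"
proof -
  let ?E = "fibprod N (btot P) f (bproj P)"
  let ?T = "quotient_topology ?E pair_code"
  let ?R = "pullback_bundle P N f"
  have sel [simp]: "btot ?R = ?T" "bbase ?R = N" "bproj ?R = (\<lambda>c. fst (assoc_rep c))"
    "banch ?R = (\<lambda>c. banch P (snd (assoc_rep c)))"
    "bact ?R = (\<lambda>c \<gamma>. pair_code (fst (assoc_rep c), bact P (snd (assoc_rep c)) \<gamma>))"
    by (simp_all add: pullback_bundle_def)
  have c1: "continuous_map ?T N (\<lambda>c. fst (assoc_rep c))" and c2: "continuous_map ?T (btot P) (\<lambda>c. snd (assoc_rep c))"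
    by (rule continuous_map_from_quotient_topology, simp add: continuous_map_fibprod_fst continuous_map_fibprod_snd eta_contract_eq)+
  have into: "continuous_map Z ?T (\<lambda>z. pair_code (a z, b z))"
    if "continuous_map Z N a" "continuous_map Z (btot P) b" "\<And>z. z \<in> topspace Z \<Longrightarrow> f (a z) = bproj P (b z)" for a b and Z :: "'z topology"
    by (rule continuous_map_compose_apply[OF continuous_map_quotient_topology])
       (rule continuous_map_into_fibprod[where f = f and g = "bproj P", OF that])
  show R: "principal_bundle G ?R"
  proof (rule principal_bundleI[where d = "\<lambda>p q. division G P (snd (assoc_rep p)) (snd (assoc_rep q))"]; (simp only: sel)?)
    show "continuous_map ?T N (\<lambda>c. fst (assoc_rep c))" by fact
    show "continuous_map ?T (gobj G) (\<lambda>c. banch P (snd (assoc_rep c)))"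
      by (rule continuous_map_compose_apply[OF continuous_banch[OF P] c2])
    show "admits_local_sections ?T N (\<lambda>c. fst (assoc_rep c))"
    proof (rule admits_local_sectionsI)
      fix y assume y: "y \<in> topspace N"
      obtain U \<sigma> where U: "openin (bbase P) U" "f y \<in> U" "continuous_map (subtopology (bbase P) U) (btot P) \<sigma>"
        "\<And>y. y \<in> U \<Longrightarrow> bproj P (\<sigma> y) = y" "\<And>y. y \<in> U \<Longrightarrow> \<sigma> y \<in> pts P"
        using principal_section[OF P continuous_map_topspace[OF f(1) y]] by metis
      let ?V = "{z \<in> topspace N. f z \<in> U}"
      have "continuous_map (subtopology N ?V) ?T (\<lambda>z. pair_code (z, \<sigma> (f z)))"
        by (rule into, rule continuous_map_from_subtopology[OF continuous_map_id[unfolded id_def]],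
            rule continuous_map_compose_subtopology[OF U(3) continuous_map_from_subtopology[OF f(1)]])
           (auto simp: U)
      then show "\<exists>U \<sigma>. openin N U \<and> y \<in> U \<and> continuous_map (subtopology N U) ?T \<sigma> \<and> (\<forall>z\<in>U. fst (assoc_rep (\<sigma> z)) = z)"
        using openin_continuous_map_preimage[OF f(1) U(1)] y U(2)
        by (intro exI[of _ ?V] exI[of _ "\<lambda>z. pair_code (z, \<sigma> (f z))"]) auto
    qed
    show "continuous_map (fibprod ?T (garr G) (\<lambda>c. banch P (snd (assoc_rep c))) tgt) ?T
      (\<lambda>z. pair_code (fst (assoc_rep (fst z)), bact P (snd (assoc_rep (fst z))) (snd z)))"
      by (intro into continuous_bact[OF P] continuous_map_compose_apply[OF c1] continuous_map_compose_apply[OF c2]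
          continuous_map_fibprod_fst continuous_map_fibprod_snd) (use P in auto)
    show "continuous_map (fibprod ?T ?T (\<lambda>c. fst (assoc_rep c)) (\<lambda>c. fst (assoc_rep c))) (garr G)
      (\<lambda>z. division G P (snd (assoc_rep (fst z))) (snd (assoc_rep (snd z))))"
      by (intro continuous_division[OF P] continuous_map_compose_apply[OF c2]
          continuous_map_fibprod_fst continuous_map_fibprod_snd) auto
  qed (use P in \<open>auto simp: bact_bact intro: division_eqI\<close>)
  show "(?R, P, \<lambda>c\<in>pts ?R. snd (assoc_rep c), f) \<in> bundle_maps G"
    by (rule bundle_mapsI[OF R P]) (use f c2 in auto)
qed

end


section \<open>Categories over the site\<close>

lemma Top_simps [simp]:
  "Ob Top = UNIV" "(X, Y, f) \<in> Ar Top \<longleftrightarrow> continuous_map X Y f \<and> f \<in> extensional (topspace X)"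
  "Dom Top (X, Y, f) = X" "Cod Top (X, Y, f) = Y" "Idt Top X = (X, X, \<lambda>x\<in>topspace X. x)"
  "Cmp Top (Y, Z, g) (X, Y', f) = (X, Z, compose (topspace X) g f)"
  by (simp_all add: Top_def)

lemma hom_setI: "f \<in> Ar C \<Longrightarrow> Dom C f = x \<Longrightarrow> Cod C f = y \<Longrightarrow> f \<in> hom_set C x y"
  by (simp add: hom_set_def)

lemma hom_setD: "f \<in> hom_set C x y \<Longrightarrow> f \<in> Ar C" "f \<in> hom_set C x y \<Longrightarrow> Dom C f = x"
  "f \<in> hom_set C x y \<Longrightarrow> Cod C f = y"
  by (simp_all add: hom_set_def)

lemma
  assumes "category C"
  shows cat_hom_ob: "f \<in> hom_set C x y \<Longrightarrow> x \<in> Ob C \<and> y \<in> Ob C"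
    and cat_idt: "x \<in> Ob C \<Longrightarrow> Idt C x \<in> hom_set C x x"
    and cat_cmp: "g \<in> hom_set C y z \<Longrightarrow> f \<in> hom_set C x y \<Longrightarrow> Cmp C g f \<in> hom_set C x z"
    and cat_idt_right: "f \<in> hom_set C x y \<Longrightarrow> Cmp C f (Idt C x) = f"
    and cat_idt_left: "f \<in> hom_set C x y \<Longrightarrow> Cmp C (Idt C y) f = f"
    and cat_assoc: "h \<in> hom_set C z w \<Longrightarrow> g \<in> hom_set C y z \<Longrightarrow> f \<in> hom_set C x y \<Longrightarrow>
      Cmp C (Cmp C h g) f = Cmp C h (Cmp C g f)"
  using assms unfolding category_def hom_set_def by auto

lemma categoryI:
  assumes "\<And>f. f \<in> Ar C \<Longrightarrow> Dom C f \<in> Ob C \<and> Cod C f \<in> Ob C"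
    and "\<And>x. x \<in> Ob C \<Longrightarrow> Idt C x \<in> hom_set C x x"
    and "\<And>f g x y z. f \<in> hom_set C x y \<Longrightarrow> g \<in> hom_set C y z \<Longrightarrow> Cmp C g f \<in> hom_set C x z"
    and "\<And>f x y. f \<in> hom_set C x y \<Longrightarrow> Cmp C f (Idt C x) = f \<and> Cmp C (Idt C y) f = f"
    and "\<And>f g h x y z w. f \<in> hom_set C x y \<Longrightarrow> g \<in> hom_set C y z \<Longrightarrow> h \<in> hom_set C z w \<Longrightarrow>
        Cmp C h (Cmp C g f) = Cmp C (Cmp C h g) f"
  shows "category C"
  unfolding category_def using assms by (simp add: hom_set_def)

lemma category_Top: "category Top"
proof (rule categoryI)
  fix f g h :: "'u tmap" and x y z w
  assume fg: "f \<in> hom_set Top x y" "g \<in> hom_set Top y z"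
  then show "Cmp Top g f \<in> hom_set Top x z"
    by (cases f; cases g) (auto simp: hom_set_def compose_def intro: continuous_map_compose_apply)
  assume "h \<in> hom_set Top z w"
  with fg show "Cmp Top h (Cmp Top g f) = Cmp Top (Cmp Top h g) f"
    by (cases f; cases g; cases h)
       (auto simp: hom_set_def compose_def restrict_def fun_eq_iff dest: continuous_map_topspace)
next
  fix f :: "'u tmap" and x y
  assume "f \<in> hom_set Top x y"
  then show "Cmp Top f (Idt Top x) = f \<and> Cmp Top (Idt Top y) f = f"
    by (cases f) (auto simp: hom_set_def compose_def restrict_def fun_eq_iff extensional_def dest: continuous_map_topspace)
qed (auto simp: hom_set_def continuous_map_id[unfolded id_def])

lemma
  assumes "is_functor C D F"
  shows functor_ob: "x \<in> Ob C \<Longrightarrow> on_ob F x \<in> Ob D"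
    and functor_ar: "f \<in> hom_set C x y \<Longrightarrow> on_ar F f \<in> hom_set D (on_ob F x) (on_ob F y)"
    and functor_idt: "x \<in> Ob C \<Longrightarrow> on_ar F (Idt C x) = Idt D (on_ob F x)"
    and functor_cmp: "g \<in> hom_set C y z \<Longrightarrow> f \<in> hom_set C x y \<Longrightarrow>
      on_ar F (Cmp C g f) = Cmp D (on_ar F g) (on_ar F f)"
  using assms unfolding is_functor_def hom_set_def by auto

lemma is_functorI:
  assumes "\<And>x. x \<in> Ob C \<Longrightarrow> on_ob F x \<in> Ob D"
    and "\<And>f x y. f \<in> hom_set C x y \<Longrightarrow> on_ar F f \<in> hom_set D (on_ob F x) (on_ob F y)"
    and "\<And>x. x \<in> Ob C \<Longrightarrow> on_ar F (Idt C x) = Idt D (on_ob F x)"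
    and "\<And>f g x y z. f \<in> hom_set C x y \<Longrightarrow> g \<in> hom_set C y z \<Longrightarrow> on_ar F (Cmp C g f) = Cmp D (on_ar F g) (on_ar F f)"
  shows "is_functor C D F"
  unfolding is_functor_def using assms by (simp add: hom_set_def)

lemma
  assumes "stack_morphism X Y F"
  shows stack_morphism_functor: "is_functor X Y F"
    and stack_morphism_ob: "x \<in> Ob X \<Longrightarrow> base_ob Y (on_ob F x) = base_ob X x"
    and stack_morphism_ar: "f \<in> hom_set X x y \<Longrightarrow> base_ar Y (on_ar F f) = base_ar X f"
  using assms unfolding stack_morphism_def hom_set_def by auto

lemma stack_morphism_hom:
  "stack_morphism X Y F \<Longrightarrow> f \<in> hom_set X x y \<Longrightarrow> on_ar F f \<in> hom_set Y (on_ob F x) (on_ob F y)"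
  by (rule functor_ar[OF stack_morphism_functor])

lemma stack_morphism_comp:
  assumes F: "stack_morphism X Y F" and H: "stack_morphism Y Z H"
  shows "stack_morphism X Z (comp_func H F)"
proof -
  note Ff = stack_morphism_functor[OF F] and Hf = stack_morphism_functor[OF H]
  have "is_functor X Z (comp_func H F)"
    by (rule is_functorI)
       (auto simp: comp_func_def functor_ob[OF Ff] functor_ob[OF Hf] functor_idt[OF Ff] functor_idt[OF Hf]
          intro: functor_ar[OF Hf] functor_ar[OF Ff] simp: functor_cmp[OF Ff] functor_cmp[OF Hf functor_ar[OF Ff] functor_ar[OF Ff]])
  then show ?thesis
    unfolding stack_morphism_def
    using stack_morphism_ob[OF F] stack_morphism_ob[OF H] functor_ob[OF Ff]
      stack_morphism_ar[OF F hom_setI[OF _ refl refl]] stack_morphism_ar[OF H functor_ar[OF Ff hom_setI[OF _ refl refl]]]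
    by (simp add: comp_func_def)
qed

section \<open>Categories fibred in groupoids\<close>

locale fibred =
  fixes X :: "('u, 'o, 'a) topcat"
  assumes fibred: "fibred_in_groupoids X"
begin

lemma category: "category X" and proj_functor: "is_functor X Top (proj X)"
  using fibred unfolding fibred_in_groupoids_def by blast+

lemmas cmp [intro] = cat_cmp[OF category]
  and idt [intro] = cat_idt[OF category]
  and assoc = cat_assoc[OF category]
  and idt_right [simp] = cat_idt_right[OF category]
  and idt_left [simp] = cat_idt_left[OF category]
  and hom_ob = cat_hom_ob[OF category]
  and base_cmp = functor_cmp[OF proj_functor]
  and base_idt = functor_idt[OF proj_functor]
  and base_hom = functor_ar[OF proj_functor]

lemma pullback:
  assumes "x \<in> Ob X" "f \<in> hom_set Top N (base_ob X x)"
  obtains y m where "m \<in> hom_set X y x" "base_ar X m = f" "base_ob X y = N"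
proof -
  have "f \<in> Ar Top" "Cod Top f = base_ob X x" using assms by (auto simp: hom_set_def)
  then obtain m where m: "m \<in> Ar X" "Cod X m = x" "base_ar X m = f"
    using fibred assms(1) unfolding fibred_in_groupoids_def by meson
  then have h: "m \<in> hom_set X (Dom X m) x" by (simp add: hom_set_def)
  have "base_ob X (Dom X m) = N"
    using base_hom[OF h] m assms(2) by (simp add: hom_set_def)
  then show thesis using that[OF h] m by simp
qed

lemma cartesian:
  assumes "m \<in> hom_set X y x" "k \<in> hom_set X z x" "h \<in> hom_set Top (base_ob X z) (base_ob X y)"
    "Cmp Top (base_ar X m) h = base_ar X k"
  obtains l where "l \<in> hom_set X z y" "base_ar X l = h" "Cmp X m l = k"
proof -
  have c: "\<forall>m\<in>Ar X. \<forall>k\<in>Ar X. \<forall>h\<in>Ar Top.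
        Cod X m = Cod X k \<and> Dom Top h = base_ob X (Dom X k) \<and>
        Cod Top h = base_ob X (Dom X m) \<and> Cmp Top (base_ar X m) h = base_ar X k \<longrightarrow>
        (\<exists>!l. l \<in> hom_set X (Dom X k) (Dom X m) \<and> base_ar X l = h \<and> Cmp X m l = k)"
    using fibred unfolding fibred_in_groupoids_def by blast
  have "\<exists>!l. l \<in> hom_set X (Dom X k) (Dom X m) \<and> base_ar X l = h \<and> Cmp X m l = k"
    using bspec[OF bspec[OF bspec[OF c, of m], of k], of h] assms by (auto simp: hom_set_def)
  then show thesis using that assms by (auto simp: hom_set_def)
qed

text \<open>Every arrow is cartesian, so by uniqueness of lifts it can be cancelled on the left
  among arrows with the same base. This is the standard way below to prove that two arrows
  agree.\<close>

lemma cartesian_cancel: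
  assumes "m \<in> hom_set X y x" "l \<in> hom_set X z y" "l' \<in> hom_set X z y"
    "base_ar X l = base_ar X l'" "Cmp X m l = Cmp X m l'"
  shows "l = l'"
proof -
  have c: "\<forall>m\<in>Ar X. \<forall>k\<in>Ar X. \<forall>h\<in>Ar Top.
        Cod X m = Cod X k \<and> Dom Top h = base_ob X (Dom X k) \<and>
        Cod Top h = base_ob X (Dom X m) \<and> Cmp Top (base_ar X m) h = base_ar X k \<longrightarrow>
        (\<exists>!l. l \<in> hom_set X (Dom X k) (Dom X m) \<and> base_ar X l = h \<and> Cmp X m l = k)"
    using fibred unfolding fibred_in_groupoids_def by blast
  let ?k = "Cmp X m l"
  have k: "?k \<in> hom_set X z x" using assms by blast
  have "\<exists>!l'. l' \<in> hom_set X (Dom X ?k) (Dom X m) \<and> base_ar X l' = base_ar X l \<and> Cmp X m l' = ?k"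
    using bspec[OF bspec[OF bspec[OF c, of m], of ?k], of "base_ar X l"] assms k base_hom[OF assms(2)]
      base_cmp[OF assms(1,2)] by (auto simp: hom_set_def)
  moreover have "Dom X ?k = z" "Dom X m = y" using k assms by (auto simp: hom_set_def)
  ultimately show ?thesis using assms by metis
qed

text \<open>Two morphisms A and B are compared through a common object z to which both map
  compatibly. As \<open>\<beta> x\<close> is cartesian, \<open>\<alpha> x\<close> factors through it
  by an arrow over the identity; these factorizations are natural because both sides of each
  naturality square agree after composition with \<open>\<beta>\<close>.\<close>

lemma two_morphism_from_cones:
  assumes A: "stack_morphism R X A" and B: "stack_morphism R X B"
    and \<alpha>: "\<And>x. x \<in> Ob R \<Longrightarrow> \<alpha> x \<in> hom_set X (on_ob A x) z"
    and \<beta>: "\<And>x. x \<in> Ob R \<Longrightarrow> \<beta> x \<in> hom_set X (on_ob B x) z"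
    and base: "\<And>x. x \<in> Ob R \<Longrightarrow> base_ar X (\<alpha> x) = base_ar X (\<beta> x)"
    and n\<alpha>: "\<And>f x y. f \<in> hom_set R x y \<Longrightarrow> Cmp X (\<alpha> y) (on_ar A f) = \<alpha> x"
    and n\<beta>: "\<And>f x y. f \<in> hom_set R x y \<Longrightarrow> Cmp X (\<beta> y) (on_ar B f) = \<beta> x"
    and R: "\<And>f x y. f \<in> hom_set R x y \<Longrightarrow> x \<in> Ob R \<and> y \<in> Ob R"
  obtains \<eta> where "two_morphism R X A B \<eta>"
proof -
  have "\<exists>l. l \<in> hom_set X (on_ob A x) (on_ob B x) \<and> base_ar X l = Idt Top (base_ob R x) \<and> Cmp X (\<beta> x) l = \<alpha> x"
    if x: "x \<in> Ob R" for x
  proof (rule cartesian[OF \<beta>[OF x] \<alpha>[OF x], of "Idt Top (base_ob R x)"])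
    have bA: "base_ob X (on_ob A x) = base_ob R x" "base_ob X (on_ob B x) = base_ob R x"
      using stack_morphism_ob[OF A x] stack_morphism_ob[OF B x] .
    show "Idt Top (base_ob R x) \<in> hom_set Top (base_ob X (on_ob A x)) (base_ob X (on_ob B x))"
      unfolding bA by (rule cat_idt[OF category_Top]) simp
    have "base_ar X (\<beta> x) \<in> hom_set Top (base_ob R x) (base_ob X z)"
      using base_hom[OF \<beta>[OF x]] bA by simp
    then show "Cmp Top (base_ar X (\<beta> x)) (Idt Top (base_ob R x)) = base_ar X (\<alpha> x)"
      using base[OF x] cat_idt_right[OF category_Top] by metis
  qed blast
  then obtain \<eta> where \<eta>: "\<And>x. x \<in> Ob R \<Longrightarrow> \<eta> x \<in> hom_set X (on_ob A x) (on_ob B x)"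
    "\<And>x. x \<in> Ob R \<Longrightarrow> base_ar X (\<eta> x) = Idt Top (base_ob R x)" "\<And>x. x \<in> Ob R \<Longrightarrow> Cmp X (\<beta> x) (\<eta> x) = \<alpha> x"
    by metis
  have "two_morphism R X A B \<eta>"
    unfolding two_morphism_def
  proof (intro conjI ballI)
    fix f assume "f \<in> Ar R"
    then have f: "f \<in> hom_set R (Dom R f) (Cod R f)" by (simp add: hom_set_def)
    let ?x = "Dom R f" and ?y = "Cod R f"
    have x: "?x \<in> Ob R" and y: "?y \<in> Ob R" using R[OF f] by auto
    note Af = stack_morphism_hom[OF A f] and Bf = stack_morphism_hom[OF B f]
    show "Cmp X (on_ar B f) (\<eta> ?x) = Cmp X (\<eta> ?y) (on_ar A f)"
    proof (rule cartesian_cancel[OF \<beta>[OF y]])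
      show "Cmp X (on_ar B f) (\<eta> ?x) \<in> hom_set X (on_ob A ?x) (on_ob B ?y)"
        "Cmp X (\<eta> ?y) (on_ar A f) \<in> hom_set X (on_ob A ?x) (on_ob B ?y)"
        using Af Bf \<eta> x y by blast+
      have b: "base_ar R f \<in> hom_set Top (base_ob R ?x) (base_ob R ?y)"
        using base_hom[OF Af] stack_morphism_ob[OF A x] stack_morphism_ob[OF A y] stack_morphism_ar[OF A f] by simp
      have "base_ar X (Cmp X (on_ar B f) (\<eta> ?x)) = base_ar R f"
        using base_cmp[OF Bf \<eta>(1)[OF x]] \<eta>(2)[OF x] stack_morphism_ar[OF B f] cat_idt_right[OF category_Top b] by simp
      moreover have "base_ar X (Cmp X (\<eta> ?y) (on_ar A f)) = base_ar R f"
        using base_cmp[OF \<eta>(1)[OF y] Af] \<eta>(2)[OF y] stack_morphism_ar[OF A f] cat_idt_left[OF category_Top b] by simp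
      ultimately show "base_ar X (Cmp X (on_ar B f) (\<eta> ?x)) = base_ar X (Cmp X (\<eta> ?y) (on_ar A f))" by simp
      have "Cmp X (\<beta> ?y) (Cmp X (on_ar B f) (\<eta> ?x)) = \<alpha> ?x"
        using assoc[OF \<beta>[OF y] Bf \<eta>(1)[OF x]] n\<beta>[OF f] \<eta>(3)[OF x] by simp
      moreover have "Cmp X (\<beta> ?y) (Cmp X (\<eta> ?y) (on_ar A f)) = \<alpha> ?x"
        using assoc[OF \<beta>[OF y] \<eta>(1)[OF y] Af] n\<alpha>[OF f] \<eta>(3)[OF y] by simp
      ultimately show "Cmp X (\<beta> ?y) (Cmp X (on_ar B f) (\<eta> ?x)) = Cmp X (\<beta> ?y) (Cmp X (\<eta> ?y) (on_ar A f))" by simp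
    qed
  qed (use \<eta> in auto)
  then show thesis by (rule that)
qed

end

section \<open>Represented stacks\<close>

lemma representable_simps [simp]:
  "Ob (representable U) = {f \<in> Ar Top. Cod Top f = U}"
  "Dom (representable U) (g, f) = Cmp Top f g" "Cod (representable U) (g, f) = f"
  "Idt (representable U) f = (Idt Top (Dom Top f), f)"
  "Cmp (representable U) (g', f') (g, f) = (Cmp Top g' g, f')"
  "base_ob (representable U) f = Dom Top f" "base_ar (representable U) (g, f) = g"
  by (simp_all add: representable_def)

lemma representable_hom:
  "m \<in> hom_set (representable U) a b \<longleftrightarrow>
    (\<exists>g. m = (g, b) \<and> b \<in> hom_set Top (Dom Top b) U \<and> g \<in> hom_set Top (Dom Top a) (Dom Top b) \<and> a = Cmp Top b g)"
proof -
  have "Dom Top (Cmp Top b g) = Dom Top g" if "g \<in> Ar Top" "b \<in> Ar Top" "Dom Top b = Cod Top g" for b g :: "'a tmap"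
    using cat_cmp[OF category_Top hom_setI[OF that(2,3) refl] hom_setI[OF that(1) refl refl]] by (simp add: hom_set_def)
  then show ?thesis
    by (cases m) (auto simp: hom_set_def representable_def)
qed

lemma representable_hom_ob:
  assumes "m \<in> hom_set (representable U) a b"
  shows "a \<in> Ob (representable U) \<and> b \<in> Ob (representable U)"
proof -
  obtain g where g: "b \<in> hom_set Top (Dom Top b) U" "g \<in> hom_set Top (Dom Top a) (Dom Top b)" "a = Cmp Top b g"
    using assms unfolding representable_hom by blast
  show ?thesis using cat_cmp[OF category_Top g(1,2)] g(1) unfolding g(3)[symmetric] by (simp add: hom_set_def)
qed

lemma representable_map_stack_morphism:
  assumes "j \<in> hom_set Top V U"
  shows "stack_morphism (representable V) (representable U) (representable_map j)"
proof -
  note cT = cat_cmp[OF category_Top] and aT = cat_assoc[OF category_Top]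
  have j: "Cmp Top j f \<in> hom_set Top (Dom Top f) U" if "f \<in> Ar Top" "Cod Top f = V" for f
    by (rule cT[OF assms]) (use that in \<open>auto simp: hom_set_def\<close>)
  show ?thesis
    unfolding stack_morphism_def
  proof (intro conjI)
    show "is_functor (representable V) (representable U) (representable_map j)"
    proof (rule is_functorI)
      fix f x y assume "f \<in> hom_set (representable V) x y"
      then obtain g where g: "f = (g, y)" "y \<in> hom_set Top (Dom Top y) V" "g \<in> hom_set Top (Dom Top x) (Dom Top y)" "x = Cmp Top y g"
        unfolding representable_hom by blast
      have "Dom Top x = Dom Top (Cmp Top j x)"
        using j[of x] cT[OF g(2,3)] unfolding g(4)[symmetric] by (simp add: hom_set_def)
      moreover have "Dom Top y = Dom Top (Cmp Top j y)" using j[of y] g(2) by (simp add: hom_set_def)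
      ultimately show "on_ar (representable_map j) f \<in> hom_set (representable U) (on_ob (representable_map j) x) (on_ob (representable_map j) y)"
        unfolding representable_hom
        using g j[of y] aT[OF assms g(2,3)] by (auto simp: representable_map_def hom_set_def)
    qed (use j in \<open>auto simp: representable_map_def representable_hom hom_set_def\<close>)
  qed (use j in \<open>auto simp: representable_map_def representable_def hom_set_def\<close>)
qed

context fibred
begin

text \<open>The morphism v chooses a pullback of x along every map into V, and \<open>c f\<close> is
  the chosen arrow to x. Besides v only the cone c is retained, since a cone over x is what
  \<open>two_morphism_from_cones\<close> asks for.\<close>

lemma yoneda:
  assumes x: "x \<in> Ob X" and V: "base_ob X x = V"
  obtains v c where "stack_morphism (representable V) X v"
    "\<And>f. f \<in> Ob (representable V) \<Longrightarrow> c f \<in> hom_set X (on_ob v f) x"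
    "\<And>f. f \<in> Ob (representable V) \<Longrightarrow> base_ar X (c f) = f"
    "\<And>m f g. m \<in> hom_set (representable V) f g \<Longrightarrow> Cmp X (c g) (on_ar v m) = c f"
proof -
  note cT = cat_cmp[OF category_Top] and aT = cat_assoc[OF category_Top]
  have "\<exists>m y. m \<in> hom_set X y x \<and> base_ar X m = f \<and> base_ob X y = Dom Top f" if "f \<in> Ob (representable V)" for f
    by (rule pullback[OF x, of f "Dom Top f"]) (use that V in \<open>auto simp: hom_set_def\<close>)
  then obtain c p where c: "\<And>f. f \<in> Ob (representable V) \<Longrightarrow> c f \<in> hom_set X (p f) x"
    and cb: "\<And>f. f \<in> Ob (representable V) \<Longrightarrow> base_ar X (c f) = f"
    and pb: "\<And>f. f \<in> Ob (representable V) \<Longrightarrow> base_ob X (p f) = Dom Top f"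
    by metis
  let ?dom = "\<lambda>m. Dom (representable V) m" and ?cod = "\<lambda>m. Cod (representable V) m"
  have ex: "\<exists>l. l \<in> hom_set X (p f) (p g) \<and> base_ar X l = fst m \<and> Cmp X (c g) l = c f"
    if m: "m \<in> hom_set (representable V) f g" for m f g
  proof -
    obtain h where h: "m = (h, g)" "g \<in> hom_set Top (Dom Top g) V" "h \<in> hom_set Top (Dom Top f) (Dom Top g)" "f = Cmp Top g h"
      using m unfolding representable_hom by blast
    have f: "f \<in> Ob (representable V)" and g: "g \<in> Ob (representable V)"
      using h cT[OF h(2,3)] by (auto simp: hom_set_def)
    show ?thesis
      by (rule cartesian[OF c[OF g] c[OF f], of h]) (use h f g pb cb in auto)
  qed
  have "\<forall>m\<in>Ar (representable V). \<exists>l. l \<in> hom_set X (p (?dom m)) (p (?cod m)) \<and> base_ar X l = fst m \<and>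
      Cmp X (c (?cod m)) l = c (?dom m)"
    using ex[OF hom_setI[OF _ refl refl]] by (rule ballI)
  then obtain l where l': "\<forall>m\<in>Ar (representable V). l m \<in> hom_set X (p (?dom m)) (p (?cod m)) \<and>
      base_ar X (l m) = fst m \<and> Cmp X (c (?cod m)) (l m) = c (?dom m)"
    by (rule bchoice[THEN exE])
  have l: "\<And>m f g. m \<in> hom_set (representable V) f g \<Longrightarrow> l m \<in> hom_set X (p f) (p g)"
      "\<And>m f g. m \<in> hom_set (representable V) f g \<Longrightarrow> base_ar X (l m) = fst m"
      "\<And>m f g. m \<in> hom_set (representable V) f g \<Longrightarrow> Cmp X (c g) (l m) = c f"
    using l' hom_setD[where C = "representable V"] by metis+
  let ?v = "\<lparr>on_ob = p, on_ar = l\<rparr>"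
  \<comment> \<open>Pullbacks are chosen without any coherence. Functoriality holds nevertheless,
    since the two candidates lift the same base arrow and agree after composition with c.\<close>
  have F: "is_functor (representable V) X ?v"
  proof (rule is_functorI, goal_cases)
    case (1 f) then show ?case using hom_ob[OF c] by simp
  next
    case (2 m f g) then show ?case using l by simp
  next
    case (3 f)
    have p: "p f \<in> Ob X" using hom_ob[OF c[OF 3]] by blast
    have m: "Idt (representable V) f \<in> hom_set (representable V) f f"
      using 3 cat_idt[OF category_Top, of "Dom Top f"] cat_idt_right[OF category_Top hom_setI[OF _ refl refl], of f]
      unfolding representable_hom by (simp add: hom_set_def)
    have "l (Idt (representable V) f) = Idt X (p f)"
      by (rule cartesian_cancel[OF c[OF 3] l(1)[OF m] idt[OF p]])
         (use l(2,3)[OF m] base_idt[OF p] pb[OF 3] c[OF 3] in auto)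
    then show ?case by simp
  next
    case (4 m n f g h)
    have m: "Cmp (representable V) n m \<in> hom_set (representable V) f h"
      "fst (Cmp (representable V) n m) = Cmp Top (fst n) (fst m)"
    proof -
      obtain k where k: "m = (k, g)" "g \<in> hom_set Top (Dom Top g) V" "k \<in> hom_set Top (Dom Top f) (Dom Top g)" "f = Cmp Top g k"
        using 4(1) unfolding representable_hom by blast
      obtain k' where k': "n = (k', h)" "h \<in> hom_set Top (Dom Top h) V" "k' \<in> hom_set Top (Dom Top g) (Dom Top h)" "g = Cmp Top h k'"
        using 4(2) unfolding representable_hom by blast
      show "fst (Cmp (representable V) n m) = Cmp Top (fst n) (fst m)" using k(1) k'(1) by simp
      show "Cmp (representable V) n m \<in> hom_set (representable V) f h"
        unfolding representable_hom using k(1) k'(1,2) cT[OF k'(3) k(3)] aT[OF k'(2,3) k(3)] k(4) k'(4) by simp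
    qed
    have "l (Cmp (representable V) n m) = Cmp X (l n) (l m)"
      by (rule cartesian_cancel[OF c l(1)[OF m(1)] cmp[OF l(1)[OF 4(2)] l(1)[OF 4(1)]]])
         (use representable_hom_ob[OF 4(2)] l(2,3)[OF m(1)] l(2,3)[OF 4(1)] l(2,3)[OF 4(2)] m(2) base_cmp[OF l(1)[OF 4(2)] l(1)[OF 4(1)]]
           assoc[OF c l(1)[OF 4(2)] l(1)[OF 4(1)], symmetric] in auto)
    then show ?case by simp
  qed
  have "stack_morphism (representable V) X ?v"
    unfolding stack_morphism_def using F pb l(2)[OF hom_setI[OF _ refl refl]] by (auto simp: representable_def)
  from that[OF this] show thesis using c cb l by auto
qed

end

text \<open>A morphism u from a represented stack is governed by the object x that it assigns to the
  identity of U. A local lift d of x yields by \<open>yoneda\<close> a morphism v over V. Both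
  \<open>F v\<close> and the restriction of u to V then carry cones over x, which produce the
  required 2-morphism.\<close>

lemma epimorphismI:
  assumes D: "fibred_in_groupoids D" and C: "fibred_in_groupoids C" and F: "stack_morphism D C F"
    and loc: "\<And>x U. x \<in> Ob C \<Longrightarrow> base_ob C x = U \<Longrightarrow>
      \<exists>\<U>. open_cover U \<U> \<and> (\<forall>V\<in>\<U>. \<exists>d\<in>Ob D. base_ob D d = subtopology U V \<and>
        (\<exists>\<kappa>\<in>hom_set C (on_ob F d) x. base_ar C \<kappa> = incl (subtopology U V) U))"
  shows "epimorphism D C F"
  unfolding epimorphism_def
proof (intro conjI allI impI, rule F)
  interpret D: fibred D by (rule fibred.intro[OF D])
  interpret C: fibred C by (rule fibred.intro[OF C])
  note cT = cat_cmp[OF category_Top] and aT = cat_assoc[OF category_Top]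
  fix U u assume u: "stack_morphism (representable U) C u"
  define x where "x = on_ob u (Idt Top U)"
  have I: "Idt Top U \<in> hom_set Top U U" by (rule cat_idt[OF category_Top]) simp
  have I': "Idt Top U \<in> Ob (representable U)" and dI: "Dom Top (Idt Top U) = U"
    using I by (simp_all add: hom_set_def)
  have x: "x \<in> Ob C" "base_ob C x = U"
    using functor_ob[OF stack_morphism_functor[OF u] I'] stack_morphism_ob[OF u I'] unfolding x_def by simp_all
  have b: "(f, Idt Top U) \<in> hom_set (representable U) f (Idt Top U)" if "f \<in> Ar Top" "Cod Top f = U" for f
    unfolding representable_hom using that I cat_idt_left[OF category_Top, of f "Dom Top f" U] dI
    by (simp add: hom_set_def)
  obtain \<U> where \<U>: "open_cover U \<U>" and loc': "\<forall>V\<in>\<U>. \<exists>d\<in>Ob D. base_ob D d = subtopology U V \<and>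
        (\<exists>\<kappa>\<in>hom_set C (on_ob F d) x. base_ar C \<kappa> = incl (subtopology U V) U)"
    using loc[OF x] by blast
  show "\<exists>\<U>. open_cover U \<U> \<and> (\<forall>V\<in>\<U>. \<exists>v \<eta>. stack_morphism (representable (subtopology U V)) D v \<and>
     two_morphism (representable (subtopology U V)) C (comp_func F v)
       (comp_func u (representable_map (incl (subtopology U V) U))) \<eta>)"
  proof (intro exI[of _ \<U>] conjI ballI \<U>)
    fix V assume "V \<in> \<U>"
    then obtain d \<kappa> where d: "d \<in> Ob D" "base_ob D d = subtopology U V"
      and \<kappa>: "\<kappa> \<in> hom_set C (on_ob F d) x" "base_ar C \<kappa> = incl (subtopology U V) U" using loc' by blast
    let ?j = "incl (subtopology U V) U" and ?V = "subtopology U V"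
    let ?R = "representable ?V"
    have j: "?j \<in> hom_set Top ?V U"
      by (auto simp: hom_set_def incl_def continuous_map_from_subtopology)
    obtain v c where v: "stack_morphism ?R D v"
      and c: "\<And>f. f \<in> Ob ?R \<Longrightarrow> c f \<in> hom_set D (on_ob v f) d" "\<And>f. f \<in> Ob ?R \<Longrightarrow> base_ar D (c f) = f"
        "\<And>m f g. m \<in> hom_set ?R f g \<Longrightarrow> Cmp D (c g) (on_ar v m) = c f"
      by (rule D.yoneda[OF d]) blast
    have jf: "Cmp Top ?j f \<in> hom_set Top (Dom Top f) U" if "f \<in> Ob ?R" for f
      by (rule cT[OF j]) (use that in \<open>auto simp: hom_set_def\<close>)
    note rj = representable_map_stack_morphism[OF j]
    have \<beta>: "(Cmp Top ?j f, Idt Top U) \<in> hom_set (representable U) (Cmp Top ?j f) (Idt Top U)" if "f \<in> Ob ?R" for f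
      using b jf[OF that] by (simp add: hom_set_def)
    \<comment> \<open>The first cone is the image under F of the cone of d, continued by \<kappa>.
      The second is u applied to the canonical arrow from \<open>Cmp Top ?j f\<close> to the
      terminal object \<open>Idt Top U\<close> of the slice.\<close>
    obtain \<eta> where "two_morphism ?R C (comp_func F v) (comp_func u (representable_map ?j)) \<eta>"
    proof (rule C.two_morphism_from_cones[where z = x and \<alpha> = "\<lambda>f. Cmp C \<kappa> (on_ar F (c f))"
          and \<beta> = "\<lambda>f. on_ar u (Cmp Top ?j f, Idt Top U)"])
      show "stack_morphism ?R C (comp_func F v)" by (rule stack_morphism_comp[OF v F])
      show "stack_morphism ?R C (comp_func u (representable_map ?j))" by (rule stack_morphism_comp[OF rj u])
      fix f assume f: "f \<in> Ob ?R"
      note Fc = stack_morphism_hom[OF F c(1)[OF f]]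
      show "Cmp C \<kappa> (on_ar F (c f)) \<in> hom_set C (on_ob (comp_func F v) f) x"
        using C.cmp[OF \<kappa>(1) Fc] by (simp add: comp_func_def)
      show "on_ar u (Cmp Top ?j f, Idt Top U) \<in> hom_set C (on_ob (comp_func u (representable_map ?j)) f) x"
        using stack_morphism_hom[OF u \<beta>[OF f]] by (simp add: x_def comp_func_def representable_map_def)
      show "base_ar C (Cmp C \<kappa> (on_ar F (c f))) = base_ar C (on_ar u (Cmp Top ?j f, Idt Top U))"
        using C.base_cmp[OF \<kappa>(1) Fc] \<kappa>(2) stack_morphism_ar[OF F c(1)[OF f]] c(2)[OF f] stack_morphism_ar[OF u \<beta>[OF f]]
        by simp
    next
      fix m f g assume m: "m \<in> hom_set ?R f g"
      have f: "f \<in> Ob ?R" and g: "g \<in> Ob ?R" using representable_hom_ob[OF m] by auto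
      have "Cmp C (on_ar F (c g)) (on_ar F (on_ar v m)) = on_ar F (c f)"
        using functor_cmp[OF stack_morphism_functor[OF F] c(1)[OF g] stack_morphism_hom[OF v m]] c(3)[OF m] by simp
      then show "Cmp C (Cmp C \<kappa> (on_ar F (c g))) (on_ar (comp_func F v) m) = Cmp C \<kappa> (on_ar F (c f))"
        using C.assoc[OF \<kappa>(1) stack_morphism_hom[OF F c(1)[OF g]] stack_morphism_hom[OF F stack_morphism_hom[OF v m]]]
        by (simp add: comp_func_def)
      obtain h where h: "m = (h, g)" "g \<in> hom_set Top (Dom Top g) ?V" "h \<in> hom_set Top (Dom Top f) (Dom Top g)" "f = Cmp Top g h"
        using m unfolding representable_hom by blast
      have "Cmp (representable U) (Cmp Top ?j g, Idt Top U) (on_ar (representable_map ?j) m) = (Cmp Top ?j f, Idt Top U)"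
        using h aT[OF j h(2,3)] by (simp add: representable_map_def)
      then show "Cmp C (on_ar u (Cmp Top ?j g, Idt Top U)) (on_ar (comp_func u (representable_map ?j)) m) = on_ar u (Cmp Top ?j f, Idt Top U)"
        using functor_cmp[OF stack_morphism_functor[OF u] \<beta>[OF g], of "on_ar (representable_map ?j) m" "on_ob (representable_map ?j) f"]
          stack_morphism_hom[OF rj m] by (simp add: comp_func_def representable_map_def)
      show "f \<in> Ob ?R \<and> g \<in> Ob ?R" using f g ..
    qed
    then show "\<exists>v \<eta>. stack_morphism ?R D v \<and> two_morphism ?R C (comp_func F v) (comp_func u (representable_map ?j)) \<eta>"
      using v by blast
  qed
qed


section \<open>The category of principal bundles\<close>

lemma classifying_stack_simps [simp]:
  "Ob (classifying_stack G) = {P. principal_bundle G P}" "Ar (classifying_stack G) = bundle_maps G"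
  "Dom (classifying_stack G) (P, Q, \<phi>, f) = P" "Cod (classifying_stack G) (P, Q, \<phi>, f) = Q"
  "Idt (classifying_stack G) P = (P, P, \<lambda>p\<in>pts P. p, \<lambda>x\<in>topspace (bbase P). x)"
  "Cmp (classifying_stack G) (Q', R, \<psi>, g) (P, Q, \<phi>, f) =
     (P, R, compose (pts P) \<psi> \<phi>, compose (topspace (bbase P)) g f)"
  "base_ob (classifying_stack G) P = bbase P"
  "base_ar (classifying_stack G) (P, Q, \<phi>, f) = (bbase P, bbase Q, f)"
  by (simp_all add: classifying_stack_def)

lemma classifying_stack_hom:
  "m \<in> hom_set (classifying_stack G) P Q \<longleftrightarrow> (\<exists>\<phi> f. m = (P, Q, \<phi>, f) \<and> (P, Q, \<phi>, f) \<in> bundle_maps G)"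
  by (cases m) (auto simp: hom_set_def)

context topgpd
begin

abbreviation B where "B \<equiv> classifying_stack G"

lemma bundle_maps_compose:
  assumes m: "(P, Q, \<phi>, f) \<in> bundle_maps G" and k: "(Q, R, \<psi>, g) \<in> bundle_maps G"
  shows "(P, R, compose (pts P) \<psi> \<phi>, compose (topspace (bbase P)) g f) \<in> bundle_maps G"
  unfolding compose_def
proof (rule bundle_mapsI)
  show "principal_bundle G P" "principal_bundle G R"
    using bundle_map_principal_dom[OF m] bundle_map_principal_cod[OF k] .
  show "continuous_map (btot P) (btot R) (\<lambda>p. \<psi> (\<phi> p))"
    by (rule continuous_map_compose_apply[OF bundle_map_continuous[OF k] bundle_map_continuous[OF m]])
  show "continuous_map (bbase P) (bbase R) (\<lambda>x\<in>topspace (bbase P). g (f x))"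
    by (simp, rule continuous_map_compose_apply[OF bundle_map_continuous_base[OF k] bundle_map_continuous_base[OF m]])
  show "bproj R (\<psi> (\<phi> p)) = (\<lambda>x\<in>topspace (bbase P). g (f x)) (bproj P p) \<and> banch R (\<psi> (\<phi> p)) = banch P p"
    if "p \<in> pts P" for p
    using that bundle_map_bproj[OF m] bundle_map_bproj[OF k] bundle_map_banch[OF m] bundle_map_banch[OF k]
      bundle_map_in[OF m] bundle_map_principal_dom[OF m] by simp
  show "\<psi> (\<phi> (bact P p \<gamma>)) = bact R (\<psi> (\<phi> p)) \<gamma>"
    if "p \<in> pts P" "\<gamma> \<in> arr" "banch P p = tgt \<gamma>" for p \<gamma>
    using that bundle_map_bact[OF m] bundle_map_bact[OF k] bundle_map_in[OF m] bundle_map_banch[OF m] by simp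
qed simp

lemma bundle_map_idt:
  assumes P: "principal_bundle G P"
  shows "(P, P, \<lambda>p\<in>pts P. p, \<lambda>x\<in>topspace (bbase P). x) \<in> bundle_maps G"
  by (rule bundle_mapsI) (use P in \<open>auto simp: continuous_map_id[unfolded id_def]\<close>)

lemma category_classifying_stack: "category B"
proof (rule categoryI)
  fix m k l P Q R S
  assume "m \<in> hom_set B P Q" "k \<in> hom_set B Q R"
  then obtain \<phi> f \<psi> g where m: "m = (P, Q, \<phi>, f)" "(P, Q, \<phi>, f) \<in> bundle_maps G"
    and k: "k = (Q, R, \<psi>, g)" "(Q, R, \<psi>, g) \<in> bundle_maps G"
    unfolding classifying_stack_hom by blast
  show "Cmp B k m \<in> hom_set B P R"
    unfolding classifying_stack_hom using m k bundle_maps_compose by auto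
  assume "l \<in> hom_set B R S"
  then obtain \<zeta> h where l: "l = (R, S, \<zeta>, h)" "(R, S, \<zeta>, h) \<in> bundle_maps G"
    unfolding classifying_stack_hom by blast
  show "Cmp B l (Cmp B k m) = Cmp B (Cmp B l k) m"
    using m(1) k(1) l(1) bundle_map_in[OF m(2)] bundle_map_base_in[OF m(2)]
    by (auto simp: compose_def restrict_def fun_eq_iff)
next
  fix m P Q
  assume "m \<in> hom_set B P Q"
  then obtain \<phi> f where m: "m = (P, Q, \<phi>, f)" "(P, Q, \<phi>, f) \<in> bundle_maps G"
    unfolding classifying_stack_hom by blast
  show "Cmp B m (Idt B P) = m \<and> Cmp B (Idt B Q) m = m"
    using m(1) bundle_map_in[OF m(2)] bundle_map_base_in[OF m(2)]
      bundle_map_extensional[OF m(2)] bundle_map_extensional_base[OF m(2)]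
    by (auto simp: compose_def restrict_def fun_eq_iff extensional_def)
next
  fix m assume "m \<in> Ar B"
  then show "Dom B m \<in> Ob B \<and> Cod B m \<in> Ob B"
    by (cases m) (use bundle_map_principal_dom bundle_map_principal_cod in auto)
next
  fix P assume "P \<in> Ob B"
  then show "Idt B P \<in> hom_set B P P"
    unfolding classifying_stack_hom using bundle_map_idt by simp
qed

lemma proj_classifying_stack: "is_functor B Top (proj B)"
proof (rule is_functorI)
  fix m k P Q R
  assume "m \<in> hom_set B P Q"
  then obtain \<phi> f where m: "m = (P, Q, \<phi>, f)" "(P, Q, \<phi>, f) \<in> bundle_maps G"
    unfolding classifying_stack_hom by blast
  then show "base_ar B m \<in> hom_set Top (base_ob B P) (base_ob B Q)"
    using bundle_map_continuous_base[OF m(2)] bundle_map_extensional_base[OF m(2)] by (simp add: hom_set_def)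
  assume "k \<in> hom_set B Q R"
  then obtain \<psi> g where k: "k = (Q, R, \<psi>, g)" "(Q, R, \<psi>, g) \<in> bundle_maps G"
    unfolding classifying_stack_hom by blast
  show "base_ar B (Cmp B k m) =
     Cmp Top (base_ar B k) (base_ar B m)"
    using m(1) k(1) by simp
qed auto

text \<open>Over \<open>h (bproj Q q)\<close> there is exactly one point that \<phi> sends to
  \<open>\<psi> q\<close>; taking it for every q gives the factorization that the fibred category
  requires.\<close>

lemma bundle_map_lift:
  assumes m: "(P, R, \<phi>, f) \<in> bundle_maps G" and k: "(Q, R, \<psi>, g) \<in> bundle_maps G"
    and h: "continuous_map (bbase Q) (bbase P) h" "h \<in> extensional (topspace (bbase Q))"
    and fh: "\<And>n. n \<in> topspace (bbase Q) \<Longrightarrow> f (h n) = g n"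
  shows "(Q, P, \<lambda>q\<in>pts Q. fibre_inverse P \<phi> (h (bproj Q q)) (\<psi> q), h) \<in> bundle_maps G"
proof (rule bundle_mapsI[OF _ _ _ h(1) _ _ h(2)])
  show P: "principal_bundle G P" and Q: "principal_bundle G Q"
    using bundle_map_principal_dom[OF m] bundle_map_principal_dom[OF k] .
  have e: "bproj R (\<psi> q) = f (h (bproj Q q))" if "q \<in> pts Q" for q
    using bundle_map_bproj[OF k that] fh Q that by simp
  show "continuous_map (btot Q) (btot P) (\<lambda>q. fibre_inverse P \<phi> (h (bproj Q q)) (\<psi> q))"
    by (rule continuous_fibre_inverse[OF m continuous_map_compose_apply[OF h(1) continuous_bproj[OF Q]] bundle_map_continuous[OF k] e])
  have h_in: "h (bproj Q q) \<in> topspace (bbase P)" if "q \<in> pts Q" for q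
    using continuous_map_topspace[OF h(1)] Q that by simp
  fix q assume q: "q \<in> pts Q"
  note fi = m h_in[OF q] bundle_map_in[OF k q] e[OF q]
  show "bproj P (fibre_inverse P \<phi> (h (bproj Q q)) (\<psi> q)) = h (bproj Q q) \<and>
    banch P (fibre_inverse P \<phi> (h (bproj Q q)) (\<psi> q)) = banch Q q"
    using bproj_fibre_inverse[OF fi] banch_fibre_inverse[OF fi] bundle_map_banch[OF k q] by simp
  fix \<gamma> assume g: "\<gamma> \<in> arr" "banch Q q = tgt \<gamma>"
  then show "fibre_inverse P \<phi> (h (bproj Q (bact Q q \<gamma>))) (\<psi> (bact Q q \<gamma>)) =
      bact P (fibre_inverse P \<phi> (h (bproj Q q)) (\<psi> q)) \<gamma>"
    using fibre_inverse_bact[OF fi g(1)] bundle_map_bact[OF k q g] bundle_map_banch[OF k q] Q q by simp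
qed

end

context topgpd_infinite
begin

text \<open>Lifts of base maps are pullback bundles. Factorizations come from
  \<open>bundle_map_lift\<close> and are unique because bundle maps are injective on fibres.\<close>

lemma fibred_classifying_stack: "fibred_in_groupoids B"
  unfolding fibred_in_groupoids_def
proof (intro conjI ballI impI category_classifying_stack proj_classifying_stack)
  fix P f assume P: "P \<in> Ob B" and f: "f \<in> Ar Top" "Cod Top f = base_ob B P"
  obtain N f0 where f0: "f = (N, bbase P, f0)" using f by (cases f) auto
  show "\<exists>m\<in>Ar B. Cod B m = P \<and> base_ar B m = f"
    by (rule bexI[OF _ pullback_bundle(2)[of P N f0, folded classifying_stack_simps(2)]])
       (use P f f0 in \<open>auto simp: pullback_bundle_def\<close>)
next
  fix m k h
  assume m: "m \<in> Ar B" and k: "k \<in> Ar B" and h: "h \<in> Ar Top"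
    and eq: "Cod B m = Cod B k \<and> Dom Top h = base_ob B (Dom B k) \<and>
        Cod Top h = base_ob B (Dom B m) \<and>
        Cmp Top (base_ar B m) h = base_ar B k"
  obtain P R \<phi> f where m': "m = (P, R, \<phi>, f)" "(P, R, \<phi>, f) \<in> bundle_maps G" using m by (cases m) auto
  obtain Q \<psi> g where k': "k = (Q, R, \<psi>, g)" "(Q, R, \<psi>, g) \<in> bundle_maps G" using k eq m' by (cases k) auto
  obtain h0 where h0: "h = (bbase Q, bbase P, h0)" "continuous_map (bbase Q) (bbase P) h0" "h0 \<in> extensional (topspace (bbase Q))"
    using h eq m' k' by (cases h) auto
  have c: "compose (topspace (bbase Q)) f h0 = g" using eq m' k' h0 by simp
  then have fh: "f (h0 n) = g n" if "n \<in> topspace (bbase Q)" for n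
    using that by (auto simp: compose_def)
  let ?l = "\<lambda>q\<in>pts Q. fibre_inverse P \<phi> (h0 (bproj Q q)) (\<psi> q)"
  have l: "(Q, P, ?l, h0) \<in> bundle_maps G"
    by (rule bundle_map_lift[OF m'(2) k'(2) h0(2,3) fh])
  have Q: "principal_bundle G Q" using bundle_map_principal_dom[OF k'(2)] .
  have fi: "\<phi> (?l q) = \<psi> q" if "q \<in> pts Q" for q
    using bundle_map_fibre_inverse[OF m'(2), of "h0 (bproj Q q)" "\<psi> q"] that Q
      continuous_map_topspace[OF h0(2)] bundle_map_in[OF k'(2)] bundle_map_bproj[OF k'(2)] fh by simp
  show "\<exists>!l. l \<in> hom_set B (Dom B k) (Dom B m) \<and>
      base_ar B l = h \<and> Cmp B m l = k"
  proof (rule ex1I[of _ "(Q, P, ?l, h0)"])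
    show "(Q, P, ?l, h0) \<in> hom_set B (Dom B k) (Dom B m) \<and>
      base_ar B (Q, P, ?l, h0) = h \<and> Cmp B m (Q, P, ?l, h0) = k"
    proof (intro conjI)
      have "compose (pts Q) \<phi> ?l = \<psi>"
        using fi bundle_map_extensional[OF k'(2)] unfolding compose_def
        by (intro extensionalityI[where A = "pts Q"]) auto
      then show "Cmp B m (Q, P, ?l, h0) = k" using m'(1) k'(1) c by simp
    qed (use l m' k' h0(1) in \<open>auto simp only: classifying_stack_hom classifying_stack_simps\<close>)
    fix l' assume l': "l' \<in> hom_set B (Dom B k) (Dom B m) \<and>
      base_ar B l' = h \<and> Cmp B m l' = k"
    then obtain \<zeta> where \<zeta>: "l' = (Q, P, \<zeta>, h0)" "(Q, P, \<zeta>, h0) \<in> bundle_maps G"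
      using m' k' h0(1) by (auto simp: classifying_stack_hom)
    have "\<zeta> q = ?l q" for q
    proof (cases "q \<in> pts Q")
      case True
      have "compose (pts Q) \<phi> \<zeta> = \<psi>" using l' \<zeta> m' k' by simp
      then have "\<phi> (\<zeta> q) = \<psi> q" using True by (auto simp: compose_def)
      then show ?thesis
        using bundle_map_inj[OF m'(2) bundle_map_in[OF \<zeta>(2) True] bundle_map_in[OF l True]]
          fi[OF True] bundle_map_bproj[OF \<zeta>(2) True] bundle_map_bproj[OF l True] by simp
    next
      case False
      then show ?thesis using bundle_map_extensional[OF \<zeta>(2)] by (simp add: extensional_def)
    qed
    then show "l' = (Q, P, ?l, h0)" using \<zeta> by auto
  qed
qed

end

sublocale topgpd_infinite \<subseteq> B: fibred "classifying_stack G"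
  by unfold_locales (rule fibred_classifying_stack)


section \<open>Gluing of bundle maps\<close>

lemma incl_hom: "S \<subseteq> W \<Longrightarrow> incl (subtopology N S) (subtopology N W) \<in> hom_set Top (subtopology N S) (subtopology N W)"
  by (auto simp: hom_set_def incl_def continuous_map_in_subtopology continuous_map_from_subtopology
      continuous_map_id[unfolded id_def])

lemma incl_hom': "incl (subtopology N S) N \<in> hom_set Top (subtopology N S) N"
  by (auto simp: hom_set_def incl_def continuous_map_from_subtopology)

lemma Cmp_incl:
  "S \<subseteq> W \<Longrightarrow> Cmp Top (incl (subtopology N W) K) (incl (subtopology N S) (subtopology N W)) = incl (subtopology N S) K"
  by (auto simp: incl_def compose_def fun_eq_iff)

lemma open_coverD:
  assumes "open_cover N \<U>" "V \<in> \<U>"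
  shows "openin N V" "V \<subseteq> topspace N" "topspace (subtopology N V) = V"
  using assms openin_subset[of N V] by (auto simp: open_cover_def)

lemma open_cover_point:
  assumes "open_cover N \<U>" "n \<in> topspace N"
  shows "(SOME V. V \<in> \<U> \<and> n \<in> V) \<in> \<U> \<and> n \<in> (SOME V. V \<in> \<U> \<and> n \<in> V)"
  by (rule someI_ex) (use assms in \<open>auto simp: open_cover_def\<close>)

context topgpd_infinite
begin

text \<open>Over V the glued map must be \<open>f V\<close> after the inverse of the restriction
  \<open>i V\<close>. The work lies in extracting a pointwise statement on overlaps from a premise
  that speaks of arrows of the stack.\<close>

lemma morphisms_glue_classifying_stack: "morphisms_glue B"
  unfolding morphisms_glue_def
proof (intro allI impI, elim conjE)
  fix N \<U> x y i f
  assume cov: "open_cover N \<U>" and x: "x \<in> Ob B" and y: "y \<in> Ob B" and xN: "base_ob B x = N" and yN: "base_ob B y = N"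
    and i0: "\<forall>V\<in>\<U>. i V \<in> Ar B \<and> Cod B (i V) = x \<and> base_ar B (i V) = incl (subtopology N V) N"
    and f0: "\<forall>V\<in>\<U>. f V \<in> hom_set B (Dom B (i V)) y \<and> base_ar B (f V) = incl (subtopology N V) N"
    and compat0: "\<forall>V\<in>\<U>. \<forall>W\<in>\<U>. \<forall>p\<in>Ar B. \<forall>q\<in>Ar B.
           Dom B p = Dom B q \<and> Cod B p = Dom B (i V) \<and> Cod B q = Dom B (i W) \<and>
           base_ar B p = incl (subtopology N (V \<inter> W)) (subtopology N V) \<and>
           base_ar B q = incl (subtopology N (V \<inter> W)) (subtopology N W) \<and>
           Cmp B (i V) p = Cmp B (i W) q \<longrightarrow>
           Cmp B (f V) p = Cmp B (f W) q"
  have px: "principal_bundle G x" and py: "principal_bundle G y" and bx: "bbase x = N" and by': "bbase y = N"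
    using x y xN yN by auto
  define D where "D V = Dom B (i V)" for V
  define im where "im V = fst (snd (snd (i V)))" for V
  define fm where "fm V = fst (snd (snd (f V)))" for V
  have i: "i V = (D V, x, im V, \<lambda>n\<in>V. n)" "(D V, x, im V, \<lambda>n\<in>V. n) \<in> bundle_maps G" "bbase (D V) = subtopology N V"
    if V: "V \<in> \<U>" for V
  proof -
    obtain d \<phi> g where *: "i V = (d, x, \<phi>, g)" "(d, x, \<phi>, g) \<in> bundle_maps G"
      using i0 V by (cases "i V") auto
    then have "(bbase d, bbase x, g) = incl (subtopology N V) N" using bspec[OF i0 V] by simp
    then have "g = (\<lambda>n\<in>V. n)" "bbase d = subtopology N V"
      using open_coverD[OF cov V] by (auto simp: incl_def)
    then show "i V = (D V, x, im V, \<lambda>n\<in>V. n)" "(D V, x, im V, \<lambda>n\<in>V. n) \<in> bundle_maps G" "bbase (D V) = subtopology N V"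
      using * by (auto simp: D_def im_def)
  qed
  have f: "f V = (D V, y, fm V, \<lambda>n\<in>V. n)" "(D V, y, fm V, \<lambda>n\<in>V. n) \<in> bundle_maps G"
    if V: "V \<in> \<U>" for V
  proof -
    obtain \<phi> g where *: "f V = (D V, y, \<phi>, g)" "(D V, y, \<phi>, g) \<in> bundle_maps G"
      using f0 V by (auto simp: classifying_stack_hom D_def)
    then have "(bbase (D V), bbase y, g) = incl (subtopology N V) N" using bspec[OF f0 V] by simp
    then have "g = (\<lambda>n\<in>V. n)"
      using open_coverD[OF cov V] by (auto simp: incl_def)
    then show "f V = (D V, y, fm V, \<lambda>n\<in>V. n)" "(D V, y, fm V, \<lambda>n\<in>V. n) \<in> bundle_maps G"
      using * by (auto simp: fm_def)
  qed
  \<comment> \<open>The inverse of \<open>i V\<close>: it takes a point of x over V to the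
    corresponding point of the restricted bundle \<open>D V\<close>.\<close>
  define b where "b V p = fibre_inverse (D V) (im V) (bproj x p) p" for V p
  have b: "b V p \<in> pts (D V)" "bproj (D V) (b V p) = bproj x p" "im V (b V p) = p" "banch (D V) (b V p) = banch x p"
    if "V \<in> \<U>" "p \<in> pts x" "bproj x p \<in> V" for V p
    unfolding b_def
    using fibre_inverse_in[OF i(2), of V "bproj x p" p] bproj_fibre_inverse[OF i(2), of V "bproj x p" p]
      bundle_map_fibre_inverse[OF i(2), of V "bproj x p" p] banch_fibre_inverse[OF i(2), of V "bproj x p" p] that
      open_coverD[OF cov that(1)] i(3) by auto
  have b_eq: "b V p = d" if "V \<in> \<U>" "d \<in> pts (D V)" "im V d = p" "bproj (D V) d = bproj x p" for V p d
    unfolding b_def by (rule fibre_inverse_eqI[OF i(2)]) (use that in auto)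
  have compat: "fm V (b V p) = fm W (b W p)"
    if V: "V \<in> \<U>" and W: "W \<in> \<U>" and p: "p \<in> pts x" "bproj x p \<in> V" "bproj x p \<in> W" for V W p
  proof -
    have iV: "i V \<in> hom_set B (D V) x" and iW: "i W \<in> hom_set B (D W) x"
      using i(1,2) V W by (auto simp: classifying_stack_hom)
    \<comment> \<open>The premise on overlaps concerns pairs of arrows from a common restriction to
      \<open>V \<inter> W\<close>, so such a pair has to be produced: w restricts
      \<open>D V\<close>, and the second leg l exists because \<open>i W\<close> is
      cartesian.\<close>
    obtain k w where k: "k \<in> hom_set B w (D V)" "base_ar B k = incl (subtopology N (V \<inter> W)) (subtopology N V)"
        "base_ob B w = subtopology N (V \<inter> W)"
    proof (rule B.pullback[of "D V" "incl (subtopology N (V \<inter> W)) (subtopology N V)" "subtopology N (V \<inter> W)"])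
      show "D V \<in> Ob B" using bundle_map_principal_dom[OF i(2)[OF V]] by simp
      show "incl (subtopology N (V \<inter> W)) (subtopology N V) \<in> hom_set Top (subtopology N (V \<inter> W)) (base_ob B (D V))"
        using incl_hom[of "V \<inter> W" V N] i(3)[OF V] by simp
    qed auto
    have ik: "Cmp B (i V) k \<in> hom_set B w x" using iV k(1) by (rule B.cmp)
    have bik: "base_ar B (Cmp B (i V) k) = incl (subtopology N (V \<inter> W)) N"
      using B.base_cmp[OF iV k(1)] k(2) i0 V Cmp_incl[of "V \<inter> W" V N] by simp
    obtain l where l: "l \<in> hom_set B w (D W)" "base_ar B l = incl (subtopology N (V \<inter> W)) (subtopology N W)"
       "Cmp B (i W) l = Cmp B (i V) k"
    proof (rule B.cartesian[OF iW ik, of "incl (subtopology N (V \<inter> W)) (subtopology N W)"])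
      show "incl (subtopology N (V \<inter> W)) (subtopology N W) \<in> hom_set Top (base_ob B w) (base_ob B (D W))"
        using incl_hom[of "V \<inter> W" W N] i(3)[OF W] k(3) by simp
      show "Cmp Top (base_ar B (i W)) (incl (subtopology N (V \<inter> W)) (subtopology N W)) = base_ar B (Cmp B (i V) k)"
        using i0 W Cmp_incl[of "V \<inter> W" W N] bik by simp
    qed auto
    have "Cmp B (f V) k = Cmp B (f W) l"
      by (rule compat0[rule_format, OF V W]) (use k l in \<open>auto simp: hom_set_def D_def\<close>)
    moreover obtain \<kappa> g where \<kappa>: "k = (w, D V, \<kappa>, g)" "(w, D V, \<kappa>, g) \<in> bundle_maps G"
      using k(1) by (auto simp: classifying_stack_hom)
    moreover obtain \<mu> g' where \<mu>: "l = (w, D W, \<mu>, g')" "(w, D W, \<mu>, g') \<in> bundle_maps G"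
      using l(1) by (auto simp: classifying_stack_hom)
    ultimately have c1: "compose (pts w) (fm V) \<kappa> = compose (pts w) (fm W) \<mu>"
      using f(1) V W by simp
    have c2: "compose (pts w) (im W) \<mu> = compose (pts w) (im V) \<kappa>"
      using l(3) i(1) V W \<kappa> \<mu> by simp
    have g: "g = (\<lambda>n\<in>V \<inter> W. n)" "bbase w = subtopology N (V \<inter> W)"
    proof -
      have "topspace N \<inter> (V \<inter> W) = V \<inter> W" using open_coverD[OF cov V] by auto
      then show "g = (\<lambda>n\<in>V \<inter> W. n)" "bbase w = subtopology N (V \<inter> W)"
        using k(2,3) \<kappa> by (simp_all add: incl_def)
    qed
    \<comment> \<open>The point of w above \<open>b V p\<close>. Evaluating the equalities of arrows
      there turns them into equalities of points.\<close>
    let ?d = "fibre_inverse w \<kappa> (bproj x p) (b V p)"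
    have n: "bproj x p \<in> topspace (bbase w)" using p open_coverD[OF cov V] g by auto
    have "bproj (D V) (b V p) = g (bproj x p)" using b(2)[OF V p(1,2)] g p by simp
    note fi = \<kappa>(2) n b(1)[OF V p(1,2)] this
    note d = fibre_inverse_in[OF fi] bproj_fibre_inverse[OF fi] bundle_map_fibre_inverse[OF fi]
    have eq: "im W (\<mu> ?d) = p" "fm V (b V p) = fm W (\<mu> ?d)"
      using fun_cong[OF c2, of ?d] fun_cong[OF c1, of ?d] d b(3)[OF V p(1,2)] by (auto simp: compose_def)
    have "b W p = \<mu> ?d"
    proof (rule b_eq[OF W _ eq(1)])
      show "\<mu> ?d \<in> pts (D W)" using bundle_map_in[OF \<mu>(2)] d by blast
      then show "bproj (D W) (\<mu> ?d) = bproj x p"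
        using bundle_map_bproj[OF i(2)[OF W], of "\<mu> ?d"] eq(1) bproj_in[OF bundle_map_principal_dom[OF i(2)[OF W]]]
          i(3)[OF W] open_coverD[OF cov W] by auto
    qed
    then show ?thesis using eq by simp
  qed
  \<comment> \<open>The member of the cover is chosen at each base point without any continuity. By
    \<open>compat\<close> the value of \<phi> does not depend on it, and continuity is tested with a
    fixed V.\<close>
  define ch where "ch n = (SOME V. V \<in> \<U> \<and> n \<in> V)" for n
  have ch: "ch n \<in> \<U>" "n \<in> ch n" if "n \<in> topspace N" for n
    unfolding ch_def using open_cover_point[OF cov that] by auto
  define \<phi> where "\<phi> p = fm (ch (bproj x p)) (b (ch (bproj x p)) p)" for p
  have pN: "bproj x p \<in> topspace N" if "p \<in> pts x" for p
    using bproj_in[OF px that] bx by simp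
  have \<phi>: "\<phi> p = fm V (b V p)" if "V \<in> \<U>" "p \<in> pts x" "bproj x p \<in> V" for V p
    unfolding \<phi>_def using compat[OF _ that(1,2) _ that(3)] ch[OF pN[OF that(2)]] by simp
  have cont_b: "continuous_map (subtopology (btot x) {p \<in> pts x. bproj x p \<in> V}) (btot (D V)) (b V)"
    if V: "V \<in> \<U>" for V
    unfolding b_def
  proof (rule continuous_fibre_inverse[OF i(2)[OF V]])
    show "continuous_map (subtopology (btot x) {p \<in> pts x. bproj x p \<in> V}) (bbase (D V)) (bproj x)"
      using continuous_bproj[OF px] bx by (auto simp: i(3)[OF V] continuous_map_in_subtopology continuous_map_from_subtopology)
  qed (auto simp: continuous_map_from_subtopology)
  have \<phi>_map: "(x, y, restrict \<phi> (pts x), \<lambda>n\<in>topspace N. n) \<in> bundle_maps G"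
  proof (rule bundle_mapsI[OF px py])
    show "continuous_map (btot x) (btot y) \<phi>"
    proof (rule continuous_map_locally)
      fix p assume p: "p \<in> pts x"
      obtain V where V: "V \<in> \<U>" "bproj x p \<in> V" using ch[OF pN[OF p]] by blast
      let ?S = "{p \<in> pts x. bproj x p \<in> V}"
      have "openin (bbase x) V" using open_coverD[OF cov V(1)] bx by simp
      then have "openin (btot x) ?S" by (rule openin_continuous_map_preimage[OF continuous_bproj[OF px]])
      moreover have "continuous_map (subtopology (btot x) ?S) (btot y) (\<lambda>p. fm V (b V p))"
        by (rule continuous_map_compose_apply[OF bundle_map_continuous[OF f(2)[OF V(1)]] cont_b[OF V(1)]])
      then have "continuous_map (subtopology (btot x) ?S) (btot y) \<phi>"
        by (rule continuous_map_cong_topspace) (use \<phi>[OF V(1)] in auto)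
      ultimately show "\<exists>U. openin (btot x) U \<and> p \<in> U \<and> continuous_map (subtopology (btot x) U) (btot y) \<phi>"
        using p V(2) by blast
    qed
    show "continuous_map (bbase x) (bbase y) (\<lambda>n\<in>topspace N. n)" "(\<lambda>n\<in>topspace N. n) \<in> extensional (topspace (bbase x))"
      using bx by' by (simp_all add: continuous_map_id[unfolded id_def])
    fix p assume p: "p \<in> pts x"
    let ?V = "ch (bproj x p)"
    note V = ch(1)[OF pN[OF p]] and pV = ch(2)[OF pN[OF p]]
    note bp = b[OF V p pV]
    show "bproj y (\<phi> p) = (\<lambda>n\<in>topspace N. n) (bproj x p) \<and> banch y (\<phi> p) = banch x p"
      using \<phi>[OF V p pV] bundle_map_bproj[OF f(2)[OF V] bp(1)] bundle_map_banch[OF f(2)[OF V] bp(1)] bp pN[OF p] pV by simp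
    fix \<gamma> assume g: "\<gamma> \<in> arr" "banch x p = tgt \<gamma>"
    have "b ?V (bact x p \<gamma>) = bact (D ?V) (b ?V p) \<gamma>"
      using fibre_inverse_bact[OF i(2)[OF V], of "bproj x p" p \<gamma>] p g pV px i(3)[OF V] pN[OF p]
      unfolding b_def by simp
    then show "\<phi> (bact x p \<gamma>) = bact y (\<phi> p) \<gamma>"
      using \<phi>[OF V p pV] \<phi>[OF V, of "bact x p \<gamma>"] bundle_map_bact[OF f(2)[OF V] bp(1) g(1)] bp p g px pV by simp
  qed
  have pp: "bproj x (im V d) = bproj (D V) d" "bproj (D V) d \<in> V" if "V \<in> \<U>" "d \<in> pts (D V)" for V d
    using bundle_map_bproj[OF i(2)[OF that(1)] that(2)] bproj_in[OF bundle_map_principal_dom[OF i(2)[OF that(1)]] that(2)]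
      i(3)[OF that(1)] open_coverD[OF cov that(1)] by auto
  show "\<exists>!\<phi>. \<phi> \<in> hom_set B x y \<and> base_ar B \<phi> = Idt Top N \<and> (\<forall>V\<in>\<U>. Cmp B \<phi> (i V) = f V)"
  proof (rule ex1I[of _ "(x, y, restrict \<phi> (pts x), \<lambda>n\<in>topspace N. n)"])
    have "compose (pts (D V)) (restrict \<phi> (pts x)) (im V) = fm V" if V: "V \<in> \<U>" for V
    proof
      fix d show "compose (pts (D V)) (restrict \<phi> (pts x)) (im V) d = fm V d"
      proof (cases "d \<in> pts (D V)")
        case True
        have "b V (im V d) = d" by (rule b_eq[OF V True refl]) (use pp[OF V True] in simp)
        then show ?thesis
          using True \<phi>[OF V bundle_map_in[OF i(2)[OF V] True]] pp[OF V True] bundle_map_in[OF i(2)[OF V] True]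
          by (simp add: compose_def)
      next
        case False
        then show ?thesis using bundle_map_extensional[OF f(2)[OF V]] by (simp add: compose_def extensional_def)
      qed
    qed
    moreover have "compose (topspace (bbase (D V))) (\<lambda>n\<in>topspace N. n) (\<lambda>n\<in>V. n) = (\<lambda>n\<in>V. n)" if V: "V \<in> \<U>" for V
      using open_coverD[OF cov V] i(3)[OF V] by (auto simp: compose_def fun_eq_iff)
    ultimately show "(x, y, restrict \<phi> (pts x), \<lambda>n\<in>topspace N. n) \<in> hom_set B x y \<and>
       base_ar B (x, y, restrict \<phi> (pts x), \<lambda>n\<in>topspace N. n) = Idt Top N \<and>
       (\<forall>V\<in>\<U>. Cmp B (x, y, restrict \<phi> (pts x), \<lambda>n\<in>topspace N. n) (i V) = f V)"
      using \<phi>_map bx by' i(1) f(1) by (auto simp: classifying_stack_hom)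
  next
    \<comment> \<open>Each point p of x is the image of \<open>b V p\<close> under
      \<open>im V\<close>, so the prescribed composites determine k.\<close>
    fix k assume k: "k \<in> hom_set B x y \<and> base_ar B k = Idt Top N \<and> (\<forall>V\<in>\<U>. Cmp B k (i V) = f V)"
    then obtain \<psi> where \<psi>: "k = (x, y, \<psi>, \<lambda>n\<in>topspace N. n)" "(x, y, \<psi>, \<lambda>n\<in>topspace N. n) \<in> bundle_maps G"
      by (auto simp: classifying_stack_hom)
    have "\<psi> p = restrict \<phi> (pts x) p" for p
    proof (cases "p \<in> pts x")
      case True
      note V = ch(1)[OF pN[OF True]] and pV = ch(2)[OF pN[OF True]]
      have "Cmp B k (i (ch (bproj x p))) = f (ch (bproj x p))" using k V by blast
      then have "compose (topspace (btot (D (ch (bproj x p))))) \<psi> (im (ch (bproj x p))) = fm (ch (bproj x p))"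
        using \<psi> i(1)[OF V] f(1)[OF V] by simp
      from fun_cong[OF this, of "b (ch (bproj x p)) p"] show ?thesis
        using b[OF V True pV] True by (simp add: compose_def \<phi>_def)
    next
      case False
      then show ?thesis using bundle_map_extensional[OF \<psi>(2)] by (simp add: extensional_def)
    qed
    then show "k = (x, y, restrict \<phi> (pts x), \<lambda>n\<in>topspace N. n)" using \<psi> by auto
  qed
qed

end


section \<open>Gluing of bundles\<close>

text \<open>A point of the glued bundle is a pair of a point \<^term>\<open>n\<close> of the base and
  a point over \<^term>\<open>n\<close> of one chosen member of the cover, so that the glued bundle fits into \<^typ>\<open>'u\<close>
  however large the cover is.\<close>

locale bundle_gluing = topgpd_infinite G for G :: "'u tgpd" +
  fixes N :: "'u topology" and \<U> :: "'u set set" and x :: "'u set \<Rightarrow> 'u pbundle"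
    and t :: "'u set \<Rightarrow> 'u set \<Rightarrow> 'u \<Rightarrow> 'u"
  assumes cover: "open_cover N \<U>"
    and local_bundle: "V \<in> \<U> \<Longrightarrow> principal_bundle G (x V)"
    and local_base: "V \<in> \<U> \<Longrightarrow> bbase (x V) = subtopology N V"
    and trans_in: "V \<in> \<U> \<Longrightarrow> W \<in> \<U> \<Longrightarrow> e \<in> pts (x V) \<Longrightarrow> bproj (x V) e \<in> W \<Longrightarrow> t V W e \<in> pts (x W)"
    and trans_proj: "V \<in> \<U> \<Longrightarrow> W \<in> \<U> \<Longrightarrow> e \<in> pts (x V) \<Longrightarrow> bproj (x V) e \<in> W \<Longrightarrow> bproj (x W) (t V W e) = bproj (x V) e"
    and trans_anch: "V \<in> \<U> \<Longrightarrow> W \<in> \<U> \<Longrightarrow> e \<in> pts (x V) \<Longrightarrow> bproj (x V) e \<in> W \<Longrightarrow> banch (x W) (t V W e) = banch (x V) e"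
    and trans_act: "V \<in> \<U> \<Longrightarrow> W \<in> \<U> \<Longrightarrow> e \<in> pts (x V) \<Longrightarrow> bproj (x V) e \<in> W \<Longrightarrow> \<gamma> \<in> arr \<Longrightarrow> banch (x V) e = tgt \<gamma> \<Longrightarrow>
        t V W (bact (x V) e \<gamma>) = bact (x W) (t V W e) \<gamma>"
    and trans_continuous: "V \<in> \<U> \<Longrightarrow> W \<in> \<U> \<Longrightarrow>
        continuous_map (subtopology (btot (x V)) {e \<in> pts (x V). bproj (x V) e \<in> W}) (btot (x W)) (t V W)"
    and trans_cocycle: "V \<in> \<U> \<Longrightarrow> W \<in> \<U> \<Longrightarrow> T \<in> \<U> \<Longrightarrow> e \<in> pts (x V) \<Longrightarrow> bproj (x V) e \<in> W \<Longrightarrow> bproj (x V) e \<in> T \<Longrightarrow>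
        t W T (t V W e) = t V T e"
begin

definition ch where "ch n = (SOME V. V \<in> \<U> \<and> n \<in> V)"

definition glue where "glue V e = pair_code (bproj (x V) e, t V (ch (bproj (x V) e)) e)"

text \<open>The sum runs over the whole cover and not only over chosen members, so each
  \<open>glue V\<close> is continuous by construction although \<open>ch\<close> is an arbitrary
  choice.\<close>

definition tot where "tot = quotient_topology (sum_topology (\<lambda>V. btot (x V)) \<U>) (\<lambda>(V, e). glue V e)"

definition pr where "pr c = fst (assoc_rep c)"

text \<open>The chart inverse to \<open>glue V\<close> over V: it goes back from the chosen member
  recorded in the code to V.\<close>

definition unglue where "unglue V c = t (ch (pr c)) V (snd (assoc_rep c))"

definition glued where
  "glued = \<lparr>btot = tot, bbase = N, bproj = pr,
     banch = (\<lambda>c. banch (x (ch (pr c))) (snd (assoc_rep c))),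
     bact = (\<lambda>c \<gamma>. pair_code (pr c, bact (x (ch (pr c))) (snd (assoc_rep c)) \<gamma>))\<rparr>"

lemma ch: "n \<in> topspace N \<Longrightarrow> ch n \<in> \<U>" "n \<in> topspace N \<Longrightarrow> n \<in> ch n"
  unfolding ch_def using open_cover_point[OF cover] by auto

lemma local_proj: "V \<in> \<U> \<Longrightarrow> e \<in> pts (x V) \<Longrightarrow> bproj (x V) e \<in> V \<and> bproj (x V) e \<in> topspace N"
  using bproj_in[OF local_bundle] local_base open_coverD[OF cover] by fastforce

lemma pr_glue [simp]: "pr (glue V e) = bproj (x V) e"
  by (simp add: pr_def glue_def)

lemma snd_glue: "snd (assoc_rep (glue V e)) = t V (ch (bproj (x V) e)) e"
  by (simp add: glue_def)

lemma topspace_tot: "topspace tot = (\<Union>V\<in>\<U>. glue V ` pts (x V))"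
  by (force simp: tot_def)

lemma tot_cases:
  assumes "c \<in> topspace tot" obtains V e where "V \<in> \<U>" "e \<in> pts (x V)" "c = glue V e"
  using assms unfolding topspace_tot by blast

lemma glue_in: "V \<in> \<U> \<Longrightarrow> e \<in> pts (x V) \<Longrightarrow> glue V e \<in> topspace tot"
  unfolding topspace_tot by blast

lemma pr_in: "c \<in> topspace tot \<Longrightarrow> pr c \<in> topspace N"
  by (erule tot_cases) (simp add: local_proj)

lemma unglue_glue:
  assumes "V \<in> \<U>" "W \<in> \<U>" "e \<in> pts (x W)" "bproj (x W) e \<in> V"
  shows "unglue V (glue W e) = t W V e"
  unfolding unglue_def snd_glue pr_glue
  by (rule trans_cocycle) (use assms ch local_proj[of W e] in auto)

lemma glue_trans:
  assumes "V \<in> \<U>" "W \<in> \<U>" "e \<in> pts (x V)" "bproj (x V) e \<in> W"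
  shows "glue W (t V W e) = glue V e"
  unfolding glue_def using trans_proj[OF assms] trans_cocycle[OF assms(1,2) _ assms(3,4)] ch local_proj[OF assms(1,3)]
  by auto

lemma
  assumes c: "c \<in> topspace tot" and V: "V \<in> \<U>" "pr c \<in> V"
  shows unglue_in: "unglue V c \<in> pts (x V)" and glue_unglue: "glue V (unglue V c) = c"
    and bproj_unglue: "bproj (x V) (unglue V c) = pr c"
proof -
  obtain W e where W: "W \<in> \<U>" "e \<in> pts (x W)" "c = glue W e" using tot_cases[OF c] .
  have p: "bproj (x W) e \<in> V" using V(2) W(3) by simp
  show "unglue V c \<in> pts (x V)" "glue V (unglue V c) = c" "bproj (x V) (unglue V c) = pr c"
    using unglue_glue[OF V(1) W(1,2) p] trans_in[OF W(1) V(1) W(2) p] glue_trans[OF W(1) V(1) W(2) p]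
      trans_proj[OF W(1) V(1) W(2) p] W(3) by simp_all
qed

lemma glued_simps [simp]: "btot glued = tot" "bbase glued = N" "bproj glued = pr"
  by (simp_all add: glued_def)

lemma banch_glue:
  assumes "V \<in> \<U>" "e \<in> pts (x V)"
  shows "banch glued (glue V e) = banch (x V) e"
proof -
  have "banch (x (ch (bproj (x V) e))) (t V (ch (bproj (x V) e)) e) = banch (x V) e"
    by (rule trans_anch) (use assms ch local_proj[OF assms] in auto)
  then show ?thesis by (simp add: glued_def snd_glue)
qed

lemma bact_glue:
  assumes "V \<in> \<U>" "e \<in> pts (x V)" "\<gamma> \<in> arr" "banch (x V) e = tgt \<gamma>"
  shows "bact glued (glue V e) \<gamma> = glue V (bact (x V) e \<gamma>)"
proof -
  have "t V (ch (bproj (x V) e)) (bact (x V) e \<gamma>) = bact (x (ch (bproj (x V) e))) (t V (ch (bproj (x V) e)) e) \<gamma>"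
    by (rule trans_act) (use assms ch local_proj[OF assms(1,2)] in auto)
  then show ?thesis using assms local_bundle by (simp add: glued_def snd_glue glue_def pr_def)
qed

section \<open>Topology of the glued total space\<close>

lemma openin_tot:
  "openin tot S \<longleftrightarrow> S \<subseteq> topspace tot \<and> (\<forall>V\<in>\<U>. openin (btot (x V)) {e \<in> pts (x V). glue V e \<in> S})"
proof -
  have "{e. (V, e) \<in> {p \<in> topspace (sum_topology (\<lambda>V. btot (x V)) \<U>). (case p of (V, e) \<Rightarrow> glue V e) \<in> S}} =
     {e \<in> pts (x V). glue V e \<in> S}" if "V \<in> \<U>" for V
    using that by auto
  then show ?thesis
    unfolding tot_def openin_quotient_topology topspace_quotient_topology openin_sum_topology by auto
qed

text \<open>The part of each local total space lying over S is open because S is open. Hence a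
  preimage open in that part is open in the whole local total space, which is how openness in
  \<open>tot\<close> is tested.\<close>

lemma continuous_from_tot:
  assumes S: "openin tot S"
    and f: "\<And>V. V \<in> \<U> \<Longrightarrow> continuous_map (subtopology (btot (x V)) {e \<in> pts (x V). glue V e \<in> S}) Y (\<lambda>e. f (glue V e))"
  shows "continuous_map (subtopology tot S) Y f"
  unfolding continuous_map_def
proof (intro conjI allI impI)
  show "f \<in> topspace (subtopology tot S) \<rightarrow> topspace Y"
  proof
    fix c assume c: "c \<in> topspace (subtopology tot S)"
    then have "c \<in> topspace tot" by simp
    then obtain V e where V: "V \<in> \<U>" "e \<in> pts (x V)" "c = glue V e" by (rule tot_cases)
    show "f c \<in> topspace Y" using continuous_map_topspace[OF f[OF V(1)], of e] V c by simp
  qed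
  fix U assume U: "openin Y U"
  have sub: "S \<subseteq> topspace tot" using S by (rule openin_subset)
  have "openin tot {c \<in> S. f c \<in> U}"
    unfolding openin_tot
  proof (intro conjI ballI)
    fix V assume V: "V \<in> \<U>"
    have "openin (btot (x V)) {e \<in> pts (x V). glue V e \<in> S}" using S V unfolding openin_tot by blast
    from openin_trans_full[OF openin_continuous_map_preimage[OF f[OF V] U] this]
    show "openin (btot (x V)) {e \<in> pts (x V). glue V e \<in> {c \<in> S. f c \<in> U}}"
      by (rule back_subst[of "openin (btot (x V))"]) auto
  qed (use sub in auto)
  moreover have "{c \<in> topspace (subtopology tot S). f c \<in> U} = {c \<in> S. f c \<in> U}" using sub by auto
  ultimately show "openin (subtopology tot S) {c \<in> topspace (subtopology tot S). f c \<in> U}"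
    using openin_open_subtopology[OF S] by auto
qed

lemma continuous_from_tot':
  assumes "\<And>V. V \<in> \<U> \<Longrightarrow> continuous_map (btot (x V)) Y (\<lambda>e. f (glue V e))"
  shows "continuous_map tot Y f"
  using continuous_from_tot[of "topspace tot" Y f] assms by (simp add: continuous_map_from_subtopology)

lemma continuous_glue: "V \<in> \<U> \<Longrightarrow> continuous_map (btot (x V)) tot (glue V)"
  unfolding continuous_map_def openin_tot by (auto intro: glue_in)

lemma continuous_pr: "continuous_map tot N pr"
proof (rule continuous_from_tot')
  fix V assume "V \<in> \<U>"
  from continuous_bproj[OF local_bundle[OF this]] show "continuous_map (btot (x V)) N (\<lambda>e. pr (glue V e))"
    by (simp add: local_base[OF \<open>V \<in> \<U>\<close>] continuous_map_in_subtopology)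
qed

lemma openin_over: "V \<in> \<U> \<Longrightarrow> openin tot {c \<in> topspace tot. pr c \<in> V}"
  by (rule openin_continuous_map_preimage[OF continuous_pr]) (rule open_coverD[OF cover])

text \<open>Read in the chart of W, this map is the transition map \<open>t W V\<close>; the choice
  \<open>ch\<close> drops out by the cocycle condition.\<close>

lemma continuous_unglue:
  assumes V: "V \<in> \<U>"
  shows "continuous_map (subtopology tot {c \<in> topspace tot. pr c \<in> V}) (btot (x V)) (unglue V)"
proof (rule continuous_from_tot[OF openin_over[OF V]])
  fix W assume W: "W \<in> \<U>"
  have "{e \<in> pts (x W). glue W e \<in> {c \<in> topspace tot. pr c \<in> V}} = {e \<in> pts (x W). bproj (x W) e \<in> V}"
    using glue_in[OF W] by auto
  then show "continuous_map (subtopology (btot (x W)) {e \<in> pts (x W). glue W e \<in> {c \<in> topspace tot. pr c \<in> V}})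
     (btot (x V)) (\<lambda>e. unglue V (glue W e))"
    using continuous_map_cong_topspace[OF trans_continuous[OF W V], of "\<lambda>e. unglue V (glue W e)"] unglue_glue[OF V W] by simp
qed

definition dv where
  "dv c c' = division G (x (ch (pr c))) (snd (assoc_rep c)) (snd (assoc_rep c'))"

text \<open>Transition maps are equivariant, so they preserve the arrow carrying e to e', and any
  member of the cover may be used to compute it.\<close>

lemma dv_glue:
  assumes V: "V \<in> \<U>" and e: "e \<in> pts (x V)" "e' \<in> pts (x V)" "bproj (x V) e = bproj (x V) e'"
  shows "dv (glue V e) (glue V e') = division G (x V) e e'"
proof -
  let ?W = "ch (bproj (x V) e)"
  note P = local_bundle[OF V]
  have W: "?W \<in> \<U>" "bproj (x V) e \<in> ?W" using ch local_proj[OF V e(1)] by auto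
  have te: "t V ?W e \<in> pts (x ?W)" "banch (x ?W) (t V ?W e) = banch (x V) e"
    using trans_in[OF V W(1) e(1) W(2)] trans_anch[OF V W(1) e(1) W(2)] by auto
  have "t V ?W e' = bact (x ?W) (t V ?W e) (division G (x V) e e')"
    using trans_act[OF V W(1) e(1) W(2), of "division G (x V) e e'"] P e by simp
  then have "division G (x ?W) (t V ?W e) (t V ?W e') = division G (x V) e e'"
    by (intro division_eqI[OF local_bundle[OF W(1)]]) (use te P e in auto)
  then show ?thesis using e(3) by (simp add: dv_def snd_glue)
qed

lemma tot_cases2:
  assumes "c \<in> topspace tot" "c' \<in> topspace tot" "pr c = pr c'"
  obtains V e e' where "V \<in> \<U>" "e \<in> pts (x V)" "c = glue V e"
    "e' \<in> pts (x V)" "c' = glue V e'" "bproj (x V) e = bproj (x V) e'"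
proof -
  let ?V = "ch (pr c)"
  have V: "?V \<in> \<U>" "pr c \<in> ?V" using ch pr_in[OF assms(1)] by auto
  show thesis
    by (rule that[OF V(1), of "unglue ?V c" "unglue ?V c'"])
       (use V assms unglue_in glue_unglue bproj_unglue in auto)
qed

text \<open>The identities are checked in a chart containing the points involved. For continuity, an
  operation near a given point is conjugated by \<open>glue\<close> and \<open>unglue\<close> for
  one fixed member of the cover, where it becomes the operation of a principal bundle.\<close>

lemma principal_glued: "principal_bundle G glued"
proof (rule principal_bundleI[where d = dv]; (simp only: glued_simps)?)
  show "continuous_map tot N pr" by (rule continuous_pr)
  show "admits_local_sections tot N pr"
  proof (rule admits_local_sectionsI)
    fix n assume "n \<in> topspace N"
    note V = ch[OF this]
    let ?V = "ch n"
    have "n \<in> topspace (bbase (x ?V))" using V open_coverD[OF cover V(1)] local_base by simp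
    then obtain U \<sigma> where U: "openin (bbase (x ?V)) U" "n \<in> U" "continuous_map (subtopology (bbase (x ?V)) U) (btot (x ?V)) \<sigma>"
      "\<And>z. z \<in> U \<Longrightarrow> bproj (x ?V) (\<sigma> z) = z" by (rule principal_section[OF local_bundle[OF V(1)]]) blast
    have oU: "openin (subtopology N ?V) U" using U(1) local_base[OF V(1)] by simp
    have "openin N U" using openin_trans_full[OF oU open_coverD(1)[OF cover V(1)]] .
    moreover have "U \<subseteq> ?V" using openin_subset[OF oU] by auto
    then have "subtopology (bbase (x ?V)) U = subtopology N U"
      using local_base[OF V(1)] by (simp add: subtopology_subtopology inf_absorb2)
    then have "continuous_map (subtopology N U) tot (\<lambda>z. glue ?V (\<sigma> z))"
      using continuous_map_compose_apply[OF continuous_glue[OF V(1)] U(3)] by simp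
    ultimately show "\<exists>U \<sigma>. openin N U \<and> n \<in> U \<and> continuous_map (subtopology N U) tot \<sigma> \<and> (\<forall>z\<in>U. pr (\<sigma> z) = z)"
      using U(2,4) by (intro exI[of _ U] exI[of _ "\<lambda>z. glue ?V (\<sigma> z)"]) simp
  qed
  show "continuous_map tot (gobj G) (banch glued)"
  proof (rule continuous_from_tot')
    fix V assume V: "V \<in> \<U>"
    show "continuous_map (btot (x V)) (gobj G) (\<lambda>e. banch glued (glue V e))"
      by (rule continuous_map_cong_topspace[OF continuous_banch[OF local_bundle[OF V]]]) (simp add: banch_glue[OF V])
  qed
  let ?A = "fibprod tot (garr G) (banch glued) tgt"
  show "continuous_map ?A tot (\<lambda>z. bact glued (fst z) (snd z))"
  proof (rule continuous_map_locally)
    fix z assume z: "z \<in> topspace ?A"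
    let ?V = "ch (pr (fst z))" let ?S = "{z \<in> topspace ?A. pr (fst z) \<in> ?V}"
    have V: "?V \<in> \<U>" "pr (fst z) \<in> ?V" using ch pr_in z by auto
    have o: "openin ?A ?S"
      by (rule openin_continuous_map_preimage[OF continuous_map_compose_apply[OF continuous_pr continuous_map_fibprod_fst]])
         (rule open_coverD[OF cover V(1)])
    have unglue_anch: "banch (x ?V) (unglue ?V c) = banch glued c" if "c \<in> topspace tot" "pr c \<in> ?V" for c
      using banch_glue[OF V(1) unglue_in[OF that(1) V(1) that(2)]] glue_unglue[OF that(1) V(1) that(2)] by simp
    have "continuous_map (subtopology ?A ?S) tot (\<lambda>z. glue ?V (bact (x ?V) (unglue ?V (fst z)) (snd z)))"
      by (intro continuous_map_compose_apply[OF continuous_glue[OF V(1)]] continuous_bact[OF local_bundle[OF V(1)]]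
            continuous_map_compose_subtopology[OF continuous_unglue[OF V(1)]] continuous_map_from_subtopology
            continuous_map_fibprod_fst continuous_map_fibprod_snd) (use unglue_anch in auto)
    then have "continuous_map (subtopology ?A ?S) tot (\<lambda>z. bact glued (fst z) (snd z))"
    proof (rule continuous_map_cong_topspace)
      fix w assume "w \<in> topspace (subtopology ?A ?S)"
      then have w: "fst w \<in> topspace tot" "snd w \<in> arr" "banch glued (fst w) = tgt (snd w)" "pr (fst w) \<in> ?V" by auto
      show "glue ?V (bact (x ?V) (unglue ?V (fst w)) (snd w)) = bact glued (fst w) (snd w)"
        using bact_glue[OF V(1) unglue_in[OF w(1) V(1) w(4)] w(2)] glue_unglue[OF w(1) V(1) w(4)] unglue_anch[OF w(1,4)] w(3) by simp
    qed
    then show "\<exists>U. openin ?A U \<and> z \<in> U \<and> continuous_map (subtopology ?A U) tot (\<lambda>z. bact glued (fst z) (snd z))"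
      using o z V(2) by blast
  qed
  let ?D = "fibprod tot tot pr pr"
  show "continuous_map ?D (garr G) (\<lambda>z. dv (fst z) (snd z))"
  proof (rule continuous_map_locally)
    fix z assume z: "z \<in> topspace ?D"
    let ?V = "ch (pr (fst z))" let ?S = "{z \<in> topspace ?D. pr (fst z) \<in> ?V}"
    have V: "?V \<in> \<U>" "pr (fst z) \<in> ?V" using ch pr_in z by auto
    have o: "openin ?D ?S"
      by (rule openin_continuous_map_preimage[OF continuous_map_compose_apply[OF continuous_pr continuous_map_fibprod_fst]])
         (rule open_coverD[OF cover V(1)])
    have "continuous_map (subtopology ?D ?S) (garr G) (\<lambda>z. division G (x ?V) (unglue ?V (fst z)) (unglue ?V (snd z)))"
      by (intro continuous_division[OF local_bundle[OF V(1)]] continuous_map_compose_subtopology[OF continuous_unglue[OF V(1)]]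
            continuous_map_from_subtopology continuous_map_fibprod_fst continuous_map_fibprod_snd)
         (use bproj_unglue[OF _ V(1)] in auto)
    then have "continuous_map (subtopology ?D ?S) (garr G) (\<lambda>z. dv (fst z) (snd z))"
    proof (rule continuous_map_cong_topspace)
      fix w assume "w \<in> topspace (subtopology ?D ?S)"
      then have w: "fst w \<in> topspace tot" "snd w \<in> topspace tot" "pr (fst w) \<in> ?V" "pr (snd w) \<in> ?V" "pr (fst w) = pr (snd w)" by auto
      show "division G (x ?V) (unglue ?V (fst w)) (unglue ?V (snd w)) = dv (fst w) (snd w)"
        using dv_glue[OF V(1) unglue_in[OF w(1) V(1) w(3)] unglue_in[OF w(2) V(1) w(4)]]
          glue_unglue[OF w(1) V(1) w(3)] glue_unglue[OF w(2) V(1) w(4)]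
          bproj_unglue[OF w(1) V(1) w(3)] bproj_unglue[OF w(2) V(1) w(4)] w(5) by simp
    qed
    then show "\<exists>U. openin ?D U \<and> z \<in> U \<and> continuous_map (subtopology ?D U) (garr G) (\<lambda>z. dv (fst z) (snd z))"
      using o z V(2) by blast
  qed
next
  fix c assume "c \<in> topspace tot"
  then obtain V e where V: "V \<in> \<U>" "e \<in> pts (x V)" "c = glue V e" by (rule tot_cases)
  note P = local_bundle[OF V(1)]
  show "bact glued c (unt (banch glued c)) = c"
    using bact_glue[OF V(1,2)] banch_glue[OF V(1,2)] V P by simp
  fix \<gamma> assume g: "\<gamma> \<in> arr" "banch glued c = tgt \<gamma>"
  have g': "banch (x V) e = tgt \<gamma>" using g banch_glue[OF V(1,2)] V by simp
  have e': "bact (x V) e \<gamma> \<in> pts (x V)" using V g g' P by simp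
  have c': "bact glued c \<gamma> = glue V (bact (x V) e \<gamma>)" using bact_glue[OF V(1,2) g(1) g'] V by simp
  show "banch glued (bact glued c \<gamma>) = src \<gamma> \<and> pr (bact glued c \<gamma>) = pr c"
    using c' banch_glue[OF V(1) e'] V g g' P by simp
  show "dv c (bact glued c \<gamma>) = \<gamma>"
    using c' dv_glue[OF V(1,2) e'] V g g' P by (simp add: division_eqI)
  fix \<delta> assume d: "\<delta> \<in> arr" "src \<gamma> = tgt \<delta>"
  show "bact glued (bact glued c \<gamma>) \<delta> = bact glued c (cmp \<gamma> \<delta>)"
    using c' bact_glue[OF V(1) e' d(1)] bact_glue[OF V(1,2), of "cmp \<gamma> \<delta>"] V g g' d P by (simp add: bact_bact)
next
  fix c c' assume c: "c \<in> topspace tot" "c' \<in> topspace tot" "pr c = pr c'"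
  obtain V e e' where V: "V \<in> \<U>" "e \<in> pts (x V)" "c = glue V e"
    "e' \<in> pts (x V)" "c' = glue V e'" "bproj (x V) e = bproj (x V) e'"
    using tot_cases2[OF c] .
  note P = local_bundle[OF V(1)]
  show "tgt (dv c c') = banch glued c \<and> bact glued c (dv c c') = c'"
    using dv_glue[OF V(1,2,4,6)] banch_glue[OF V(1,2)] bact_glue[OF V(1,2), of "dv c c'"] V P by simp
qed

lemma bundle_map_glue:
  assumes V: "V \<in> \<U>"
  shows "(x V, glued, restrict (glue V) (pts (x V)), \<lambda>n\<in>V. n) \<in> bundle_maps G"
  by (rule bundle_mapsI[OF local_bundle[OF V] principal_glued])
     (use V open_coverD[OF cover V] local_base[OF V] in
      \<open>auto simp: continuous_glue local_proj banch_glue bact_glue intro: continuous_map_from_subtopology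
         continuous_map_cong_topspace[OF continuous_map_from_subtopology[OF continuous_map_id]]\<close>)

end

context topgpd_infinite
begin

text \<open>Abstract descent data are converted into transition functions between total spaces, to
  which the clutching construction of \<open>bundle_gluing\<close> applies.\<close>

lemma objects_glue_classifying_stack: "objects_glue B"
  unfolding objects_glue_def
proof (intro allI impI, elim conjE)
  fix N \<U> x p q
  assume cov: "open_cover N \<U>"
    and x: "\<forall>V\<in>\<U>. x V \<in> Ob B \<and> base_ob B (x V) = subtopology N V"
    and pq: "\<forall>V\<in>\<U>. \<forall>W\<in>\<U>.
           p V W \<in> Ar B \<and> q V W \<in> Ar B \<and> Dom B (p V W) = Dom B (q V W) \<and>
           Cod B (p V W) = x V \<and> Cod B (q V W) = x W \<and>
           base_ar B (p V W) = incl (subtopology N (V \<inter> W)) (subtopology N V) \<and>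
           base_ar B (q V W) = incl (subtopology N (V \<inter> W)) (subtopology N W)"
    and coc: "\<forall>V\<in>\<U>. \<forall>W\<in>\<U>. \<forall>T\<in>\<U>. \<forall>w\<in>Ob B. \<forall>a b c.
           base_ob B w = subtopology N (V \<inter> W \<inter> T) \<and>
           a \<in> hom_set B w (Dom B (p V W)) \<and>
           b \<in> hom_set B w (Dom B (p W T)) \<and>
           c \<in> hom_set B w (Dom B (p V T)) \<and>
           base_ar B a = incl (subtopology N (V \<inter> W \<inter> T)) (subtopology N (V \<inter> W)) \<and>
           base_ar B b = incl (subtopology N (V \<inter> W \<inter> T)) (subtopology N (W \<inter> T)) \<and>
           base_ar B c = incl (subtopology N (V \<inter> W \<inter> T)) (subtopology N (V \<inter> T)) \<and>
           Cmp B (p V W) a = Cmp B (p V T) c \<and>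
           Cmp B (q V W) a = Cmp B (p W T) b \<longrightarrow>
           Cmp B (q W T) b = Cmp B (q V T) c"
  define D where "D V W = Dom B (p V W)" for V W
  define pm where "pm V W = fst (snd (snd (p V W)))" for V W
  define qm where "qm V W = fst (snd (snd (q V W)))" for V W
  have xV: "principal_bundle G (x V)" "bbase (x V) = subtopology N V" if "V \<in> \<U>" for V
    using x that by auto
  have pq': "p V W = (D V W, x V, pm V W, \<lambda>n\<in>V \<inter> W. n)" "(D V W, x V, pm V W, \<lambda>n\<in>V \<inter> W. n) \<in> bundle_maps G"
      "q V W = (D V W, x W, qm V W, \<lambda>n\<in>V \<inter> W. n)" "(D V W, x W, qm V W, \<lambda>n\<in>V \<inter> W. n) \<in> bundle_maps G"
      "bbase (D V W) = subtopology N (V \<inter> W)" "topspace (subtopology N (V \<inter> W)) = V \<inter> W"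
    if V: "V \<in> \<U>" and W: "W \<in> \<U>" for V W
  proof -
    note pqVW = bspec[OF bspec[OF pq V] W]
    have t: "topspace N \<inter> (V \<inter> W) = V \<inter> W" using open_coverD[OF cov V] by auto
    then show "topspace (subtopology N (V \<inter> W)) = V \<inter> W" by simp
    obtain d \<phi> g where p: "p V W = (d, x V, \<phi>, g)" using pqVW by (cases "p V W") auto
    have pb: "(bbase d, bbase (x V), g) = incl (subtopology N (V \<inter> W)) (subtopology N V)"
      using pqVW unfolding p by auto
    obtain \<psi> g' where q: "q V W = (d, x W, \<psi>, g')" using pqVW p by (cases "q V W") auto
    have qb: "(bbase d, bbase (x W), g') = incl (subtopology N (V \<inter> W)) (subtopology N W)"
      using pqVW unfolding q by auto
    have g: "g = (\<lambda>n\<in>V \<inter> W. n)" "bbase d = subtopology N (V \<inter> W)" "g' = (\<lambda>n\<in>V \<inter> W. n)"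
      using pb qb t by (simp_all add: incl_def)
    have d: "D V W = d" using p by (simp add: D_def)
    show "p V W = (D V W, x V, pm V W, \<lambda>n\<in>V \<inter> W. n)" "q V W = (D V W, x W, qm V W, \<lambda>n\<in>V \<inter> W. n)"
      "bbase (D V W) = subtopology N (V \<inter> W)"
      using p q g d by (simp_all add: pm_def qm_def)
    then show "(D V W, x V, pm V W, \<lambda>n\<in>V \<inter> W. n) \<in> bundle_maps G" "(D V W, x W, qm V W, \<lambda>n\<in>V \<inter> W. n) \<in> bundle_maps G"
      using pqVW by simp_all
  qed
  define b where "b V W e = fibre_inverse (D V W) (pm V W) (bproj (x V) e) e" for V W e
  \<comment> \<open>The transition function inverts the restriction \<open>p V W\<close> and then
    applies \<open>q V W\<close>.\<close>
  define t where "t V W e = qm V W (b V W e)" for V W e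
  have pe: "bproj (x V) e \<in> V" if "V \<in> \<U>" "e \<in> pts (x V)" for V e
    using bproj_in[OF xV(1)[OF that(1)] that(2)] xV(2)[OF that(1)] by simp
  have b: "b V W e \<in> pts (D V W)" "bproj (D V W) (b V W e) = bproj (x V) e" "pm V W (b V W e) = e"
      "banch (D V W) (b V W e) = banch (x V) e"
    if "V \<in> \<U>" "W \<in> \<U>" "e \<in> pts (x V)" "bproj (x V) e \<in> W" for V W e
    unfolding b_def
    using fibre_inverse_in[OF pq'(2), of V W "bproj (x V) e" e] bproj_fibre_inverse[OF pq'(2), of V W "bproj (x V) e" e]
      bundle_map_fibre_inverse[OF pq'(2), of V W "bproj (x V) e" e] banch_fibre_inverse[OF pq'(2), of V W "bproj (x V) e" e]
      that pq'(5,6)[OF that(1,2)] pe[OF that(1,3)] by auto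
  have b_eq: "b V W (pm V W d) = d" if "V \<in> \<U>" "W \<in> \<U>" "d \<in> pts (D V W)" "bproj (D V W) d = bproj (x V) (pm V W d)" for V W d
    unfolding b_def by (rule fibre_inverse_eqI[OF pq'(2)]) (use that in auto)
  have Dproj: "bproj (D V W) d \<in> V \<inter> W" if "V \<in> \<U>" "W \<in> \<U>" "d \<in> pts (D V W)" for V W d
    using bproj_in[OF bundle_map_principal_dom[OF pq'(2)] that(3)] that pq'(5,6) by metis
  have cocycle: "t W T (t V W e) = t V T e"
    if V: "V \<in> \<U>" and W: "W \<in> \<U>" and T: "T \<in> \<U>" and e: "e \<in> pts (x V)" "bproj (x V) e \<in> W" "bproj (x V) e \<in> T" for V W T e
  proof -
    let ?S = "V \<inter> W \<inter> T"
    have tS: "topspace N \<inter> ?S = ?S" using open_coverD[OF cov V] by auto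
    have ph: "p V W \<in> hom_set B (D V W) (x V)" "q V W \<in> hom_set B (D V W) (x W)"
       "base_ar B (p V W) = incl (subtopology N (V \<inter> W)) (subtopology N V)"
       "base_ar B (q V W) = incl (subtopology N (V \<inter> W)) (subtopology N W)" if "V \<in> \<U>" "W \<in> \<U>" for V W
      using pq that by (auto simp: hom_set_def D_def)
    \<comment> \<open>The cocycle premise concerns three arrows out of one object over the triple
      overlap. The object w is a restriction of \<open>D V W\<close>; the arrows c and b' exist
      because \<open>p V T\<close> and \<open>p W T\<close> are cartesian. The premise is then
      evaluated at the point of w above \<open>b V W e\<close>.\<close>
    obtain a w where a: "a \<in> hom_set B w (D V W)" "base_ar B a = incl (subtopology N ?S) (subtopology N (V \<inter> W))"
      "base_ob B w = subtopology N ?S"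
    proof (rule B.pullback[of "D V W" "incl (subtopology N ?S) (subtopology N (V \<inter> W))" "subtopology N ?S"])
      show "D V W \<in> Ob B" using bundle_map_principal_dom[OF pq'(2)[OF V W]] by simp
      show "incl (subtopology N ?S) (subtopology N (V \<inter> W)) \<in> hom_set Top (subtopology N ?S) (base_ob B (D V W))"
        using incl_hom[of ?S "V \<inter> W" N] pq'(5)[OF V W] by auto
    qed auto
    have pa: "Cmp B (p V W) a \<in> hom_set B w (x V)" "Cmp B (q V W) a \<in> hom_set B w (x W)"
      using ph[OF V W] a(1) by blast+
    have bpa: "base_ar B (Cmp B (p V W) a) = incl (subtopology N ?S) (subtopology N V)"
       "base_ar B (Cmp B (q V W) a) = incl (subtopology N ?S) (subtopology N W)"
      using B.base_cmp[OF ph(1)[OF V W] a(1)] B.base_cmp[OF ph(2)[OF V W] a(1)] ph(3,4)[OF V W] a(2)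
        Cmp_incl[of ?S "V \<inter> W" N] by auto
    obtain c where c: "c \<in> hom_set B w (D V T)" "base_ar B c = incl (subtopology N ?S) (subtopology N (V \<inter> T))"
      "Cmp B (p V T) c = Cmp B (p V W) a"
    proof (rule B.cartesian[OF ph(1)[OF V T] pa(1), of "incl (subtopology N ?S) (subtopology N (V \<inter> T))"])
      show "incl (subtopology N ?S) (subtopology N (V \<inter> T)) \<in> hom_set Top (base_ob B w) (base_ob B (D V T))"
        using incl_hom[of ?S "V \<inter> T" N] pq'(5)[OF V T] a(3) by auto
      show "Cmp Top (base_ar B (p V T)) (incl (subtopology N ?S) (subtopology N (V \<inter> T))) = base_ar B (Cmp B (p V W) a)"
        using bpa(1) ph(3)[OF V T] Cmp_incl[of ?S "V \<inter> T" N] by auto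
    qed auto
    obtain b' where b': "b' \<in> hom_set B w (D W T)" "base_ar B b' = incl (subtopology N ?S) (subtopology N (W \<inter> T))"
      "Cmp B (p W T) b' = Cmp B (q V W) a"
    proof (rule B.cartesian[OF ph(1)[OF W T] pa(2), of "incl (subtopology N ?S) (subtopology N (W \<inter> T))"])
      show "incl (subtopology N ?S) (subtopology N (W \<inter> T)) \<in> hom_set Top (base_ob B w) (base_ob B (D W T))"
        using incl_hom[of ?S "W \<inter> T" N] pq'(5)[OF W T] a(3) by auto
      show "Cmp Top (base_ar B (p W T)) (incl (subtopology N ?S) (subtopology N (W \<inter> T))) = base_ar B (Cmp B (q V W) a)"
        using bpa(2) ph(3)[OF W T] Cmp_incl[of ?S "W \<inter> T" N] by auto
    qed auto
    have w: "w \<in> Ob B" using B.hom_ob[OF a(1)] by blast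
    have qq: "Cmp B (q W T) b' = Cmp B (q V T) c"
      using coc[rule_format, OF V W T w, of a b' c] a b' c by (simp add: D_def)
    obtain \<alpha> ga where \<alpha>: "a = (w, D V W, \<alpha>, ga)" "(w, D V W, \<alpha>, ga) \<in> bundle_maps G" using a(1) by (auto simp: classifying_stack_hom)
    obtain \<beta> gb where \<beta>: "b' = (w, D W T, \<beta>, gb)" "(w, D W T, \<beta>, gb) \<in> bundle_maps G" using b'(1) by (auto simp: classifying_stack_hom)
    obtain \<zeta> gc where \<zeta>: "c = (w, D V T, \<zeta>, gc)" "(w, D V T, \<zeta>, gc) \<in> bundle_maps G" using c(1) by (auto simp: classifying_stack_hom)
    have ga: "ga = (\<lambda>n\<in>?S. n)" "gb = (\<lambda>n\<in>?S. n)" "gc = (\<lambda>n\<in>?S. n)" "bbase w = subtopology N ?S"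
      using \<alpha> \<beta> \<zeta> a(2,3) b'(2) c(2) tS by (simp_all add: incl_def)
    have n: "bproj (x V) e \<in> ?S" using pe[OF V e(1)] e by simp
    have nw: "bproj (x V) e \<in> topspace (bbase w)" using n tS ga(4) by auto
    note be = b[OF V W e(1,2)]
    have "bproj (D V W) (b V W e) = ga (bproj (x V) e)" using be(2) ga(1) n by simp
    note fi = \<alpha>(2) nw be(1) this
    let ?d = "fibre_inverse w \<alpha> (bproj (x V) e) (b V W e)"
    note d = fibre_inverse_in[OF fi] bproj_fibre_inverse[OF fi] bundle_map_fibre_inverse[OF fi]
    have c1: "pm V T (\<zeta> ?d) = pm V W (\<alpha> ?d)"
      using c(3) pq'(1)[OF V T] pq'(1)[OF V W] \<alpha>(1) \<zeta>(1) d(1) by (auto simp: compose_def fun_eq_iff split: if_splits)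
    have c2: "pm W T (\<beta> ?d) = qm V W (\<alpha> ?d)"
      using b'(3) pq'(1)[OF W T] pq'(3)[OF V W] \<alpha>(1) \<beta>(1) d(1) by (auto simp: compose_def fun_eq_iff split: if_splits)
    have c3: "qm W T (\<beta> ?d) = qm V T (\<zeta> ?d)"
      using qq pq'(3)[OF W T] pq'(3)[OF V T] \<zeta>(1) \<beta>(1) d(1) by (auto simp: compose_def fun_eq_iff split: if_splits)
    have tv: "t V W e = pm W T (\<beta> ?d)" using c2 d(3) by (simp add: t_def)
    have bd: "\<beta> ?d \<in> pts (D W T)" "bproj (D W T) (\<beta> ?d) = bproj (x V) e"
      using bundle_map_in[OF \<beta>(2) d(1)] bundle_map_bproj[OF \<beta>(2) d(1)] d(2) ga n by auto
    have zd: "\<zeta> ?d \<in> pts (D V T)" "bproj (D V T) (\<zeta> ?d) = bproj (x V) e"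
      using bundle_map_in[OF \<zeta>(2) d(1)] bundle_map_bproj[OF \<zeta>(2) d(1)] d(2) ga n by auto
    have "b W T (pm W T (\<beta> ?d)) = \<beta> ?d"
      by (rule b_eq[OF W T bd(1)]) (use bundle_map_bproj[OF pq'(2)[OF W T] bd(1)] bd(2) n in simp)
    moreover have "b V T e = \<zeta> ?d"
      using b_eq[OF V T zd(1)] bundle_map_bproj[OF pq'(2)[OF V T] zd(1)] zd(2) n c1 d(3) be(3) by simp
    ultimately show ?thesis using c3 tv by (simp add: t_def)
  qed
  interpret gl: bundle_gluing G N \<U> x t
  proof (unfold_locales, fact cov, fact xV(1), fact xV(2))
    fix V W e assume V: "V \<in> \<U>" and W: "W \<in> \<U>" and e: "e \<in> pts (x V)" "bproj (x V) e \<in> W"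
    note be = b[OF V W e]
    note q = pq'(4)[OF V W]
    show "t V W e \<in> pts (x W)" "bproj (x W) (t V W e) = bproj (x V) e" "banch (x W) (t V W e) = banch (x V) e"
      using bundle_map_in[OF q be(1)] bundle_map_bproj[OF q be(1)] bundle_map_banch[OF q be(1)] be pe[OF V e(1)] e
      by (auto simp: t_def)
    fix \<gamma> assume g: "\<gamma> \<in> arr" "banch (x V) e = tgt \<gamma>"
    have "b V W (bact (x V) e \<gamma>) = bact (D V W) (b V W e) \<gamma>"
      using fibre_inverse_bact[OF pq'(2)[OF V W], of "bproj (x V) e" e \<gamma>] e g xV[OF V] pq'(5,6)[OF V W] pe[OF V e(1)]
        subsetD[OF open_coverD(2)[OF cov V] pe[OF V e(1)]]
      unfolding b_def by simp
    then show "t V W (bact (x V) e \<gamma>) = bact (x W) (t V W e) \<gamma>"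
      using bundle_map_bact[OF q be(1) g(1)] be(4) g by (simp add: t_def)
  next
    fix V W assume V: "V \<in> \<U>" and W: "W \<in> \<U>"
    have "continuous_map (subtopology (btot (x V)) {e \<in> pts (x V). bproj (x V) e \<in> W}) (btot (D V W)) (b V W)"
      unfolding b_def
    proof (rule continuous_fibre_inverse[OF pq'(2)[OF V W]])
      show "continuous_map (subtopology (btot (x V)) {e \<in> pts (x V). bproj (x V) e \<in> W}) (bbase (D V W)) (bproj (x V))"
        using continuous_bproj[OF xV(1)[OF V]] pe[OF V] xV(2)[OF V]
        by (auto simp: pq'(5)[OF V W] continuous_map_in_subtopology continuous_map_from_subtopology)
    qed (use pe[OF V] in \<open>auto simp: continuous_map_from_subtopology\<close>)
    from continuous_map_compose_apply[OF bundle_map_continuous[OF pq'(4)[OF V W]] this]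
    show "continuous_map (subtopology (btot (x V)) {e \<in> pts (x V). bproj (x V) e \<in> W}) (btot (x W)) (t V W)"
      by (simp add: t_def[abs_def])
  qed (rule cocycle)
  let ?i = "\<lambda>V. (x V, gl.glued, restrict (gl.glue V) (pts (x V)), \<lambda>n\<in>V. n)"
  show "\<exists>z i. z \<in> Ob B \<and> base_ob B z = N \<and>
           (\<forall>V\<in>\<U>. i V \<in> hom_set B (x V) z \<and> base_ar B (i V) = incl (subtopology N V) N) \<and>
           (\<forall>V\<in>\<U>. \<forall>W\<in>\<U>. Cmp B (i V) (p V W) = Cmp B (i W) (q V W))"
  proof (intro exI[of _ gl.glued] exI[of _ ?i] conjI ballI)
    fix V assume V: "V \<in> \<U>"
    show "?i V \<in> hom_set B (x V) gl.glued" using gl.bundle_map_glue[OF V] by (simp add: classifying_stack_hom)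
    show "base_ar B (?i V) = incl (subtopology N V) N"
      using xV(2)[OF V] open_coverD[OF cov V] by (simp add: incl_def)
    fix W assume W: "W \<in> \<U>"
    have "restrict (gl.glue V) (pts (x V)) (pm V W d) = restrict (gl.glue W) (pts (x W)) (qm V W d)"
      if d: "d \<in> pts (D V W)" for d
    proof -
      have pd: "pm V W d \<in> pts (x V)" "bproj (x V) (pm V W d) = bproj (D V W) d"
        and qd: "qm V W d \<in> pts (x W)"
        using bundle_map_in[OF pq'(2)[OF V W] d] bundle_map_in[OF pq'(4)[OF V W] d]
          bundle_map_bproj[OF pq'(2)[OF V W] d] Dproj[OF V W d] by auto
      \<comment> \<open>The two legs of the descent datum differ by the transition map, which
        \<open>glue\<close> absorbs.\<close>
      have "t V W (pm V W d) = qm V W d" using b_eq[OF V W d] pd by (simp add: t_def)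
      then show ?thesis using gl.glue_trans[OF V W pd(1)] pd qd Dproj[OF V W d] by simp
    qed
    then show "Cmp B (?i V) (p V W) = Cmp B (?i W) (q V W)"
      using pq'(1,3,5,6)[OF V W] by (auto simp: compose_def fun_eq_iff)
  qed (use gl.principal_glued in auto)
qed

section \<open>Classifying stacks are topological stacks\<close>

theorem stack_classifying_stack: "stack B"
  unfolding stack_def
  using fibred_classifying_stack morphisms_glue_classifying_stack objects_glue_classifying_stack by blast

theorem topological_stack_classifying_stack: "topological_stack B"
proof -
  have id: "stack_morphism B B id_func"
    unfolding stack_morphism_def is_functor_def by (auto simp: id_func_def hom_set_def)
  have "two_morphism B B (comp_func id_func id_func) id_func (Idt B)"
    unfolding two_morphism_def
  proof (intro conjI ballI)
    fix P assume P: "P \<in> Ob B"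
    show "Idt B P \<in> hom_set B (on_ob (comp_func id_func id_func) P) (on_ob id_func P)"
      using B.idt[OF P] by (simp add: id_func_def comp_func_def)
    show "base_ar B (Idt B P) = Idt Top (base_ob B P)" by (rule B.base_idt[OF P])
  next
    fix m assume "m \<in> Ar B"
    then have "m \<in> hom_set B (Dom B m) (Cod B m)" by (simp add: hom_set_def)
    then show "Cmp B (on_ar id_func m) (Idt B (Dom B m)) = Cmp B (Idt B (Cod B m)) (on_ar (comp_func id_func id_func) m)"
      using B.idt_right B.idt_left by (simp add: id_func_def comp_func_def)
  qed
  then show ?thesis
    unfolding topological_stack_def isomorphic_stacks_def using stack_classifying_stack topological_groupoid id by blast
qed

end


section \<open>The associated bundle\<close>

context topgpd
begin

lemma division_self [simp]: "principal_bundle G P \<Longrightarrow> p \<in> pts P \<Longrightarrow> division G P p p = unt (banch P p)"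
  by (rule division_eqI) auto

lemma division_cmp:
  assumes "principal_bundle G P" "p \<in> pts P" "q \<in> pts P" "r \<in> pts P"
    "bproj P p = bproj P q" "bproj P q = bproj P r"
  shows "cmp (division G P p q) (division G P q r) = division G P p r"
  by (rule division_eqI[symmetric]) (use assms in \<open>auto simp flip: bact_bact\<close>)

text \<open>By equivariance the arrow from p to q also carries \<open>\<phi> p\<close> to
  \<open>\<phi> q\<close>.\<close>

lemma division_bundle_map:
  assumes m: "(P, Q, \<phi>, f) \<in> bundle_maps G" and p: "p \<in> pts P" "q \<in> pts P" "bproj P p = bproj P q"
  shows "division G Q (\<phi> p) (\<phi> q) = division G P p q"
proof (rule division_eqI[OF bundle_map_principal_cod[OF m]])
  show "bact Q (\<phi> p) (division G P p q) = \<phi> q"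
    using bundle_map_bact[OF m p(1), of "division G P p q"] bundle_map_principal_dom[OF m] p by simp
qed (use bundle_map_in[OF m] bundle_map_banch[OF m] bundle_map_principal_dom[OF m] p in auto)

end

locale gpd_extension = G: topgpd_infinite G + H: topgpd_infinite H for G H :: "'u tgpd" +
  fixes F :: "'u \<Rightarrow> 'u"
  assumes extension: "groupoid_extension G H F"
begin

lemma gobj_eq [simp]: "gobj H = gobj G"
  and continuous_F: "continuous_map (garr G) (garr H) F"
  and F_local_sections: "admits_local_sections (garr G) (garr H) F"
  using extension unfolding groupoid_extension_def by auto

lemma F_in [simp]: "g \<in> G.arr \<Longrightarrow> F g \<in> H.arr"
  by (rule continuous_map_topspace[OF continuous_F])

lemma src_F [simp]: "g \<in> G.arr \<Longrightarrow> H.src (F g) = G.src g"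
  and tgt_F [simp]: "g \<in> G.arr \<Longrightarrow> H.tgt (F g) = G.tgt g"
  and F_unt [simp]: "x \<in> G.obj \<Longrightarrow> F (G.unt x) = H.unt x"
  and F_cmp [simp]: "g \<in> G.arr \<Longrightarrow> h \<in> G.arr \<Longrightarrow> G.src g = G.tgt h \<Longrightarrow> F (G.cmp g h) = H.cmp (F g) (F h)"
  using extension unfolding groupoid_extension_def by blast+

lemma H_src_in [simp]: "h \<in> H.arr \<Longrightarrow> H.src h \<in> G.obj" and H_tgt_in [simp]: "h \<in> H.arr \<Longrightarrow> H.tgt h \<in> G.obj"
  using H.src_in H.tgt_in by simp_all

section \<open>Orbits and their names\<close>

abbreviation cls where "cls \<equiv> assoc_class G H F"
abbreviation E where "E Q \<equiv> fibprod (btot Q) (garr H) (banch Q) (gtgt H)"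
abbreviation A where "A \<equiv> assoc_bundle G H F"

text \<open>The orbit relation without its existential quantifier: principality of Q leaves the
  translation from the first component of z to that of w as the only possible \<gamma>. The
  condition on the second components is then solved for the one of z.\<close>

definition rel where
  "rel Q z w \<longleftrightarrow> bproj Q (fst z) = bproj Q (fst w) \<and> snd z = H.cmp (F (division G Q (fst z) (fst w))) (snd w)"

lemma assoc_orbit_eq:
  assumes Q: "principal_bundle G Q" and z: "z \<in> topspace (E Q)"
  shows "assoc_orbit G H F Q z = {w \<in> topspace (E Q). rel Q z w}"
proof -
  obtain x h where z': "z = (x, h)" by (cases z)
  have x: "x \<in> pts Q" "h \<in> H.arr" "banch Q x = H.tgt h" using z z' by auto
  show ?thesis
  proof (intro set_eqI iffI)
    fix w assume "w \<in> assoc_orbit G H F Q z"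
    then obtain \<gamma> where g: "\<gamma> \<in> G.arr" "G.tgt \<gamma> = banch Q x" "w = (bact Q x \<gamma>, H.cmp (H.inw (F \<gamma>)) h)"
      unfolding assoc_orbit_def z' by auto
    then have "division G Q x (bact Q x \<gamma>) = \<gamma>" using Q x by (simp add: G.division_eqI)
    then show "w \<in> {w \<in> topspace (E Q). rel Q z w}"
      using g Q x unfolding z' rel_def by simp
  next
    fix w assume "w \<in> {w \<in> topspace (E Q). rel Q z w}"
    then obtain x' h' where w: "w = (x', h')" "x' \<in> pts Q" "h' \<in> H.arr" "banch Q x' = H.tgt h'"
      "bproj Q x = bproj Q x'" "h = H.cmp (F (division G Q x x')) h'"
      by (cases w) (auto simp: rel_def z')
    then have "w = (bact Q x (division G Q x x'), H.cmp (H.inw (F (division G Q x x'))) h)"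
      using Q x by simp
    then show "w \<in> assoc_orbit G H F Q z"
      unfolding assoc_orbit_def z' using w(2,5) Q x(1)
      by (auto intro!: exI[of _ "division G Q x x'"])
  qed
qed

lemma rel_refl:
  assumes "principal_bundle G Q" "z \<in> topspace (E Q)" shows "rel Q z z"
  using assms by (cases z) (auto simp: rel_def)

lemma F_division_cmp:
  assumes "principal_bundle G Q" "x \<in> pts Q" "y \<in> pts Q" "z \<in> pts Q"
    "bproj Q x = bproj Q y" "bproj Q y = bproj Q z"
  shows "H.cmp (F (division G Q x y)) (F (division G Q y z)) = F (division G Q x z)"
proof -
  have "H.cmp (F (division G Q x y)) (F (division G Q y z)) = F (G.cmp (division G Q x y) (division G Q y z))"
    by (rule F_cmp[symmetric]) (use assms in simp_all)
  then show ?thesis by (simp only: G.division_cmp[OF assms])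
qed

lemma rel_trans:
  assumes Q: "principal_bundle G Q" and in_E: "z \<in> topspace (E Q)" "w \<in> topspace (E Q)" "v \<in> topspace (E Q)"
    and r: "rel Q z w" "rel Q w v"
  shows "rel Q z v"
proof -
  obtain x h x' h' x'' h'' where e: "z = (x, h)" "w = (x', h')" "v = (x'', h'')" by (cases z; cases w; cases v)
  have x: "x \<in> pts Q" "x' \<in> pts Q" "x'' \<in> pts Q" "h'' \<in> H.arr" "banch Q x'' = H.tgt h''"
    using in_E e by auto
  have p: "bproj Q x = bproj Q x'" "bproj Q x' = bproj Q x''" using r e by (auto simp: rel_def)
  have "h = H.cmp (F (division G Q x x')) (H.cmp (F (division G Q x' x'')) h'')"
    using r unfolding e rel_def by simp
  also have "\<dots> = H.cmp (H.cmp (F (division G Q x x')) (F (division G Q x' x''))) h''"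
    by (rule H.cmp_assoc[symmetric]) (use x p Q in simp_all)
  also have "\<dots> = H.cmp (F (division G Q x x'')) h''" by (simp only: F_division_cmp[OF Q x(1-3) p])
  finally show ?thesis using p e by (simp add: rel_def)
qed

lemma rel_sym:
  assumes Q: "principal_bundle G Q" and in_E: "z \<in> topspace (E Q)" "w \<in> topspace (E Q)" and r: "rel Q z w"
  shows "rel Q w z"
proof -
  obtain x h x' h' where e: "z = (x, h)" "w = (x', h')" by (cases z; cases w)
  have x: "x \<in> pts Q" "x' \<in> pts Q" "h' \<in> H.arr" "banch Q x' = H.tgt h'"
    using in_E e by auto
  have p: "bproj Q x = bproj Q x'" using r e by (auto simp: rel_def)
  have "H.cmp (F (division G Q x' x)) (H.cmp (F (division G Q x x')) h') =
      H.cmp (H.cmp (F (division G Q x' x)) (F (division G Q x x'))) h'"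
    by (rule H.cmp_assoc[symmetric]) (use x p Q in simp_all)
  also have "\<dots> = h'"
    using F_division_cmp[OF Q x(2,1,2) p[symmetric] p] x Q by simp
  finally show ?thesis using r e by (simp add: rel_def)
qed

lemma cls_choice:
  assumes "principal_bundle G Q" "z \<in> topspace (E Q)"
  obtains w where "w \<in> topspace (E Q)" "rel Q z w" "cls Q z = pair_code w"
proof -
  define w where "w = (SOME w. w \<in> assoc_orbit G H F Q z)"
  have "z \<in> assoc_orbit G H F Q z"
    unfolding assoc_orbit_eq[OF assms] using assms(2) rel_refl[OF assms] by blast
  then have "w \<in> assoc_orbit G H F Q z"
    unfolding w_def by (rule someI)
  then have "w \<in> topspace (E Q)" "rel Q z w"
    unfolding assoc_orbit_eq[OF assms] by blast+
  then show thesis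
    by (rule that) (simp add: assoc_class_def w_def)
qed

text \<open>The name depends only on the orbit as a set, so related pairs receive the same choice.
  Conversely a common name decodes to a pair lying in both orbits.\<close>

lemma cls_eq_iff:
  assumes Q: "principal_bundle G Q" and z: "z \<in> topspace (E Q)" "w \<in> topspace (E Q)"
  shows "cls Q z = cls Q w \<longleftrightarrow> rel Q z w"
proof
  assume eq: "cls Q z = cls Q w"
  obtain a where a: "a \<in> topspace (E Q)" "rel Q z a" "cls Q z = pair_code a" by (rule cls_choice[OF Q z(1)])
  obtain b where b: "b \<in> topspace (E Q)" "rel Q w b" "cls Q w = pair_code b" by (rule cls_choice[OF Q z(2)])
  have "a = b" using eq a(3) b(3) G.assoc_rep_pair_code' by metis
  then show "rel Q z w" using rel_trans[OF Q z(1) a(1) z(2) a(2)] rel_sym[OF Q z(2) b(1,2)] by simp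
next
  assume r: "rel Q z w"
  have "assoc_orbit G H F Q z = assoc_orbit G H F Q w"
    unfolding assoc_orbit_eq[OF Q z(1)] assoc_orbit_eq[OF Q z(2)]
    using rel_trans[OF Q z _ r] rel_trans[OF Q z(2,1) _ rel_sym[OF Q z r]] by blast
  then show "cls Q z = cls Q w" by (simp add: assoc_class_def)
qed

text \<open>The rule \<open>[x \<gamma>, k] = [x, F(\<gamma>) k]\<close>, which moves arrows of G
  across the bracket; later computations with classes rest on it.\<close>

lemma cls_bact:
  assumes "principal_bundle G Q" "x \<in> pts Q" "\<gamma> \<in> G.arr" "banch Q x = G.tgt \<gamma>" "k \<in> H.arr" "G.src \<gamma> = H.tgt k"
  shows "cls Q (bact Q x \<gamma>, k) = cls Q (x, H.cmp (F \<gamma>) k)"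
proof -
  have "division G Q x (bact Q x \<gamma>) = \<gamma>" using assms by (simp add: G.division_eqI)
  then have "cls Q (x, H.cmp (F \<gamma>) k) = cls Q (bact Q x \<gamma>, k)"
    by (subst cls_eq_iff) (use assms in \<open>simp_all add: rel_def\<close>)
  then show ?thesis by simp
qed

section \<open>The orbit space as a bundle\<close>

lemma assoc_bundle_simps [simp]:
  "btot (A Q) = quotient_topology (E Q) (cls Q)" "bbase (A Q) = bbase Q"
  by (simp_all add: assoc_bundle_def)

lemma tot_cases:
  assumes "c \<in> pts (A Q)"
  obtains x h where "x \<in> pts Q" "h \<in> H.arr" "banch Q x = H.tgt h" "c = cls Q (x, h)"
  using assms by auto

lemma cls_in: "x \<in> pts Q \<Longrightarrow> h \<in> H.arr \<Longrightarrow> banch Q x = H.tgt h \<Longrightarrow> cls Q (x, h) \<in> pts (A Q)"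
  by simp

lemma cls_rep:
  assumes "principal_bundle G Q" "z \<in> topspace (E Q)"
  shows "assoc_rep (cls Q z) \<in> topspace (E Q)" "rel Q z (assoc_rep (cls Q z))"
  by (rule cls_choice[OF assms]; simp del: topspace_fibprod)+

text \<open>The structure maps of \<open>A Q\<close> are defined through the decoded representative,
  which is some pair related to (x, h). Related pairs have the same base point and the same source,
  and composing on the right respects the relation, so any representative may be used.\<close>

lemma
  assumes Q: "principal_bundle G Q" and x: "x \<in> pts Q" "h \<in> H.arr" "banch Q x = H.tgt h"
  shows bproj_assoc: "bproj (A Q) (cls Q (x, h)) = bproj Q x"
    and banch_assoc: "banch (A Q) (cls Q (x, h)) = H.src h"
    and bact_assoc: "k \<in> H.arr \<Longrightarrow> H.src h = H.tgt k \<Longrightarrow> bact (A Q) (cls Q (x, h)) k = cls Q (x, H.cmp h k)"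
proof -
  have z: "(x, h) \<in> topspace (E Q)" using x by simp
  obtain x' h' where r: "assoc_rep (cls Q (x, h)) = (x', h')" by (cases "assoc_rep (cls Q (x, h))")
  have x': "x' \<in> pts Q" "h' \<in> H.arr" "banch Q x' = H.tgt h'" "bproj Q x = bproj Q x'"
    "h = H.cmp (F (division G Q x x')) h'"
    using cls_rep[OF Q z] unfolding r by (auto simp: rel_def)
  show "bproj (A Q) (cls Q (x, h)) = bproj Q x" "banch (A Q) (cls Q (x, h)) = H.src h"
  proof -
    have "H.src h = H.src h'" unfolding x'(5) using x'(1-4) Q x(1) by simp
    then show "bproj (A Q) (cls Q (x, h)) = bproj Q x" "banch (A Q) (cls Q (x, h)) = H.src h"
      using x'(4) by (simp_all add: assoc_bundle_def r)
  qed
  assume k: "k \<in> H.arr" "H.src h = H.tgt k"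
  have "cls Q (x, H.cmp h k) = cls Q (x', H.cmp h' k)"
    by (subst cls_eq_iff[OF Q]) (use x(1) x' k Q in \<open>simp_all add: rel_def H.cmp_assoc\<close>)
  then show "bact (A Q) (cls Q (x, h)) k = cls Q (x, H.cmp h k)"
    by (simp add: assoc_bundle_def r)
qed

lemma continuous_cls:
  assumes "continuous_map Z (btot Q) a" "continuous_map Z (garr H) b" "\<And>z. z \<in> topspace Z \<Longrightarrow> banch Q (a z) = H.tgt (b z)"
  shows "continuous_map Z (btot (A Q)) (\<lambda>z. cls Q (a z, b z))"
  unfolding assoc_bundle_simps
  by (rule continuous_map_compose_apply[OF continuous_map_quotient_topology])
     (rule continuous_map_into_fibprod[where f = "banch Q" and g = H.tgt, OF assms])

lemma continuous_from_assoc: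
  "continuous_map (E Q) Y (\<lambda>z. f (cls Q z)) \<Longrightarrow> continuous_map (btot (A Q)) Y f"
  unfolding assoc_bundle_simps by (rule continuous_map_from_quotient_topology)

lemma continuous_F': "continuous_map Z (garr G) a \<Longrightarrow> continuous_map Z (garr H) (\<lambda>z. F (a z))"
  by (rule continuous_map_compose_apply[OF continuous_F])

lemma continuous_bproj_assoc: "principal_bundle G Q \<Longrightarrow> continuous_map (btot (A Q)) (bbase Q) (bproj (A Q))"
  by (rule continuous_from_assoc,
      rule continuous_map_cong_topspace[OF continuous_map_compose_apply[OF G.continuous_bproj continuous_map_fibprod_fst]])
     (auto simp: bproj_assoc)

lemma continuous_banch_assoc: "principal_bundle G Q \<Longrightarrow> continuous_map (btot (A Q)) (gobj H) (banch (A Q))"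
  by (rule continuous_from_assoc,
      rule continuous_map_cong_topspace[OF continuous_map_compose_apply[OF H.continuous_src continuous_map_fibprod_snd]])
     (auto simp: banch_assoc)

lemma assoc_local_lift:
  assumes Q: "principal_bundle G Q" and c0: "c0 \<in> pts (A Q)"
  obtains S a b where "openin (btot (A Q)) S" "c0 \<in> S"
    "continuous_map (subtopology (btot (A Q)) S) (btot Q) a" "continuous_map (subtopology (btot (A Q)) S) (garr H) b"
    "\<And>c. c \<in> S \<Longrightarrow> a c \<in> pts Q \<and> b c \<in> H.arr \<and> banch Q (a c) = H.tgt (b c) \<and> cls Q (a c, b c) = c"
proof -
  let ?T = "btot (A Q)"
  let ?p = "bproj (A Q)"
  have n0: "?p c0 \<in> topspace (bbase Q)" by (rule continuous_map_topspace[OF continuous_bproj_assoc[OF Q] c0])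
  obtain U \<sigma> where U: "openin (bbase Q) U" "?p c0 \<in> U" "continuous_map (subtopology (bbase Q) U) (btot Q) \<sigma>"
    "\<And>y. y \<in> U \<Longrightarrow> bproj Q (\<sigma> y) = y" "\<And>y. y \<in> U \<Longrightarrow> \<sigma> y \<in> pts Q" using G.principal_section[OF Q n0] by metis
  define S where "S = {c \<in> topspace ?T. ?p c \<in> U}"
  define a where "a c = \<sigma> (?p c)" for c
  \<comment> \<open>If the decoded representative is (x', h'), moving its first component to
    \<sigma> multiplies h' by F of the arrow from \<sigma> to x'.\<close>
  define b where "b c = H.cmp (F (division G Q (\<sigma> (?p c)) (fst (assoc_rep c)))) (snd (assoc_rep c))" for c
  have S: "openin ?T S"
    unfolding S_def by (rule openin_continuous_map_preimage[OF continuous_bproj_assoc[OF Q] U(1)])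
  have b_cls: "b (cls Q (x, h)) = H.cmp (F (division G Q (\<sigma> (bproj Q x)) x)) h"
    if x: "x \<in> pts Q" "h \<in> H.arr" "banch Q x = H.tgt h" "bproj Q x \<in> U" for x h
  proof -
    have z: "(x, h) \<in> topspace (E Q)" using x by simp
    obtain x' h' where r: "assoc_rep (cls Q (x, h)) = (x', h')" by (cases "assoc_rep (cls Q (x, h))")
    have x': "x' \<in> pts Q" "h' \<in> H.arr" "banch Q x' = H.tgt h'" "bproj Q x = bproj Q x'"
      "h = H.cmp (F (division G Q x x')) h'"
      using cls_rep[OF Q z] unfolding r by (auto simp: rel_def)
    have s: "\<sigma> (bproj Q x) \<in> pts Q" "bproj Q (\<sigma> (bproj Q x)) = bproj Q x" using U x by auto
    have "rel Q (\<sigma> (bproj Q x), H.cmp (F (division G Q (\<sigma> (bproj Q x)) x')) h') (x', h')"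
      using s x' by (simp add: rel_def)
    moreover have "rel Q (x', h') (x, h)"
      by (rule rel_sym[OF Q z]) (use x' in \<open>simp_all add: rel_def\<close>)
    ultimately have "rel Q (\<sigma> (bproj Q x), H.cmp (F (division G Q (\<sigma> (bproj Q x)) x')) h') (x, h)"
      by (rule rel_trans[OF Q, rotated 3]) (use s x x' Q in simp_all)
    then show ?thesis using bproj_assoc[OF Q x(1-3)] by (simp add: b_def r rel_def)
  qed
  show thesis
  proof (rule that[OF S])
    show "c0 \<in> S" using c0 U by (simp add: S_def del: assoc_bundle_simps)
    show "continuous_map (subtopology ?T S) (btot Q) a"
      unfolding a_def
      by (rule continuous_map_compose_subtopology[OF U(3) continuous_map_from_subtopology[OF continuous_bproj_assoc[OF Q]]])
         (simp add: S_def)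
    \<comment> \<open>Continuity of b is tested upstairs on the preimage of S, where
      \<open>b_cls\<close> replaces the decoded representative by the given pair.\<close>
    let ?E = "subtopology (E Q) {z \<in> topspace (E Q). cls Q z \<in> S}"
    have inU: "fst z \<in> pts Q \<and> snd z \<in> H.arr \<and> banch Q (fst z) = H.tgt (snd z) \<and> bproj Q (fst z) \<in> U"
      if "z \<in> topspace ?E" for z
      using that bproj_assoc[OF Q, of "fst z" "snd z"] by (auto simp: S_def simp del: assoc_bundle_simps)
    have f1: "continuous_map ?E (btot Q) fst" and f2: "continuous_map ?E (garr H) snd"
      by (intro continuous_map_from_subtopology continuous_map_fibprod_fst continuous_map_fibprod_snd)+
    have "continuous_map ?E (btot Q) (\<lambda>z. \<sigma> (bproj Q (fst z)))"
      by (rule continuous_map_compose_subtopology[OF U(3) continuous_map_compose_apply[OF G.continuous_bproj[OF Q] f1]])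
         (use inU in blast)
    then have "continuous_map ?E (garr H) (\<lambda>z. H.cmp (F (division G Q (\<sigma> (bproj Q (fst z))) (fst z))) (snd z))"
      by (intro H.continuous_cmp continuous_F' G.continuous_division[OF Q] f1 f2) (use inU U Q in auto)
    then have "continuous_map ?E (garr H) (\<lambda>z. b (cls Q z))"
      by (rule continuous_map_cong_topspace) (use inU b_cls in force)
    then show "continuous_map (subtopology ?T S) (garr H) b"
      using continuous_map_from_open_quotient_topology[of "E Q" "cls Q" S "garr H" b] S by simp
  next
    fix c assume "c \<in> S"
    then obtain x h where x: "x \<in> pts Q" "h \<in> H.arr" "banch Q x = H.tgt h" "c = cls Q (x, h)" "bproj (A Q) c \<in> U"
      unfolding S_def by (blast elim: tot_cases)
    have p: "bproj (A Q) c = bproj Q x" using bproj_assoc[OF Q x(1-3)] x(4) by simp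
    have s: "\<sigma> (bproj Q x) \<in> pts Q" "bproj Q (\<sigma> (bproj Q x)) = bproj Q x" using U x p by auto
    have bc: "b c = H.cmp (F (division G Q (\<sigma> (bproj Q x)) x)) h" using b_cls[OF x(1-3)] x p by simp
    show "a c \<in> pts Q \<and> b c \<in> H.arr \<and> banch Q (a c) = H.tgt (b c) \<and> cls Q (a c, b c) = c"
      unfolding bc a_def p x(4)[symmetric]
    proof (intro conjI)
      show "cls Q (\<sigma> (bproj Q x), H.cmp (F (division G Q (\<sigma> (bproj Q x)) x)) h) = c"
        unfolding x(4) by (subst cls_eq_iff[OF Q]) (use s x Q in \<open>simp_all add: rel_def\<close>)
    qed (use s x Q in simp_all)
  qed
qed

text \<open>Since \<open>[x', h'] = [x, F(\<gamma>) h']\<close> for the arrow \<gamma> from x to x',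
  the unique arrow of H taking \<open>[x, h]\<close> to \<open>[x', h']\<close> is the composite of
  the inverse of h with \<open>F(\<gamma>) h'\<close>. The continuous lifts of
  \<open>assoc_local_lift\<close> make this formula, and the action, continuous.\<close>

lemma principal_assoc_bundle:
  assumes Q: "principal_bundle G Q"
  shows "principal_bundle H (A Q)"
proof -
  let ?T = "btot (A Q)"
  have dv: "division H (A Q) (cls Q (x, h)) (cls Q (x', h')) = H.cmp (H.inw h) (H.cmp (F (division G Q x x')) h')"
    and av: "bact (A Q) (cls Q (x, h)) (H.cmp (H.inw h) (H.cmp (F (division G Q x x')) h')) = cls Q (x', h')"
    if x: "x \<in> pts Q" "h \<in> H.arr" "banch Q x = H.tgt h"
      and x': "x' \<in> pts Q" "h' \<in> H.arr" "banch Q x' = H.tgt h'" and p: "bproj Q x = bproj Q x'" for x h x' h'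
  proof -
    let ?k = "H.cmp (H.inw h) (H.cmp (F (division G Q x x')) h')"
    have k: "?k \<in> H.arr" "H.src h = H.tgt ?k" using x x' p Q by simp_all
    show av: "bact (A Q) (cls Q (x, h)) ?k = cls Q (x', h')"
      unfolding bact_assoc[OF Q x k]
      by (subst cls_eq_iff[OF Q]) (use x x' p Q in \<open>simp_all add: rel_def\<close>)
    show "division H (A Q) (cls Q (x, h)) (cls Q (x', h')) = ?k"
      unfolding division_def[of H]
    proof (rule the_equality)
      show "?k \<in> H.arr \<and> banch (A Q) (cls Q (x, h)) = H.tgt ?k \<and> bact (A Q) (cls Q (x, h)) ?k = cls Q (x', h')"
        using k av banch_assoc[OF Q x] by simp
      fix l assume l: "l \<in> H.arr \<and> banch (A Q) (cls Q (x, h)) = H.tgt l \<and> bact (A Q) (cls Q (x, h)) l = cls Q (x', h')"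
      have l': "l \<in> H.arr" "H.src h = H.tgt l" using l banch_assoc[OF Q x] by auto
      have "cls Q (x, H.cmp h l) = cls Q (x, H.cmp h ?k)"
        using l av bact_assoc[OF Q x l'] bact_assoc[OF Q x k] by simp
      then have "H.cmp h l = H.cmp h ?k"
        by (subst (asm) cls_eq_iff[OF Q]) (use x k l' Q in \<open>simp_all add: rel_def\<close>)
      then show "l = ?k" by (rule H.cmp_left_cancel) (use x k l' in auto)
    qed
  qed
  show ?thesis
  proof (rule H.principal_bundleI[where d = "division H (A Q)"]; (simp only: assoc_bundle_simps(2))?)
    show "continuous_map ?T (bbase Q) (bproj (A Q))" by (rule continuous_bproj_assoc[OF Q])
    show "continuous_map ?T (gobj H) (banch (A Q))" by (rule continuous_banch_assoc[OF Q])
    show "admits_local_sections ?T (bbase Q) (bproj (A Q))"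
    proof (rule admits_local_sectionsI)
      fix n assume n: "n \<in> topspace (bbase Q)"
      obtain U \<sigma> where U: "openin (bbase Q) U" "n \<in> U" "continuous_map (subtopology (bbase Q) U) (btot Q) \<sigma>"
        "\<And>y. y \<in> U \<Longrightarrow> bproj Q (\<sigma> y) = y" "\<And>y. y \<in> U \<Longrightarrow> \<sigma> y \<in> pts Q" using G.principal_section[OF Q n] by metis
      have "continuous_map (subtopology (bbase Q) U) (gobj H) (\<lambda>z. banch Q (\<sigma> z))"
        using continuous_map_compose_apply[OF G.continuous_banch[OF Q] U(3)] by simp
      then have "continuous_map (subtopology (bbase Q) U) ?T (\<lambda>z. cls Q (\<sigma> z, H.unt (banch Q (\<sigma> z))))"
        by (intro continuous_cls U(3) continuous_map_compose_apply[OF H.continuous_unt]) (use U Q in auto)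
      then show "\<exists>U \<sigma>. openin (bbase Q) U \<and> n \<in> U \<and> continuous_map (subtopology (bbase Q) U) ?T \<sigma> \<and> (\<forall>z\<in>U. bproj (A Q) (\<sigma> z) = z)"
        using U Q bproj_assoc[OF Q] by (intro exI[of _ U] exI[of _ "\<lambda>z. cls Q (\<sigma> z, H.unt (banch Q (\<sigma> z)))"]) simp
    qed
    let ?A = "fibprod ?T (garr H) (banch (A Q)) H.tgt"
    show "continuous_map ?A ?T (\<lambda>z. bact (A Q) (fst z) (snd z))"
    proof (rule continuous_map_locally)
      fix z assume z: "z \<in> topspace ?A"
      then have "fst z \<in> topspace ?T" by auto
      then obtain S a b where S: "openin ?T S" "fst z \<in> S"
        "continuous_map (subtopology ?T S) (btot Q) a" "continuous_map (subtopology ?T S) (garr H) b"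
        and ab: "\<And>c. c \<in> S \<Longrightarrow> a c \<in> pts Q \<and> b c \<in> H.arr \<and> banch Q (a c) = H.tgt (b c) \<and> cls Q (a c, b c) = c"
        by (rule assoc_local_lift[OF Q]) blast
      let ?S = "{z \<in> topspace ?A. fst z \<in> S}"
      have o: "openin ?A ?S" by (rule openin_continuous_map_preimage[OF continuous_map_fibprod_fst S(1)])
      have anch: "banch (A Q) c = H.src (b c)" if "c \<in> S" for c
        using banch_assoc[OF Q, of "a c" "b c"] ab[OF that] by simp
      \<comment> \<open>On S a class c is \<open>[a c, b c]\<close> with a and b continuous, so
        acting by k only composes \<open>b c\<close> with k.\<close>
      have "continuous_map (subtopology ?A ?S) ?T (\<lambda>z. cls Q (a (fst z), H.cmp (b (fst z)) (snd z)))"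
        by (intro continuous_cls H.continuous_cmp continuous_map_compose_subtopology[OF S(3)] continuous_map_compose_subtopology[OF S(4)]
            continuous_map_from_subtopology continuous_map_fibprod_fst continuous_map_fibprod_snd) (use ab anch in auto)
      then have "continuous_map (subtopology ?A ?S) ?T (\<lambda>z. bact (A Q) (fst z) (snd z))"
      proof (rule continuous_map_cong_topspace)
        fix w assume "w \<in> topspace (subtopology ?A ?S)"
        then have w: "fst w \<in> S" "snd w \<in> H.arr" "banch (A Q) (fst w) = H.tgt (snd w)" by auto
        show "cls Q (a (fst w), H.cmp (b (fst w)) (snd w)) = bact (A Q) (fst w) (snd w)"
          using bact_assoc[OF Q, of "a (fst w)" "b (fst w)" "snd w"] ab[OF w(1)] anch[OF w(1)] w by simp
      qed
      then show "\<exists>U. openin ?A U \<and> z \<in> U \<and> continuous_map (subtopology ?A U) ?T (\<lambda>z. bact (A Q) (fst z) (snd z))"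
        using o z S(2) by blast
    qed
    let ?D = "fibprod ?T ?T (bproj (A Q)) (bproj (A Q))"
    show "continuous_map ?D (garr H) (\<lambda>z. division H (A Q) (fst z) (snd z))"
    proof (rule continuous_map_locally)
      fix z assume z: "z \<in> topspace ?D"
      then have z1: "fst z \<in> topspace ?T" and z2: "snd z \<in> topspace ?T" by auto
      obtain S a b where S: "openin ?T S" "fst z \<in> S"
        "continuous_map (subtopology ?T S) (btot Q) a" "continuous_map (subtopology ?T S) (garr H) b"
        and ab: "\<And>c. c \<in> S \<Longrightarrow> a c \<in> pts Q \<and> b c \<in> H.arr \<and> banch Q (a c) = H.tgt (b c) \<and> cls Q (a c, b c) = c"
        by (rule assoc_local_lift[OF Q z1]) blast
      obtain S' a' b' where S': "openin ?T S'" "snd z \<in> S'"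
        "continuous_map (subtopology ?T S') (btot Q) a'" "continuous_map (subtopology ?T S') (garr H) b'"
        and ab': "\<And>c. c \<in> S' \<Longrightarrow> a' c \<in> pts Q \<and> b' c \<in> H.arr \<and> banch Q (a' c) = H.tgt (b' c) \<and> cls Q (a' c, b' c) = c"
        by (rule assoc_local_lift[OF Q z2]) blast
      let ?S = "{z \<in> topspace ?D. fst z \<in> S} \<inter> {z \<in> topspace ?D. snd z \<in> S'}"
      have o: "openin ?D ?S"
        by (intro openin_Int openin_continuous_map_preimage[OF continuous_map_fibprod_fst S(1)]
            openin_continuous_map_preimage[OF continuous_map_fibprod_snd S'(1)])
      have pr: "bproj Q (a (fst w)) = bproj Q (a' (snd w))" if "w \<in> topspace (subtopology ?D ?S)" for w
        using that bproj_assoc[OF Q, of "a (fst w)" "b (fst w)"] bproj_assoc[OF Q, of "a' (snd w)" "b' (snd w)"] ab ab' by auto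
      have "continuous_map (subtopology ?D ?S) (garr H)
          (\<lambda>z. H.cmp (H.inw (b (fst z))) (H.cmp (F (division G Q (a (fst z)) (a' (snd z)))) (b' (snd z))))"
        by (intro H.continuous_cmp continuous_F' G.continuous_division[OF Q] continuous_map_compose_apply[OF H.continuous_inw]
            continuous_map_compose_subtopology[OF S(3)] continuous_map_compose_subtopology[OF S(4)]
            continuous_map_compose_subtopology[OF S'(3)] continuous_map_compose_subtopology[OF S'(4)]
            continuous_map_from_subtopology continuous_map_fibprod_fst continuous_map_fibprod_snd)
           (use ab ab' pr Q in auto)
      then have "continuous_map (subtopology ?D ?S) (garr H) (\<lambda>z. division H (A Q) (fst z) (snd z))"
      proof (rule continuous_map_cong_topspace)
        fix w assume w: "w \<in> topspace (subtopology ?D ?S)"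
        then have w': "fst w \<in> S" "snd w \<in> S'" by auto
        show "H.cmp (H.inw (b (fst w))) (H.cmp (F (division G Q (a (fst w)) (a' (snd w)))) (b' (snd w))) = division H (A Q) (fst w) (snd w)"
          using dv[of "a (fst w)" "b (fst w)" "a' (snd w)" "b' (snd w)"] ab[OF w'(1)] ab'[OF w'(2)] pr[OF w] by simp
      qed
      then show "\<exists>U. openin ?D U \<and> z \<in> U \<and> continuous_map (subtopology ?D U) (garr H) (\<lambda>z. division H (A Q) (fst z) (snd z))"
        using o z S(2) S'(2) by blast
    qed
  next
    fix c assume "c \<in> topspace ?T"
    then obtain x h where x: "x \<in> pts Q" "h \<in> H.arr" "banch Q x = H.tgt h" and c: "c = cls Q (x, h)"
      by (rule tot_cases)
    show "bact (A Q) c (H.unt (banch (A Q) c)) = c"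
      using bact_assoc[OF Q x, of "H.unt (H.src h)"] banch_assoc[OF Q x] c x by simp
    fix k assume k: "k \<in> H.arr" "banch (A Q) c = H.tgt k"
    have k': "H.src h = H.tgt k" using k banch_assoc[OF Q x] c by simp
    have ck: "bact (A Q) c k = cls Q (x, H.cmp h k)" using bact_assoc[OF Q x k(1) k'] c by simp
    have x': "H.cmp h k \<in> H.arr" "banch Q x = H.tgt (H.cmp h k)" using x k k' by simp_all
    show "banch (A Q) (bact (A Q) c k) = H.src k \<and> bproj (A Q) (bact (A Q) c k) = bproj (A Q) c"
      unfolding ck using banch_assoc[OF Q x(1) x'] bproj_assoc[OF Q x(1) x'] bproj_assoc[OF Q x] c x k k' by simp
    show "division H (A Q) c (bact (A Q) c k) = k"
      unfolding ck unfolding c using dv[OF x x(1) x' refl] x k k' Q by simp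
    fix l assume l: "l \<in> H.arr" "H.src k = H.tgt l"
    show "bact (A Q) (bact (A Q) c k) l = bact (A Q) c (H.cmp k l)"
      unfolding ck using bact_assoc[OF Q x(1) x' l(1)] bact_assoc[OF Q x, of "H.cmp k l"] c x k k' l by (simp add: H.cmp_assoc)
  next
    fix c c' assume c: "c \<in> topspace ?T" "c' \<in> topspace ?T" "bproj (A Q) c = bproj (A Q) c'"
    obtain x h where x: "x \<in> pts Q" "h \<in> H.arr" "banch Q x = H.tgt h" "c = cls Q (x, h)"
      using c(1) by (rule tot_cases)
    obtain x' h' where x': "x' \<in> pts Q" "h' \<in> H.arr" "banch Q x' = H.tgt h'" "c' = cls Q (x', h')"
      using c(2) by (rule tot_cases)
    have p: "bproj Q x = bproj Q x'" using c(3) bproj_assoc[OF Q x(1-3)] bproj_assoc[OF Q x'(1-3)] x(4) x'(4) by simp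
    show "H.tgt (division H (A Q) c c') = banch (A Q) c \<and> bact (A Q) c (division H (A Q) c c') = c'"
      unfolding x(4) x'(4) dv[OF x(1-3) x'(1-3) p] av[OF x(1-3) x'(1-3) p]
      using banch_assoc[OF Q x(1-3)] x(1-3) x'(1-3) p Q by simp
  qed
qed


section \<open>The associated morphism of stacks\<close>

abbreviation f_assoc where "f_assoc \<equiv> assoc_morphism G H F"

definition assoc_map where
  "assoc_map P Q \<phi> = (\<lambda>c\<in>pts (A P). case assoc_rep c of (x, h) \<Rightarrow> cls Q (\<phi> x, h))"

lemma assoc_morphism_simps [simp]:
  "on_ob f_assoc P = A P" "on_ar f_assoc (P, Q, \<phi>, f) = (A P, A Q, assoc_map P Q \<phi>, f)"
  by (simp_all add: assoc_morphism_def assoc_map_def)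

text \<open>Independence of the decoded representative: a bundle map preserves
  \<open>division\<close>, hence maps related pairs to related pairs.\<close>

lemma assoc_map_cls:
  assumes m: "(P, Q, \<phi>, f) \<in> bundle_maps G" and x: "x \<in> pts P" "h \<in> H.arr" "banch P x = H.tgt h"
  shows "assoc_map P Q \<phi> (cls P (x, h)) = cls Q (\<phi> x, h)"
proof -
  note P = G.bundle_map_principal_dom[OF m] and Q = G.bundle_map_principal_cod[OF m]
  have z: "(x, h) \<in> topspace (E P)" using x by simp
  obtain x' h' where r: "assoc_rep (cls P (x, h)) = (x', h')" by (cases "assoc_rep (cls P (x, h))")
  have x': "x' \<in> pts P" "h' \<in> H.arr" "banch P x' = H.tgt h'" "bproj P x = bproj P x'"
    "h = H.cmp (F (division G P x x')) h'"
    using cls_rep[OF P z] unfolding r by (auto simp: rel_def)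
  have "cls Q (\<phi> x, h) = cls Q (\<phi> x', h')"
    by (subst cls_eq_iff[OF Q])
       (use x x' G.division_bundle_map[OF m x(1) x'(1,4)] G.bundle_map_in[OF m] G.bundle_map_banch[OF m] G.bundle_map_bproj[OF m]
         in \<open>simp_all add: rel_def\<close>)
  then show ?thesis using cls_in[OF x] r unfolding assoc_map_def by simp
qed

lemma bundle_map_assoc:
  assumes m: "(P, Q, \<phi>, f) \<in> bundle_maps G"
  shows "(A P, A Q, assoc_map P Q \<phi>, f) \<in> bundle_maps H"
proof -
  note P = G.bundle_map_principal_dom[OF m] and Q = G.bundle_map_principal_cod[OF m]
  have *: "\<phi> x \<in> pts Q" "banch Q (\<phi> x) = banch P x" if "x \<in> pts P" for x
    using G.bundle_map_in[OF m that] G.bundle_map_banch[OF m that] .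
  have "(A P, A Q, restrict (assoc_map P Q \<phi>) (pts (A P)), f) \<in> bundle_maps H"
  proof (rule H.bundle_mapsI)
    show "principal_bundle H (A P)" "principal_bundle H (A Q)"
      using principal_assoc_bundle P Q by blast+
    show "continuous_map (bbase (A P)) (bbase (A Q)) f" "f \<in> extensional (topspace (bbase (A P)))"
      using G.bundle_map_continuous_base[OF m] G.bundle_map_extensional_base[OF m] by simp_all
    have "continuous_map (E P) (btot (A Q)) (\<lambda>z. cls Q (\<phi> (fst z), snd z))"
      by (intro continuous_cls continuous_map_compose_apply[OF G.bundle_map_continuous[OF m]] continuous_map_fibprod_fst
          continuous_map_fibprod_snd) (use * in auto)
    then have "continuous_map (E P) (btot (A Q)) (\<lambda>z. assoc_map P Q \<phi> (cls P z))"
      by (rule continuous_map_cong_topspace) (use assoc_map_cls[OF m] in auto)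
    then show "continuous_map (btot (A P)) (btot (A Q)) (assoc_map P Q \<phi>)"
      by (rule continuous_from_assoc)
    fix c assume "c \<in> pts (A P)"
    then obtain x h where x: "x \<in> pts P" "h \<in> H.arr" "banch P x = H.tgt h" and c: "c = cls P (x, h)"
      by (rule tot_cases)
    have y: "\<phi> x \<in> pts Q" "h \<in> H.arr" "banch Q (\<phi> x) = H.tgt h" using x * by auto
    show "bproj (A Q) (assoc_map P Q \<phi> c) = f (bproj (A P) c) \<and> banch (A Q) (assoc_map P Q \<phi> c) = banch (A P) c"
      unfolding c assoc_map_cls[OF m x] bproj_assoc[OF P x] banch_assoc[OF P x] bproj_assoc[OF Q y] banch_assoc[OF Q y]
      using G.bundle_map_bproj[OF m x(1)] by simp
    fix k assume k: "k \<in> H.arr" "banch (A P) c = H.tgt k"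
    then have k': "H.src h = H.tgt k" using banch_assoc[OF P x] c by simp
    show "assoc_map P Q \<phi> (bact (A P) c k) = bact (A Q) (assoc_map P Q \<phi> c) k"
      unfolding c assoc_map_cls[OF m x] bact_assoc[OF P x k(1) k'] bact_assoc[OF Q y k(1) k']
      by (rule assoc_map_cls[OF m]) (use x k k' in auto)
  qed
  then show ?thesis unfolding assoc_map_def by simp
qed

lemma stack_morphism_assoc: "stack_morphism G.B H.B f_assoc"
  unfolding stack_morphism_def
proof (intro conjI ballI)
  show "is_functor G.B H.B f_assoc"
  proof (rule is_functorI)
    fix P assume P: "P \<in> Ob G.B"
    then show "on_ob f_assoc P \<in> Ob H.B" using principal_assoc_bundle by simp
    have id: "Idt G.B P = (P, P, \<lambda>p\<in>pts P. p, \<lambda>x\<in>topspace (bbase P). x)" by simp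
    have m: "(P, P, \<lambda>p\<in>pts P. p, \<lambda>x\<in>topspace (bbase P). x) \<in> bundle_maps G"
      using G.bundle_map_idt P by simp
    have "assoc_map P P (\<lambda>p\<in>pts P. p) = (\<lambda>c\<in>pts (A P). c)"
    proof (rule extensionalityI[where A = "pts (A P)"])
      fix c assume "c \<in> pts (A P)"
      then obtain x h where x: "x \<in> pts P" "h \<in> H.arr" "banch P x = H.tgt h" and c: "c = cls P (x, h)"
        by (rule tot_cases)
      show "assoc_map P P (\<lambda>p\<in>pts P. p) c = (\<lambda>c\<in>pts (A P). c) c"
        using assoc_map_cls[OF m x] c x by auto
    qed (auto simp: assoc_map_def)
    then show "on_ar f_assoc (Idt G.B P) = Idt H.B (on_ob f_assoc P)" unfolding id assoc_morphism_simps by simp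
  next
    fix m k P Q R
    assume "m \<in> hom_set G.B P Q"
    then obtain \<phi> f where m: "m = (P, Q, \<phi>, f)" "(P, Q, \<phi>, f) \<in> bundle_maps G"
      unfolding classifying_stack_hom by blast
    then show "on_ar f_assoc m \<in> hom_set H.B (on_ob f_assoc P) (on_ob f_assoc Q)"
      using bundle_map_assoc unfolding classifying_stack_hom by auto
    assume "k \<in> hom_set G.B Q R"
    then obtain \<psi> g where k: "k = (Q, R, \<psi>, g)" "(Q, R, \<psi>, g) \<in> bundle_maps G"
      unfolding classifying_stack_hom by blast
    have "assoc_map P R (compose (pts P) \<psi> \<phi>) = compose (pts (A P)) (assoc_map Q R \<psi>) (assoc_map P Q \<phi>)"
    proof (rule extensionalityI[where A = "pts (A P)"])
      fix c assume c0: "c \<in> pts (A P)"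
      then obtain x h where x: "x \<in> pts P" "h \<in> H.arr" "banch P x = H.tgt h" and c: "c = cls P (x, h)"
        by (rule tot_cases)
      have y: "\<phi> x \<in> pts Q" "h \<in> H.arr" "banch Q (\<phi> x) = H.tgt h"
        using x G.bundle_map_in[OF m(2)] G.bundle_map_banch[OF m(2)] by auto
      show "assoc_map P R (compose (pts P) \<psi> \<phi>) c = compose (pts (A P)) (assoc_map Q R \<psi>) (assoc_map P Q \<phi>) c"
        using c0 unfolding compose_def restrict_apply' c
        using assoc_map_cls[OF G.bundle_maps_compose[OF m(2) k(2)] x] assoc_map_cls[OF m(2) x] assoc_map_cls[OF k(2) y] x(1)
        by (simp add: compose_def)
    qed (auto simp: assoc_map_def compose_def)
    then show "on_ar f_assoc (Cmp G.B k m) = Cmp H.B (on_ar f_assoc k) (on_ar f_assoc m)"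
      unfolding m(1) k(1) by simp
  qed
next
  fix m assume "m \<in> Ar G.B"
  then show "base_ar H.B (on_ar f_assoc m) = base_ar G.B m" by (cases m) simp
qed simp

end


section \<open>The 2-fibre product\<close>

locale fibred_morphism = D: fibred D + C: fibred C
  for D :: "('u, 'o, 'a) topcat" and C :: "('u, 'p, 'b) topcat" +
  fixes F :: "('o, 'a, 'p, 'b) func"
  assumes morphism: "stack_morphism D C F"
begin

abbreviation S where "S \<equiv> self_fibre_product D C F"

lemma S_Ob: "(x, y, \<phi>) \<in> Ob S \<longleftrightarrow> x \<in> Ob D \<and> y \<in> Ob D \<and> base_ob D x = base_ob D y \<and>
    \<phi> \<in> hom_set C (on_ob F x) (on_ob F y) \<and> base_ar C \<phi> = Idt Top (base_ob D x)"
  by (simp add: self_fibre_product_def)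

lemma S_simps [simp]:
  "Dom S (s, t, ab) = s" "Cod S (s, t, ab) = t"
  "Idt S (x, y, \<phi>) = ((x, y, \<phi>), (x, y, \<phi>), (Idt D x, Idt D y))"
  "Cmp S (s', t', (a', b')) (s, t, (a, b)) = (s, t', (Cmp D a' a, Cmp D b' b))"
  "base_ob S (x, y, \<phi>) = base_ob D x" "base_ar S (s, t, (a, b)) = base_ar D a"
  by (simp_all add: self_fibre_product_def)

lemma S_hom: "m \<in> hom_set S (x, y, \<phi>) (x', y', \<phi>') \<longleftrightarrow>
    (x, y, \<phi>) \<in> Ob S \<and> (x', y', \<phi>') \<in> Ob S \<and>
    (\<exists>a b. m = ((x, y, \<phi>), (x', y', \<phi>'), (a, b)) \<and> a \<in> hom_set D x x' \<and> b \<in> hom_set D y y' \<and>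
      base_ar D a = base_ar D b \<and> Cmp C \<phi>' (on_ar F a) = Cmp C (on_ar F b) \<phi>)"
  by (auto simp: hom_set_def self_fibre_product_def)

lemmas F_hom = stack_morphism_hom[OF morphism]
  and F_base = stack_morphism_ar[OF morphism]
  and F_base_ob = stack_morphism_ob[OF morphism]
  and F_cmp = functor_cmp[OF stack_morphism_functor[OF morphism]]
  and F_idt = functor_idt[OF stack_morphism_functor[OF morphism]]

lemma category_S: "category S"
proof (rule categoryI)
  fix m assume m: "m \<in> Ar S"
  obtain x y \<phi> x' y' \<phi>' a b where "m = ((x, y, \<phi>), (x', y', \<phi>'), (a, b))" by (cases m) auto
  with m show "Dom S m \<in> Ob S \<and> Cod S m \<in> Ob S" by (simp add: self_fibre_product_def)
next
  fix s assume s: "s \<in> Ob S"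
  obtain x y \<phi> where s': "s = (x, y, \<phi>)" by (cases s)
  have *: "x \<in> Ob D" "y \<in> Ob D" "base_ob D x = base_ob D y" "\<phi> \<in> hom_set C (on_ob F x) (on_ob F y)"
    using s unfolding s' S_Ob by auto
  have "base_ar D (Idt D x) = base_ar D (Idt D y)" using * by (simp add: D.base_idt)
  then show "Idt S s \<in> hom_set S s s"
    using s * unfolding s' S_hom by (auto simp: F_idt)
next
  fix m k l s t u v
  assume m: "m \<in> hom_set S s t" and k: "k \<in> hom_set S t u"
  obtain x y \<phi> x' y' \<phi>' x'' y'' \<phi>'' where e: "s = (x, y, \<phi>)" "t = (x', y', \<phi>')" "u = (x'', y'', \<phi>'')"
    by (cases s; cases t; cases u)
  obtain a b where ab: "m = ((x, y, \<phi>), (x', y', \<phi>'), (a, b))" "a \<in> hom_set D x x'" "b \<in> hom_set D y y'"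
      "base_ar D a = base_ar D b" "Cmp C \<phi>' (on_ar F a) = Cmp C (on_ar F b) \<phi>"
    and o: "(x, y, \<phi>) \<in> Ob S" "(x', y', \<phi>') \<in> Ob S"
    using m unfolding e S_hom by blast
  obtain c d where cd: "k = ((x', y', \<phi>'), (x'', y'', \<phi>''), (c, d))" "c \<in> hom_set D x' x''" "d \<in> hom_set D y' y''"
      "base_ar D c = base_ar D d" "Cmp C \<phi>'' (on_ar F c) = Cmp C (on_ar F d) \<phi>'"
    and o': "(x'', y'', \<phi>'') \<in> Ob S"
    using k unfolding e S_hom by blast
  have \<phi>: "\<phi> \<in> hom_set C (on_ob F x) (on_ob F y)" "\<phi>' \<in> hom_set C (on_ob F x') (on_ob F y')"
    "\<phi>'' \<in> hom_set C (on_ob F x'') (on_ob F y'')"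
    using o o' unfolding S_Ob by auto
  note Fa = F_hom[OF ab(2)] F_hom[OF ab(3)] F_hom[OF cd(2)] F_hom[OF cd(3)]
  have "Cmp C \<phi>'' (on_ar F (Cmp D c a)) = Cmp C (Cmp C \<phi>'' (on_ar F c)) (on_ar F a)"
    by (simp add: F_cmp[OF cd(2) ab(2)] C.assoc[OF \<phi>(3) Fa(3) Fa(1)])
  also have "\<dots> = Cmp C (on_ar F d) (Cmp C \<phi>' (on_ar F a))"
    by (simp add: cd(5) C.assoc[OF Fa(4) \<phi>(2) Fa(1)])
  also have "\<dots> = Cmp C (on_ar F (Cmp D d b)) \<phi>"
    by (simp add: ab(5) F_cmp[OF cd(3) ab(3)] C.assoc[OF Fa(4) Fa(2) \<phi>(1)])
  finally show "Cmp S k m \<in> hom_set S s u"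
    unfolding e S_hom using o o' ab cd D.cmp[OF cd(2) ab(2)] D.cmp[OF cd(3) ab(3)]
    by (auto simp: D.base_cmp[OF cd(2) ab(2)] D.base_cmp[OF cd(3) ab(3)])
  assume l: "l \<in> hom_set S u v"
  obtain x3 y3 \<phi>3 where v: "v = (x3, y3, \<phi>3)" by (cases v)
  obtain f g where fg: "l = ((x'', y'', \<phi>''), (x3, y3, \<phi>3), (f, g))" "f \<in> hom_set D x'' x3" "g \<in> hom_set D y'' y3"
    using l unfolding e v S_hom by blast
  show "Cmp S l (Cmp S k m) = Cmp S (Cmp S l k) m"
    unfolding ab(1) cd(1) fg(1) by (simp add: D.assoc[OF fg(2) cd(2) ab(2)] D.assoc[OF fg(3) cd(3) ab(3)])
next
  fix m s t assume m: "m \<in> hom_set S s t"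
  obtain x y \<phi> x' y' \<phi>' where e: "s = (x, y, \<phi>)" "t = (x', y', \<phi>')" by (cases s; cases t)
  obtain a b where ab: "m = ((x, y, \<phi>), (x', y', \<phi>'), (a, b))" "a \<in> hom_set D x x'" "b \<in> hom_set D y y'"
    using m unfolding e S_hom by blast
  then show "Cmp S m (Idt S s) = m \<and> Cmp S (Idt S t) m = m"
    unfolding e by simp
qed

lemma proj_S: "is_functor S Top (proj S)"
proof (rule is_functorI)
  fix s assume s: "s \<in> Ob S"
  obtain x y \<phi> where s': "s = (x, y, \<phi>)" by (cases s)
  then show "base_ar S (Idt S s) = Idt Top (base_ob S s)"
    using s unfolding s' S_Ob by (simp add: D.base_idt)
next
  fix m k s t u assume m: "m \<in> hom_set S s t"
  obtain x y \<phi> x' y' \<phi>' where e: "s = (x, y, \<phi>)" "t = (x', y', \<phi>')" by (cases s; cases t)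
  obtain a b where ab: "m = ((x, y, \<phi>), (x', y', \<phi>'), (a, b))" "a \<in> hom_set D x x'" "b \<in> hom_set D y y'"
    using m unfolding e S_hom by blast
  show "base_ar S m \<in> hom_set Top (base_ob S s) (base_ob S t)" using D.base_hom[OF ab(2)] ab(1) e by simp
  assume k: "k \<in> hom_set S t u"
  obtain x'' y'' \<phi>'' where u: "u = (x'', y'', \<phi>'')" by (cases u)
  obtain c d where cd: "k = ((x', y', \<phi>'), (x'', y'', \<phi>''), (c, d))" "c \<in> hom_set D x' x''" "d \<in> hom_set D y' y''"
    using k unfolding e u S_hom by blast
  show "base_ar S (Cmp S k m) = Cmp Top (base_ar S k) (base_ar S m)"
    using ab(1) cd(1) D.base_cmp[OF cd(2) ab(2)] by simp
qed simp

text \<open>Pullbacks and factorizations are formed in both components; the isomorphism between the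
  images under F is then forced, because the images of arrows of D are cartesian in C.\<close>

lemma fibred_S: "fibred_in_groupoids S"
  unfolding fibred_in_groupoids_def
proof (intro conjI ballI impI category_S proj_S)
  fix s f assume s: "s \<in> Ob S" and f: "f \<in> Ar Top" "Cod Top f = base_ob S s"
  obtain x y \<phi> where e: "s = (x, y, \<phi>)" by (cases s)
  have o: "x \<in> Ob D" "y \<in> Ob D" "base_ob D y = base_ob D x" "\<phi> \<in> hom_set C (on_ob F x) (on_ob F y)"
    "base_ar C \<phi> = Idt Top (base_ob D x)"
    using s unfolding e S_Ob by auto
  have f': "f \<in> hom_set Top (Dom Top f) (base_ob D x)" "f \<in> hom_set Top (Dom Top f) (base_ob D y)"
    using f o(3) e by (simp_all add: hom_set_def)
  obtain a x' where a: "a \<in> hom_set D x' x" "base_ar D a = f" "base_ob D x' = Dom Top f"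
    by (rule D.pullback[OF o(1) f'(1)])
  obtain b y' where b: "b \<in> hom_set D y' y" "base_ar D b = f" "base_ob D y' = Dom Top f"
    by (rule D.pullback[OF o(2) f'(2)])
  have x': "x' \<in> Ob D" "y' \<in> Ob D" using D.hom_ob[OF a(1)] D.hom_ob[OF b(1)] by auto
  note Fa = F_hom[OF a(1)] and Fb = F_hom[OF b(1)]
  have k: "Cmp C \<phi> (on_ar F a) \<in> hom_set C (on_ob F x') (on_ob F y)" using o(4) Fa by (rule C.cmp)
  have bk: "base_ar C (Cmp C \<phi> (on_ar F a)) = f"
    using C.base_cmp[OF o(4) Fa] o(5) F_base[OF a(1)] a(2) cat_idt_left[OF category_Top f'(1)] by simp
  \<comment> \<open>The restriction of \<phi> along f: it is the factorization through
    \<open>F b\<close> of \<phi> after \<open>F a\<close>, taken over the identity.\<close>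
  obtain \<phi>' where \<phi>': "\<phi>' \<in> hom_set C (on_ob F x') (on_ob F y')" "base_ar C \<phi>' = Idt Top (Dom Top f)"
    "Cmp C (on_ar F b) \<phi>' = Cmp C \<phi> (on_ar F a)"
  proof (rule C.cartesian[OF Fb k, of "Idt Top (Dom Top f)"])
    show "Idt Top (Dom Top f) \<in> hom_set Top (base_ob C (on_ob F x')) (base_ob C (on_ob F y'))"
      using cat_idt[OF category_Top, of "Dom Top f"] F_base_ob x' a(3) b(3) by simp
    show "Cmp Top (base_ar C (on_ar F b)) (Idt Top (Dom Top f)) = base_ar C (Cmp C \<phi> (on_ar F a))"
      using bk F_base[OF b(1)] b(2) cat_idt_right[OF category_Top f'(1)] by simp
  qed auto
  have "((x', y', \<phi>'), (x, y, \<phi>), (a, b)) \<in> hom_set S (x', y', \<phi>') (x, y, \<phi>)"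
    unfolding S_hom using s e a b \<phi>' x' by (simp add: S_Ob)
  then show "\<exists>m\<in>Ar S. Cod S m = s \<and> base_ar S m = f"
    using e a(2) by (intro bexI[of _ "((x', y', \<phi>'), (x, y, \<phi>), (a, b))"]) (auto simp: hom_set_def)
next
  fix m k h assume m: "m \<in> Ar S" and k: "k \<in> Ar S" and h: "h \<in> Ar Top"
    and eq: "Cod S m = Cod S k \<and> Dom Top h = base_ob S (Dom S k) \<and>
        Cod Top h = base_ob S (Dom S m) \<and> Cmp Top (base_ar S m) h = base_ar S k"
  obtain x y \<phi> x0 y0 \<phi>0 a b where m': "m = ((x, y, \<phi>), (x0, y0, \<phi>0), (a, b))" by (cases m) auto
  obtain x' y' \<phi>' a' b' where k': "k = ((x', y', \<phi>'), (x0, y0, \<phi>0), (a', b'))" using eq m' by (cases k) auto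
  have m1: "m \<in> hom_set S (x, y, \<phi>) (x0, y0, \<phi>0)" and k1: "k \<in> hom_set S (x', y', \<phi>') (x0, y0, \<phi>0)"
    using m k m' k' by (simp_all add: hom_set_def)
  have ab: "a \<in> hom_set D x x0" "b \<in> hom_set D y y0" "base_ar D a = base_ar D b" "Cmp C \<phi>0 (on_ar F a) = Cmp C (on_ar F b) \<phi>"
    and o: "(x, y, \<phi>) \<in> Ob S" "(x0, y0, \<phi>0) \<in> Ob S"
    using m1 m' unfolding S_hom by auto
  have ab': "a' \<in> hom_set D x' x0" "b' \<in> hom_set D y' y0" "base_ar D a' = base_ar D b'" "Cmp C \<phi>0 (on_ar F a') = Cmp C (on_ar F b') \<phi>'"
    and o': "(x', y', \<phi>') \<in> Ob S"
    using k1 k' unfolding S_hom by auto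
  have \<phi>: "\<phi> \<in> hom_set C (on_ob F x) (on_ob F y)" "\<phi>0 \<in> hom_set C (on_ob F x0) (on_ob F y0)" "\<phi>' \<in> hom_set C (on_ob F x') (on_ob F y')"
    "base_ob D y = base_ob D x" "base_ob D y' = base_ob D x'"
    "base_ar C \<phi> = Idt Top (base_ob D x)" "base_ar C \<phi>' = Idt Top (base_ob D x')"
    using o o' unfolding S_Ob by auto
  have h': "h \<in> hom_set Top (base_ob D x') (base_ob D x)" "h \<in> hom_set Top (base_ob D y') (base_ob D y)"
    using h eq m' k' \<phi>(4,5) by (simp_all add: hom_set_def)
  have bh: "Cmp Top (base_ar D a) h = base_ar D a'" "Cmp Top (base_ar D b) h = base_ar D b'"
    using eq m' k' ab(3) ab'(3) by simp_all
  obtain l1 where l1: "l1 \<in> hom_set D x' x" "base_ar D l1 = h" "Cmp D a l1 = a'"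
    by (rule D.cartesian[OF ab(1) ab'(1) h'(1) bh(1)])
  obtain l2 where l2: "l2 \<in> hom_set D y' y" "base_ar D l2 = h" "Cmp D b l2 = b'"
    by (rule D.cartesian[OF ab(2) ab'(2) h'(2) bh(2)])
  note Fa = F_hom[OF ab(1)] and Fb = F_hom[OF ab(2)] and F1 = F_hom[OF l1(1)] and F2 = F_hom[OF l2(1)]
  \<comment> \<open>The two componentwise lifts form an arrow of the fibre product only if they are
    compatible with \<phi> and \<phi>'. The two sides agree after composition with the cartesian
    arrow \<open>F b\<close>.\<close>
  have comm: "Cmp C \<phi> (on_ar F l1) = Cmp C (on_ar F l2) \<phi>'"
  proof (rule C.cartesian_cancel[OF Fb])
    show "Cmp C \<phi> (on_ar F l1) \<in> hom_set C (on_ob F x') (on_ob F y)" using \<phi>(1) F1 by (rule C.cmp)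
    show "Cmp C (on_ar F l2) \<phi>' \<in> hom_set C (on_ob F x') (on_ob F y)" using F2 \<phi>(3) by (rule C.cmp)
    show "base_ar C (Cmp C \<phi> (on_ar F l1)) = base_ar C (Cmp C (on_ar F l2) \<phi>')"
      using C.base_cmp[OF \<phi>(1) F1] C.base_cmp[OF F2 \<phi>(3)] \<phi>(6,7) F_base[OF l1(1)] F_base[OF l2(1)] l1(2) l2(2)
        cat_idt_left[OF category_Top h'(1)] cat_idt_right[OF category_Top h'(1)] by simp
    have "Cmp C (on_ar F b) (Cmp C \<phi> (on_ar F l1)) = Cmp C \<phi>0 (on_ar F a')"
      using C.assoc[OF Fb \<phi>(1) F1] C.assoc[OF \<phi>(2) Fa F1] ab(4) F_cmp[OF ab(1) l1(1)] l1(3) by simp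
    also have "\<dots> = Cmp C (on_ar F b) (Cmp C (on_ar F l2) \<phi>')"
      using C.assoc[OF Fb F2 \<phi>(3)] ab'(4) F_cmp[OF ab(2) l2(1)] l2(3) by simp
    finally show "Cmp C (on_ar F b) (Cmp C \<phi> (on_ar F l1)) = Cmp C (on_ar F b) (Cmp C (on_ar F l2) \<phi>')" .
  qed
  show "\<exists>!l. l \<in> hom_set S (Dom S k) (Dom S m) \<and> base_ar S l = h \<and> Cmp S m l = k"
  proof (rule ex1I[of _ "((x', y', \<phi>'), (x, y, \<phi>), (l1, l2))"])
    show "((x', y', \<phi>'), (x, y, \<phi>), (l1, l2)) \<in> hom_set S (Dom S k) (Dom S m) \<and>
      base_ar S ((x', y', \<phi>'), (x, y, \<phi>), (l1, l2)) = h \<and> Cmp S m ((x', y', \<phi>'), (x, y, \<phi>), (l1, l2)) = k"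
      unfolding m' k' using o o' l1 l2 comm by (simp add: S_hom)
    fix l assume l: "l \<in> hom_set S (Dom S k) (Dom S m) \<and> base_ar S l = h \<and> Cmp S m l = k"
    then have "l \<in> hom_set S (x', y', \<phi>') (x, y, \<phi>)" using m' k' by simp
    then obtain c d where cd: "l = ((x', y', \<phi>'), (x, y, \<phi>), (c, d))" "c \<in> hom_set D x' x" "d \<in> hom_set D y' y"
      "base_ar D c = base_ar D d" unfolding S_hom by blast
    have "base_ar D c = h" "Cmp D a c = a'" "Cmp D b d = b'" using l cd(1) m' k' by simp_all
    then have "c = l1" "d = l2"
      using D.cartesian_cancel[OF ab(1) cd(2) l1(1)] D.cartesian_cancel[OF ab(2) cd(3) l2(1)] l1 l2 cd(4) by simp_all
    then show "l = ((x', y', \<phi>'), (x, y, \<phi>), (l1, l2))" using cd(1) by simp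
  qed
qed

section \<open>The diagonal morphism\<close>

lemma diagonal_simps [simp]:
  "on_ob (diagonal D C F) x = (x, x, Idt C (on_ob F x))"
  "on_ar (diagonal D C F) a = ((Dom D a, Dom D a, Idt C (on_ob F (Dom D a))), (Cod D a, Cod D a, Idt C (on_ob F (Cod D a))), (a, a))"
  by (simp_all add: diagonal_def)

lemma diagonal_Ob: "x \<in> Ob D \<Longrightarrow> (x, x, Idt C (on_ob F x)) \<in> Ob S"
  using functor_ob[OF stack_morphism_functor[OF morphism]] by (simp add: S_Ob C.idt C.base_idt F_base_ob)

lemma stack_morphism_diagonal: "stack_morphism D S (diagonal D C F)"
  unfolding stack_morphism_def
proof (intro conjI ballI)
  show "is_functor D S (diagonal D C F)"
  proof (rule is_functorI)
    fix x assume x: "x \<in> Ob D"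
    show "on_ob (diagonal D C F) x \<in> Ob S" using diagonal_Ob[OF x] by simp
    show "on_ar (diagonal D C F) (Idt D x) = Idt S (on_ob (diagonal D C F) x)"
      using D.idt[OF x] by (simp add: hom_set_def)
  next
    fix a b x y z assume a: "a \<in> hom_set D x y"
    have xy: "Dom D a = x" "Cod D a = y" using a by (simp_all add: hom_set_def)
    show "on_ar (diagonal D C F) a \<in> hom_set S (on_ob (diagonal D C F) x) (on_ob (diagonal D C F) y)"
      using a D.hom_ob[OF a] diagonal_Ob F_hom[OF a] by (simp add: S_hom xy)
    assume b: "b \<in> hom_set D y z"
    then show "on_ar (diagonal D C F) (Cmp D b a) = Cmp S (on_ar (diagonal D C F) b) (on_ar (diagonal D C F) a)"
      using a D.cmp[OF b a] by (simp add: hom_set_def)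
  qed
qed simp_all

text \<open>An arrow from the diagonal image of d to (x, y, \<phi>) is a pair of arrows a and b out
  of the same d. As the isomorphism attached to d is an identity, compatibility reduces to \<phi>
  after \<open>F a\<close> being \<open>F b\<close>. Thus \<phi> has to be lifted locally to an
  arrow of D.\<close>

lemma epimorphism_diagonalI:
  assumes "\<And>x y \<phi> U. (x, y, \<phi>) \<in> Ob S \<Longrightarrow> base_ob D x = U \<Longrightarrow>
    \<exists>\<U>. open_cover U \<U> \<and> (\<forall>V\<in>\<U>. \<exists>d\<in>Ob D. base_ob D d = subtopology U V \<and>
        (\<exists>a\<in>hom_set D d x. \<exists>b\<in>hom_set D d y. base_ar D a = incl (subtopology U V) U \<and> base_ar D b = incl (subtopology U V) U \<and>
          Cmp C \<phi> (on_ar F a) = on_ar F b))"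
  shows "epimorphism D S (diagonal D C F)"
proof (rule epimorphismI[OF D.fibred fibred_S stack_morphism_diagonal])
  fix s U assume s: "s \<in> Ob S" and U: "base_ob S s = U"
  obtain x y \<phi> where e: "s = (x, y, \<phi>)" by (cases s)
  obtain \<U> where \<U>: "open_cover U \<U>" and loc: "\<And>V. V \<in> \<U> \<Longrightarrow> \<exists>d\<in>Ob D. base_ob D d = subtopology U V \<and>
        (\<exists>a\<in>hom_set D d x. \<exists>b\<in>hom_set D d y. base_ar D a = incl (subtopology U V) U \<and> base_ar D b = incl (subtopology U V) U \<and>
          Cmp C \<phi> (on_ar F a) = on_ar F b)"
    using assms[of x y \<phi> U] s U e by auto
  show "\<exists>\<U>. open_cover U \<U> \<and> (\<forall>V\<in>\<U>. \<exists>d\<in>Ob D. base_ob D d = subtopology U V \<and>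
     (\<exists>\<kappa>\<in>hom_set S (on_ob (diagonal D C F) d) s. base_ar S \<kappa> = incl (subtopology U V) U))"
  proof (intro exI[of _ \<U>] conjI ballI \<U>)
    fix V assume "V \<in> \<U>"
    then obtain d a b where d: "d \<in> Ob D" "base_ob D d = subtopology U V"
      and a: "a \<in> hom_set D d x" "base_ar D a = incl (subtopology U V) U"
      and b: "b \<in> hom_set D d y" "base_ar D b = incl (subtopology U V) U" and c: "Cmp C \<phi> (on_ar F a) = on_ar F b"
      using loc by metis
    have "((d, d, Idt C (on_ob F d)), (x, y, \<phi>), (a, b)) \<in> hom_set S (on_ob (diagonal D C F) d) s"
      using s e a b c diagonal_Ob[OF d(1)] F_hom[OF b(1)] by (simp add: S_hom)
    then show "\<exists>d\<in>Ob D. base_ob D d = subtopology U V \<and>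
     (\<exists>\<kappa>\<in>hom_set S (on_ob (diagonal D C F) d) s. base_ar S \<kappa> = incl (subtopology U V) U)"
      using d a(2) by (intro bexI[of _ d] conjI bexI[of _ "((d, d, Idt C (on_ob F d)), (x, y, \<phi>), (a, b))"]) simp_all
  qed
qed

end


section \<open>The gerbe of an extension\<close>

lemma open_cover_localI:
  assumes "\<And>n. n \<in> topspace U \<Longrightarrow> \<exists>V. openin U V \<and> n \<in> V \<and> R V"
  shows "\<exists>\<U>. open_cover U \<U> \<and> (\<forall>V\<in>\<U>. R V)"
proof (intro exI conjI)
  show "open_cover U {V. openin U V \<and> R V}"
    unfolding open_cover_def
  proof (intro conjI equalityI subsetI)
    fix n assume "n \<in> topspace U"
    from assms[OF this] show "n \<in> \<Union>{V. openin U V \<and> R V}" by blast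
  qed (auto dest: openin_subset)
qed simp

sublocale gpd_extension \<subseteq> FM: fibred_morphism "classifying_stack G" "classifying_stack H" "assoc_morphism G H F"
  by unfold_locales (rule stack_morphism_assoc)

context gpd_extension
begin

lemma epimorphism_assoc: "epimorphism G.B H.B f_assoc"
proof (rule epimorphismI[OF G.fibred_classifying_stack H.fibred_classifying_stack stack_morphism_assoc])
  fix P U assume "P \<in> Ob H.B" "base_ob H.B P = U"
  then have P: "principal_bundle H P" and U: "bbase P = U" by auto
  show "\<exists>\<U>. open_cover U \<U> \<and> (\<forall>V\<in>\<U>. \<exists>d\<in>Ob G.B. base_ob G.B d = subtopology U V \<and>
     (\<exists>\<kappa>\<in>hom_set H.B (on_ob f_assoc d) P. base_ar H.B \<kappa> = incl (subtopology U V) U))"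
  proof (rule open_cover_localI)
    fix n assume n: "n \<in> topspace U"
    obtain V \<sigma> where V: "openin U V" "n \<in> V" and \<sigma>: "continuous_map (subtopology U V) (btot P) \<sigma>"
      "\<And>z. z \<in> V \<Longrightarrow> bproj P (\<sigma> z) = z" "\<And>z. z \<in> V \<Longrightarrow> \<sigma> z \<in> pts P"
      using H.principal_section[OF P] n U by metis
    let ?N = "subtopology U V"
    have tN: "topspace ?N = V" using openin_subset[OF V(1)] by auto
    \<comment> \<open>The anchor of P along \<sigma>, extended by \<open>undefined\<close> off V
      because maps of the site are extensional. It takes values in the common object space, so it
      classifies a trivial G-bundle d.\<close>
    define \<alpha> where "\<alpha> = (\<lambda>z\<in>V. banch P (\<sigma> z))"
    have \<alpha>: "continuous_map ?N (gobj G) \<alpha>" "\<alpha> \<in> extensional (topspace ?N)"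
    proof -
      have "continuous_map ?N (gobj G) (\<lambda>z. banch P (\<sigma> z))"
        using continuous_map_compose_apply[OF H.continuous_banch[OF P] \<sigma>(1)] by simp
      then show "continuous_map ?N (gobj G) \<alpha>"
        by (rule continuous_map_cong_topspace) (simp add: \<alpha>_def)
      show "\<alpha> \<in> extensional (topspace ?N)" unfolding \<alpha>_def tN by simp
    qed
    have \<alpha>_in: "\<alpha> z \<in> G.obj" if "z \<in> V" for z using continuous_map_topspace[OF \<alpha>(1), of z] that unfolding tN by simp
    define d where "d = pullback_bundle G.unit_bundle ?N \<alpha>"
    define \<pi> where "\<pi> = (\<lambda>c\<in>pts d. snd (assoc_rep c))"
    have d: "principal_bundle G d" "(d, G.unit_bundle, \<pi>, \<alpha>) \<in> bundle_maps G"
      unfolding d_def \<pi>_def using G.pullback_bundle[OF G.principal_unit_bundle, of ?N \<alpha>] \<alpha> by simp_all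
    have bd: "bbase d = ?N" by (simp add: d_def pullback_bundle_def)
    \<comment> \<open>The section of the trivial bundle d that corresponds to the units of G; its
      anchor is \<alpha>.\<close>
    define e where "e z = fibre_inverse d \<pi> z (G.unt (\<alpha> z))" for z
    have e: "e z \<in> pts d" "bproj d (e z) = z" "banch d (e z) = \<alpha> z" if z: "z \<in> V" for z
      unfolding e_def
      using G.fibre_inverse_in[OF d(2), of z "G.unt (\<alpha> z)"] G.bproj_fibre_inverse[OF d(2), of z "G.unt (\<alpha> z)"]
        G.banch_fibre_inverse[OF d(2), of z "G.unt (\<alpha> z)"] \<alpha>_in[OF z] z subsetD[OF openin_subset[OF V(1)] z] bd by simp_all
    have ce: "continuous_map ?N (btot d) e"
      unfolding e_def
      by (rule G.continuous_fibre_inverse[OF d(2)])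
         (use bd \<alpha>_in tN continuous_map_compose_apply[OF G.continuous_unt \<alpha>(1)] in \<open>auto simp: continuous_map_id[unfolded id_def]\<close>)
    have ce': "continuous_map ?N (btot (A d)) (\<lambda>z. cls d (e z, H.unt (\<alpha> z)))"
      by (intro continuous_cls ce) (use e \<alpha>_in tN continuous_map_compose_apply[OF H.continuous_unt] \<alpha>(1) in auto)
    have el: "e z \<in> pts d" "H.unt (\<alpha> z) \<in> H.arr" "banch d (e z) = H.tgt (H.unt (\<alpha> z))" if "z \<in> V" for z
      using e[OF that] \<alpha>_in[OF that] by simp_all
    \<comment> \<open>Pairing e with units of H gives a section of the associated bundle whose
      anchor is \<alpha>, the anchor of P along \<sigma>. Matching this section with \<sigma>
      defines the bundle map.\<close>
    have "\<exists>\<phi>. (A d, P, \<phi>, \<lambda>z\<in>V. z) \<in> bundle_maps H"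
    proof (rule exI, rule H.bundle_map_from_section[where s = "\<lambda>z. cls d (e z, H.unt (\<alpha> z))" and t = \<sigma>])
      show "principal_bundle H (A d)" by (rule principal_assoc_bundle[OF d(1)])
      show "principal_bundle H P" by (rule P)
      have "continuous_map ?N U (\<lambda>z. z)" by (simp add: continuous_map_from_subtopology)
      then have "continuous_map ?N U (\<lambda>z\<in>V. z)"
        by (rule continuous_map_cong_topspace) (use tN in auto)
      then show "continuous_map (bbase (A d)) (bbase P) (\<lambda>z\<in>V. z)" using bd U by simp
      show "(\<lambda>z\<in>V. z) \<in> extensional (topspace (bbase (A d)))" using bd tN by simp
      show "continuous_map (bbase (A d)) (btot (A d)) (\<lambda>z. cls d (e z, H.unt (\<alpha> z)))" using ce' bd by simp
      show "continuous_map (bbase (A d)) (btot P) \<sigma>" using \<sigma> bd by simp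
      fix z assume "z \<in> topspace (bbase (A d))"
      then have z: "z \<in> V" using bd tN by simp
      show "bproj (A d) (cls d (e z, H.unt (\<alpha> z))) = z" "bproj P (\<sigma> z) = (\<lambda>z\<in>V. z) z"
        "banch P (\<sigma> z) = banch (A d) (cls d (e z, H.unt (\<alpha> z)))"
        using bproj_assoc[OF d(1) el[OF z]] banch_assoc[OF d(1) el[OF z]] e[OF z] \<sigma>(2)[OF z] z \<alpha>_in[OF z] by (auto simp: \<alpha>_def)
    qed
    then obtain \<phi> where \<phi>: "(A d, P, \<phi>, \<lambda>z\<in>V. z) \<in> bundle_maps H" by blast
    show "\<exists>V. openin U V \<and> n \<in> V \<and> (\<exists>d\<in>Ob G.B. base_ob G.B d = subtopology U V \<and>
     (\<exists>\<kappa>\<in>hom_set H.B (on_ob f_assoc d) P. base_ar H.B \<kappa> = incl (subtopology U V) U))"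
    proof (intro exI[of _ V] conjI V bexI[of _ d] bexI[of _ "(A d, P, \<phi>, \<lambda>z\<in>V. z)"])
      show "base_ar H.B (A d, P, \<phi>, \<lambda>z\<in>V. z) = incl ?N U" using bd U tN by (simp add: incl_def)
    qed (use \<phi> d bd in \<open>auto simp: classifying_stack_hom\<close>)
  qed
qed

text \<open>Given sections \<^term>\<open>\<sigma>\<close> of \<^term>\<open>x\<close> and \<^term>\<open>\<tau>\<close> of \<^term>\<open>y\<close>, a map \<^term>\<open>\<phi>\<close> between the associated bundles is
  determined by the arrows \<^term>\<open>h n\<close> of \<^term>\<open>H\<close> with \<^term>\<open>\<phi> [\<sigma> n, 1] = [\<tau> n, h n]\<close>. A lift of \<^term>\<open>h\<close> along \<^term>\<open>F\<close>
  therefore lifts \<^term>\<open>\<phi>\<close> to a map of \<^term>\<open>G\<close>-bundles.\<close>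

lemma epimorphism_diagonal_assoc: "epimorphism G.B (self_fibre_product G.B H.B f_assoc) (diagonal G.B H.B f_assoc)"
proof (rule FM.epimorphism_diagonalI)
  fix x y \<phi>' U assume "(x, y, \<phi>') \<in> Ob FM.S" "base_ob G.B x = U"
  then obtain \<phi> where x: "principal_bundle G x" and y: "principal_bundle G y" and U: "bbase x = U" "bbase y = U"
    and \<phi>': "\<phi>' = (A x, A y, \<phi>, \<lambda>z\<in>topspace U. z)" and \<phi>: "(A x, A y, \<phi>, \<lambda>z\<in>topspace U. z) \<in> bundle_maps H"
    unfolding FM.S_Ob by (auto simp: classifying_stack_hom)
  show "\<exists>\<U>. open_cover U \<U> \<and> (\<forall>V\<in>\<U>. \<exists>d\<in>Ob G.B. base_ob G.B d = subtopology U V \<and>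
        (\<exists>a\<in>hom_set G.B d x. \<exists>b\<in>hom_set G.B d y. base_ar G.B a = incl (subtopology U V) U \<and> base_ar G.B b = incl (subtopology U V) U \<and>
          Cmp H.B \<phi>' (on_ar f_assoc a) = on_ar f_assoc b))"
  proof (rule open_cover_localI)
    fix n assume n: "n \<in> topspace U"
    obtain V1 \<sigma> where V1: "openin U V1" "n \<in> V1" and \<sigma>: "continuous_map (subtopology U V1) (btot x) \<sigma>"
      "\<And>z. z \<in> V1 \<Longrightarrow> bproj x (\<sigma> z) = z" "\<And>z. z \<in> V1 \<Longrightarrow> \<sigma> z \<in> pts x"
      using G.principal_section[OF x] n U by metis
    obtain V2 \<tau> where V2: "openin U V2" "n \<in> V2" and \<tau>: "continuous_map (subtopology U V2) (btot y) \<tau>"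
      "\<And>z. z \<in> V2 \<Longrightarrow> bproj y (\<tau> z) = z" "\<And>z. z \<in> V2 \<Longrightarrow> \<tau> z \<in> pts y"
      using G.principal_section[OF y] n U by metis
    define W where "W = V1 \<inter> V2"
    have W: "openin U W" "n \<in> W" "W \<subseteq> topspace U" using V1 V2 openin_subset[of U V1] by (auto simp: W_def)
    have tW: "topspace (subtopology U W) = W" using W(3) by auto
    have \<sigma>W: "continuous_map (subtopology U W) (btot x) \<sigma>" and \<tau>W: "continuous_map (subtopology U W) (btot y) \<tau>"
      by (rule continuous_map_from_subtopology_mono[OF \<sigma>(1)], simp add: W_def)
         (rule continuous_map_from_subtopology_mono[OF \<tau>(1)], simp add: W_def)
    define s0 where "s0 z = cls x (\<sigma> z, H.unt (banch x (\<sigma> z)))" for z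
    define t0 where "t0 z = cls y (\<tau> z, H.unt (banch y (\<tau> z)))" for z
    have sx: "\<sigma> z \<in> pts x" "H.unt (banch x (\<sigma> z)) \<in> H.arr" "banch x (\<sigma> z) = H.tgt (H.unt (banch x (\<sigma> z)))"
      if "z \<in> W" for z using \<sigma> that x by (simp_all add: W_def)
    have ty: "\<tau> z \<in> pts y" "H.unt (banch y (\<tau> z)) \<in> H.arr" "banch y (\<tau> z) = H.tgt (H.unt (banch y (\<tau> z)))"
      if "z \<in> W" for z using \<tau> that y by (simp_all add: W_def)
    have s0: "s0 z \<in> pts (A x)" "bproj (A x) (s0 z) = z" "banch (A x) (s0 z) = banch x (\<sigma> z)" if "z \<in> W" for z
      unfolding s0_def
      using cls_in[OF sx[OF that]] bproj_assoc[OF x sx[OF that]] banch_assoc[OF x sx[OF that]] \<sigma>(2)[of z] that x sx(1)[OF that]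
      by (simp_all add: W_def del: assoc_bundle_simps)
    have t0: "t0 z \<in> pts (A y)" "bproj (A y) (t0 z) = z" "banch (A y) (t0 z) = banch y (\<tau> z)" if "z \<in> W" for z
      unfolding t0_def
      using cls_in[OF ty[OF that]] bproj_assoc[OF y ty[OF that]] banch_assoc[OF y ty[OF that]] \<tau>(2)[of z] that y ty(1)[OF that]
      by (simp_all add: W_def del: assoc_bundle_simps)
    have cs0: "continuous_map (subtopology U W) (btot (A x)) s0"
      unfolding s0_def
      by (intro continuous_cls \<sigma>W continuous_map_compose_apply[OF H.continuous_unt])
         (use continuous_map_compose_apply[OF G.continuous_banch[OF x] \<sigma>W] sx tW in auto)
    have ct0: "continuous_map (subtopology U W) (btot (A y)) t0"
      unfolding t0_def
      by (intro continuous_cls \<tau>W continuous_map_compose_apply[OF H.continuous_unt])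
         (use continuous_map_compose_apply[OF G.continuous_banch[OF y] \<tau>W] ty tW in auto)
    have Ax: "principal_bundle H (A x)" and Ay: "principal_bundle H (A y)"
      using principal_assoc_bundle x y by blast+
    have \<phi>s: "\<phi> (s0 z) \<in> pts (A y)" "bproj (A y) (\<phi> (s0 z)) = z" "banch (A y) (\<phi> (s0 z)) = banch x (\<sigma> z)" if "z \<in> W" for z
      using H.bundle_map_in[OF \<phi> s0(1)[OF that]] H.bundle_map_bproj[OF \<phi> s0(1)[OF that]] H.bundle_map_banch[OF \<phi> s0(1)[OF that]]
        s0[OF that] subsetD[OF W(3) that] by simp_all
    \<comment> \<open>The translation from the section \<open>[\<tau> z, 1]\<close> of
      \<open>A y\<close> to the image under \<phi> of the section \<open>[\<sigma> z, 1]\<close> of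
      \<open>A x\<close>.\<close>
    define h where "h z = division H (A y) (t0 z) (\<phi> (s0 z))" for z
    have h: "h z \<in> H.arr" "H.tgt (h z) = banch y (\<tau> z)" "H.src (h z) = banch x (\<sigma> z)" "\<phi> (s0 z) = cls y (\<tau> z, h z)"
      if z: "z \<in> W" for z
    proof -
      have p: "bproj (A y) (t0 z) = bproj (A y) (\<phi> (s0 z))" using t0[OF z] \<phi>s[OF z] by simp
      note hz = H.division_in[OF Ay t0(1)[OF z] \<phi>s(1)[OF z] p, folded h_def]
        H.tgt_division[OF Ay t0(1)[OF z] \<phi>s(1)[OF z] p, folded h_def]
        H.src_division[OF Ay t0(1)[OF z] \<phi>s(1)[OF z] p, folded h_def]
        H.bact_division[OF Ay t0(1)[OF z] \<phi>s(1)[OF z] p, folded h_def]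
      show hz': "h z \<in> H.arr" "H.tgt (h z) = banch y (\<tau> z)" "H.src (h z) = banch x (\<sigma> z)"
        using hz t0[OF z] \<phi>s[OF z] by simp_all
      have "banch y (\<tau> z) \<in> G.obj" using y ty(1)[OF z] by simp
      then have "bact (A y) (t0 z) (h z) = cls y (\<tau> z, h z)"
        unfolding t0_def using bact_assoc[OF y ty[OF z] hz'(1)] hz' by simp
      then show "\<phi> (s0 z) = cls y (\<tau> z, h z)" using hz(4) by simp
    qed
    have ch: "continuous_map (subtopology U W) (garr H) h"
      unfolding h_def
      by (rule H.continuous_division[OF Ay ct0 continuous_map_compose_apply[OF H.bundle_map_continuous[OF \<phi>] cs0]])
         (use t0 \<phi>s tW in simp)
    \<comment> \<open>Here the local sections of F are used: near \<open>h n\<close> the arrows of H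
      lift continuously to G, so h lifts on the preimage of K.\<close>
    obtain K \<rho> where K: "openin (garr H) K" "h n \<in> K" and \<rho>: "continuous_map (subtopology (garr H) K) (garr G) \<rho>" "\<And>k. k \<in> K \<Longrightarrow> F (\<rho> k) = k"
      using admits_local_sectionsD[OF F_local_sections h(1)[OF W(2)]] by metis
    define V where "V = {z \<in> W. h z \<in> K}"
    have "{z \<in> topspace (subtopology U W). h z \<in> K} = V" using tW by (auto simp: V_def)
    then have V: "openin U V" "n \<in> V" "V \<subseteq> W"
      using openin_trans_full[OF openin_continuous_map_preimage[OF ch K(1)] W(1)] W K(2) by (simp_all add: V_def)
    let ?N = "subtopology U V"
    have tN: "topspace ?N = V" using V(3) W(3) by auto
    have sub: "z \<in> W" if "z \<in> V" for z using that V(3) by blast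
    have \<sigma>V: "continuous_map ?N (btot x) \<sigma>" and \<tau>V: "continuous_map ?N (btot y) \<tau>" and hV: "continuous_map ?N (garr H) h"
      using continuous_map_from_subtopology_mono[OF \<sigma>W V(3)] continuous_map_from_subtopology_mono[OF \<tau>W V(3)]
        continuous_map_from_subtopology_mono[OF ch V(3)] .
    define g where "g z = \<rho> (h z)" for z
    have cg: "continuous_map ?N (garr G) g"
      unfolding g_def by (rule continuous_map_compose_subtopology[OF \<rho>(1) hV]) (use tN in \<open>simp add: V_def\<close>)
    have g: "g z \<in> G.arr" "F (g z) = h z" "G.tgt (g z) = banch y (\<tau> z)" "G.src (g z) = banch x (\<sigma> z)" if z: "z \<in> V" for z
    proof -
      show g1: "g z \<in> G.arr" using continuous_map_topspace[OF cg, of z] z unfolding tN by simp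
      show g2: "F (g z) = h z" unfolding g_def by (rule \<rho>(2)) (use z in \<open>simp add: V_def\<close>)
      show "G.tgt (g z) = banch y (\<tau> z)" "G.src (g z) = banch x (\<sigma> z)"
        using tgt_F[OF g1] src_F[OF g1] h[OF sub[OF z]] g2 by simp_all
    qed
    have inc: "incl ?N U = (?N, U, \<lambda>z\<in>V. z)" using tN by (simp add: incl_def)
    \<comment> \<open>The object required over V is the restriction d of x, with a the restriction
      arrow; only the second arrow, to y, has to be constructed.\<close>
    obtain a d where a: "a \<in> hom_set G.B d x" "base_ar G.B a = incl ?N U" "base_ob G.B d = ?N"
      by (rule G.B.pullback[of x "incl ?N U" ?N]) (use x U incl_hom'[of U V] in auto)
    obtain \<alpha> where \<alpha>: "a = (d, x, \<alpha>, \<lambda>z\<in>V. z)" "(d, x, \<alpha>, \<lambda>z\<in>V. z) \<in> bundle_maps G"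
      using a U inc by (auto simp: classifying_stack_hom)
    have bd: "bbase d = ?N" using a(3) by simp
    note d = G.bundle_map_principal_dom[OF \<alpha>(2)]
    define s where "s z = fibre_inverse d \<alpha> z (\<sigma> z)" for z
    have s: "s z \<in> pts d" "bproj d (s z) = z" "\<alpha> (s z) = \<sigma> z" "banch d (s z) = banch x (\<sigma> z)" if z: "z \<in> V" for z
      unfolding s_def
      using G.fibre_inverse_in[OF \<alpha>(2), of z "\<sigma> z"] G.bproj_fibre_inverse[OF \<alpha>(2), of z "\<sigma> z"]
        G.bundle_map_fibre_inverse[OF \<alpha>(2), of z "\<sigma> z"] G.banch_fibre_inverse[OF \<alpha>(2), of z "\<sigma> z"]
        sx(1)[OF sub[OF z]] \<sigma>(2)[of z] sub[OF z] z subsetD[OF openin_subset[OF V(1)] z] bd by (simp_all add: W_def)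
    have cs: "continuous_map ?N (btot d) s"
      unfolding s_def
      by (rule G.continuous_fibre_inverse[OF \<alpha>(2) _ \<sigma>V])
         (use bd tN \<sigma>(2) V(3) in \<open>auto simp: continuous_map_id[unfolded id_def] W_def\<close>)
    \<comment> \<open>Chosen so that
      \<open>[t z, 1] = [\<tau> z, F (g z)] = [\<tau> z, h z]\<close>, which is the value of \<phi>
      at \<open>[\<sigma> z, 1]\<close>. Sending s to t is therefore a lift of \<phi>.\<close>
    define t where "t z = bact y (\<tau> z) (g z)" for z
    have t: "t z \<in> pts y" "bproj y (t z) = z" "banch y (t z) = banch x (\<sigma> z)" if z: "z \<in> V" for z
      using ty(1)[OF sub[OF z]] \<tau>(2)[of z] sub[OF z] g[OF z] y by (simp_all add: t_def W_def)
    have ct: "continuous_map ?N (btot y) t"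
      unfolding t_def by (rule G.continuous_bact[OF y \<tau>V cg]) (use g tN in simp)
    define \<beta> where "\<beta> = (\<lambda>p\<in>pts d. bact y (t (bproj d p)) (division G d (s (bproj d p)) p))"
    have \<beta>: "(d, y, \<beta>, \<lambda>z\<in>V. z) \<in> bundle_maps G"
      unfolding \<beta>_def
    proof (rule G.bundle_map_from_section[OF d y])
      show "continuous_map (bbase d) (bbase y) (\<lambda>z\<in>V. z)" "(\<lambda>z\<in>V. z) \<in> extensional (topspace (bbase d))"
        using G.bundle_map_continuous_base[OF \<alpha>(2)] G.bundle_map_extensional_base[OF \<alpha>(2)] U by simp_all
      show "continuous_map (bbase d) (btot d) s" "continuous_map (bbase d) (btot y) t" using cs ct bd by simp_all
      fix z assume "z \<in> topspace (bbase d)"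
      then have z: "z \<in> V" using bd tN by simp
      show "bproj d (s z) = z" "bproj y (t z) = (\<lambda>z\<in>V. z) z" "banch y (t z) = banch d (s z)"
        using s[OF z] t[OF z] z by simp_all
    qed
    \<comment> \<open>Write p as \<open>s z\<close> moved by \<delta>. On the left
      \<open>[\<sigma> z, F(\<delta>) k]\<close> is sent by \<phi> to
      \<open>[\<tau> z, h(z) F(\<delta>) k]\<close>. On the right \<open>[t z \<delta>, k]\<close>
      becomes the same class by moving first \<delta> and then \<open>g z\<close> across the
      bracket, as F maps \<open>g z\<close> to \<open>h z\<close>.\<close>
    have key: "\<phi> (assoc_map d x \<alpha> c) = assoc_map d y \<beta> c" if c_in: "c \<in> pts (A d)" for c
    proof -
      obtain p k where p: "p \<in> pts d" "k \<in> H.arr" "banch d p = H.tgt k" and c: "c = cls d (p, k)"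
        using c_in by (rule tot_cases)
      define z where "z = bproj d p"
      have z: "z \<in> V" using G.bproj_in[OF d p(1)] bd tN by (simp add: z_def)
      note zW = sub[OF z]
      define \<delta> where "\<delta> = division G d (s z) p"
      have pz: "bproj d (s z) = bproj d p" using s[OF z] by (simp add: z_def)
      have \<delta>: "\<delta> \<in> G.arr" "G.tgt \<delta> = banch x (\<sigma> z)" "G.src \<delta> = H.tgt k" "bact d (s z) \<delta> = p"
        unfolding \<delta>_def using d s[OF z] p pz by simp_all
      have Fk: "H.cmp (F \<delta>) k \<in> H.arr" "H.tgt (H.cmp (F \<delta>) k) = banch x (\<sigma> z)" using \<delta> p(2) by simp_all
      have "\<alpha> p = bact x (\<sigma> z) \<delta>"
        using G.bundle_map_bact[OF \<alpha>(2) s(1)[OF z] \<delta>(1)] s[OF z] \<delta> by simp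
      then have "cls x (\<alpha> p, k) = cls x (\<sigma> z, H.cmp (F \<delta>) k)"
        using cls_bact[OF x sx(1)[OF zW] \<delta>(1) _ p(2)] \<delta> by simp
      also have "\<dots> = bact (A x) (s0 z) (H.cmp (F \<delta>) k)"
        unfolding s0_def using bact_assoc[OF x sx[OF zW] Fk(1)] Fk x sx(1)[OF zW] by simp
      finally have "\<phi> (cls x (\<alpha> p, k)) = bact (A y) (\<phi> (s0 z)) (H.cmp (F \<delta>) k)"
        using H.bundle_map_bact[OF \<phi> s0(1)[OF zW] Fk(1)] s0(3)[OF zW] Fk(2) by simp
      also have "\<dots> = cls y (\<tau> z, H.cmp (h z) (H.cmp (F \<delta>) k))"
        unfolding h(4)[OF zW]
        by (rule bact_assoc[OF y ty(1)[OF zW] h(1)[OF zW] _ Fk(1)]) (use h(2,3)[OF zW] Fk in simp_all)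
      also have "H.cmp (h z) (H.cmp (F \<delta>) k) = H.cmp (F (g z)) (H.cmp (F \<delta>) k)" using g(2)[OF z] by simp
      also have "cls y (\<tau> z, \<dots>) = cls y (t z, H.cmp (F \<delta>) k)"
        unfolding t_def
        by (rule cls_bact[OF y ty(1)[OF zW] g(1)[OF z] _ Fk(1), symmetric]) (use g[OF z] Fk in simp_all)
      also have "\<dots> = cls y (bact y (t z) \<delta>, k)"
        by (rule cls_bact[OF y t(1)[OF z] \<delta>(1) _ p(2), symmetric]) (use t[OF z] \<delta> in simp_all)
      also have "bact y (t z) \<delta> = \<beta> p" using p(1) by (simp add: \<beta>_def \<delta>_def z_def)
      finally show ?thesis
        unfolding c using assoc_map_cls[OF \<alpha>(2) p] assoc_map_cls[OF \<beta> p] by simp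
    qed
    have "compose (pts (A d)) \<phi> (assoc_map d x \<alpha>) = assoc_map d y \<beta>"
      by (rule extensionalityI[where A = "pts (A d)"])
         (auto simp: compose_def assoc_map_def[of d y] key simp del: assoc_bundle_simps intro: key)
    moreover have "compose (topspace ?N) (\<lambda>z\<in>topspace U. z) (\<lambda>z\<in>V. z) = (\<lambda>z\<in>V. z)"
      unfolding tN using V(3) W(3) by (auto simp: compose_def fun_eq_iff)
    ultimately have "Cmp H.B \<phi>' (on_ar f_assoc a) = on_ar f_assoc (d, y, \<beta>, \<lambda>z\<in>V. z)"
      unfolding \<phi>' \<alpha>(1) by (simp add: bd del: assoc_bundle_simps(1))
    moreover have "(d, y, \<beta>, \<lambda>z\<in>V. z) \<in> hom_set G.B d y" "base_ar G.B (d, y, \<beta>, \<lambda>z\<in>V. z) = incl ?N U" "d \<in> Ob G.B"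
      using \<beta> d bd U inc by (simp_all add: classifying_stack_hom)
    ultimately show "\<exists>V. openin U V \<and> n \<in> V \<and> (\<exists>d\<in>Ob G.B. base_ob G.B d = subtopology U V \<and>
        (\<exists>a\<in>hom_set G.B d x. \<exists>b\<in>hom_set G.B d y. base_ar G.B a = incl (subtopology U V) U \<and> base_ar G.B b = incl (subtopology U V) U \<and>
          Cmp H.B \<phi>' (on_ar f_assoc a) = on_ar f_assoc b))"
      using V(1,2) a by blast
  qed
qed

end

theorem theorem6p3p5:
  fixes G H :: "'u tgpd" and F :: "'u \<Rightarrow> 'u"
  assumes "infinite (UNIV :: 'u set)"
    and "groupoid_extension G H F"
  shows "gerbe (classifying_stack G) (classifying_stack H) (assoc_morphism G H F)"
proof -
  interpret gpd_extension G H F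
    using assms by unfold_locales (auto simp: groupoid_extension_def)
  show ?thesis
    unfolding gerbe_def
    using G.topological_stack_classifying_stack H.topological_stack_classifying_stack stack_morphism_assoc
      epimorphism_assoc epimorphism_diagonal_assoc by blast
qed

end
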